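(* There exists a bounded domain $D\subset\mathbb{C}$ such that $\liminf_{D\ni z\to\partial D}K_D(z)<\infty$ and $D$ is Bergman complete.
   Context: For a bounded domain $D\subset\mathbb{C}$, $L_h^2(D)$ denotes the Hilbert space of holomorphic functions on $D$ that are square integrable with respect to Lebesgue measure, with norm $\|\cdot\|_{L^2(D)}$. The Bergman kernel (on the diagonal) of $D$ is $$K_D(z)=\sup\left\{\frac{|f(z)|^2}{\|f\|_{L^2(D)}^2}: f\in L_h^2(D),\ f\not\equiv 0\right\},\quad z\in D.$$ The function $\log K_D$ is smooth and subharmonic, and the Bergman pseudometric is $$\beta_D(z;X)=\left(\frac{\partial^2\log K_D(z)}{\partial z\,\partial\bar z}\,|X|^2\right)^{1/2},\quad z\in D,\ X\in\mathbb{C}.$$ The Bergman distance is $b_D(w,z)=\inf_\alpha\int_0^1\beta_D(\alpha(t);\alpha'(t))\,dt$, the infimum being over all piecewise $C^1$ curves $\alpha:[0,1]\to D$ joining $w$ and $z$. The bounded domain $D$ is called Bergman complete if every $b_D$-Cauchy sequence converges to some point of $D$ in the standard (Euclidean) topology of $D$. The condition $\liminf_{D\ni z\to\partial D}K_D(z)<\infty$ means that there is a sequence $(z_k)$ in $D$ whose Euclidean distance to $\partial D$ tends to $0$ and along which $K_D(z_k)$ stays bounded. *)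

theory Defs
  imports "HOL-Analysis.Analysis"
begin

definition bounded_domain :: "complex set \<Rightarrow> bool" where
  "bounded_domain D \<longleftrightarrow> open D \<and> connected D \<and> D \<noteq> {} \<and> bounded D"

definition L2h :: "complex set \<Rightarrow> (complex \<Rightarrow> complex) set" where
  "L2h D = {f. f holomorphic_on D \<and> set_integrable lborel D (\<lambda>z. (cmod (f z))\<^sup>2)}"

definition L2_norm :: "complex set \<Rightarrow> (complex \<Rightarrow> complex) \<Rightarrow> real" where
  "L2_norm D f = sqrt (LINT z:D|lborel. (cmod (f z))\<^sup>2)"

(* For bounded open D the set below is nonempty (constants) and, at points of D, bounded
   above (mean value property), so the real supremum is the intended one. *)
definition bergman_kernel :: "complex set \<Rightarrow> complex \<Rightarrow> real" where
  "bergman_kernel D z =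
     Sup {(cmod (f z))\<^sup>2 / (L2_norm D f)\<^sup>2 | f. f \<in> L2h D \<and> (\<exists>w\<in>D. f w \<noteq> 0)}"

definition partial_x :: "(complex \<Rightarrow> complex) \<Rightarrow> complex \<Rightarrow> complex" where
  "partial_x u z = vector_derivative (\<lambda>t::real. u (z + of_real t)) (at 0)"

definition partial_y :: "(complex \<Rightarrow> complex) \<Rightarrow> complex \<Rightarrow> complex" where
  "partial_y u z = vector_derivative (\<lambda>t::real. u (z + \<i> * of_real t)) (at 0)"

definition wirtinger_z :: "(complex \<Rightarrow> complex) \<Rightarrow> complex \<Rightarrow> complex" where
  "wirtinger_z u z = (partial_x u z - \<i> * partial_y u z) / 2"

definition wirtinger_zbar :: "(complex \<Rightarrow> complex) \<Rightarrow> complex \<Rightarrow> complex" where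
  "wirtinger_zbar u z = (partial_x u z + \<i> * partial_y u z) / 2"

(* The mixed Wirtinger derivative of a real-valued smooth function is a quarter of its
   Laplacian, hence real, so Re discards nothing. *)
definition bergman_metric :: "complex set \<Rightarrow> complex \<Rightarrow> complex \<Rightarrow> real" where
  "bergman_metric D z X =
     sqrt (Re (wirtinger_z (wirtinger_zbar (\<lambda>w. of_real (ln (bergman_kernel D w)))) z)
           * (cmod X)\<^sup>2)"

(* The library predicate piecewise_C1_differentiable_on does not require one-sided limits of the
   derivative at the break points, so it also admits curves of infinite length; here every
   closed piece is C^1, with one-sided derivatives at its ends. *)
definition piecewise_C1_curve :: "(real \<Rightarrow> complex) \<Rightarrow> bool" where
  "piecewise_C1_curve \<alpha> \<longleftrightarrow>
     (\<exists>(n::nat) (t::nat \<Rightarrow> real). t 0 = 0 \<and> t n = 1 \<and> (\<forall>i<n. t i < t (Suc i)) \<and>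
        (\<forall>i<n. \<exists>\<alpha>'. continuous_on {t i..t (Suc i)} \<alpha>' \<and>
           (\<forall>s\<in>{t i..t (Suc i)}.
              (\<alpha> has_vector_derivative \<alpha>' s) (at s within {t i..t (Suc i)}))))"

(* The two-sided derivative is undetermined only at the break points and at 0 and 1,
   a null set. *)
definition bergman_length :: "complex set \<Rightarrow> (real \<Rightarrow> complex) \<Rightarrow> ennreal" where
  "bergman_length D \<alpha> =
     (\<integral>\<^sup>+t\<in>{0..1}. ennreal (bergman_metric D (\<alpha> t) (vector_derivative \<alpha> (at t))) \<partial>lborel)"

definition bergman_dist :: "complex set \<Rightarrow> complex \<Rightarrow> complex \<Rightarrow> ennreal" where
  "bergman_dist D w z =
     Inf {bergman_length D \<alpha> | \<alpha>. piecewise_C1_curve \<alpha> \<and> path_image \<alpha> \<subseteq> D \<and>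
                                   pathstart \<alpha> = w \<and> pathfinish \<alpha> = z}"

definition bergman_Cauchy :: "complex set \<Rightarrow> (nat \<Rightarrow> complex) \<Rightarrow> bool" where
  "bergman_Cauchy D x \<longleftrightarrow> (\<forall>k. x k \<in> D) \<and>
     (\<forall>\<epsilon>>0. \<exists>N. \<forall>m\<ge>N. \<forall>n\<ge>N. bergman_dist D (x m) (x n) < ennreal \<epsilon>)"

definition bergman_complete :: "complex set \<Rightarrow> bool" where
  "bergman_complete D \<longleftrightarrow> (\<forall>x. bergman_Cauchy D x \<longrightarrow> (\<exists>l\<in>D. x \<longlonglongrightarrow> l))"

(* liminf of K_D(z), as z in D tends to the boundary of D, is finite. *)
definition finite_boundary_liminf :: "complex set \<Rightarrow> bool" where
  "finite_boundary_liminf D \<longleftrightarrow>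
     (\<exists>z::nat \<Rightarrow> complex. (\<forall>k. z k \<in> D) \<and> (\<lambda>k. infdist (z k) (frontier D)) \<longlonglongrightarrow> 0 \<and>
        (\<exists>C. \<forall>k. bergman_kernel D (z k) \<le> C))"

end

theory Submission
  imports Defs "HOL-Complex_Analysis.Complex_Analysis"
begin

text \<open>The domain is the unit disc without the origin and without discs \<open>B(a\<^sub>n, r\<^sub>n)\<close>, where
  \<open>a\<^sub>n\<close> tends to \<open>0\<close> and \<open>ln (1 / r\<^sub>n)\<close> is about \<open>(n / a\<^sub>n)\<^sup>2\<close>. Away from the holes the
  \<open>n\<close>-th one contributes about \<open>1 / (a\<^sub>n\<^sup>2 ln (1 / r\<^sub>n)) = 1 / n\<^sup>2\<close> to the kernel, so the kernel stays
  bounded there. The functions \<open>1 + (a\<^sub>n - w) / (z - a\<^sub>n)\<close> show that crossing the annulus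
  \<open>a\<^sub>n / 8 \<le> |z| \<le> a\<^sub>n / 4\<close> has Bergman length of order \<open>1 / (a\<^sub>n \<surd>(ln (1 / r\<^sub>n))) = 1 / n\<close>,
  and the harmonic series diverges, so that the origin is infinitely far away. At the boundary circles the
  metric dominates a multiple of the inverse distance to the circle.

  Kernel bounds come from writing \<open>f w\<close> as an area integral of \<open>f\<close> against
  the gradient of a cutoff function, divided by \<open>z - w\<close>; logarithmic cutoffs around the holes make the
  \<open>L\<^sup>2\<close> norm of this weight small.\<close>

section \<open>The space of square integrable holomorphic functions\<close>

text \<open>A kernel that stays bounded along a sequence tending to the boundary rules out
  completeness by exhaustion, so the metric itself must push every boundary point to infinity. The
  room for this is a square root: the kernel sees the sum of 1/n^2, the metric the sum of its square
  roots. For any f vanishing at w, the squared metric at w is at least |f'(w)|^2 divided by the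
  squared norm of f and by the kernel, so upper bounds for the kernel serve both halves of the
  theorem. The centres decrease faster than geometrically. The cutoff that removes the origin
  together with all later holes then has a logarithmic ratio that grows with its index, and for each
  w it can be placed so deep that its energy is at most 1; a fixed ratio would leave a term of order
  1/|w|^2. Distances are bounded below by functions whose gradient the metric dominates. Each
  boundary component gets its own function, with no uniformity between components, because a
  Euclidean cluster point of a Cauchy sequence lies on at most one of them.\<close>

lemma Cauchy_Schwarz_integral:
  fixes F G :: "'a \<Rightarrow> real"
  assumes [measurable]: "F \<in> borel_measurable M" "G \<in> borel_measurable M"
    and F: "integrable M (\<lambda>x. (F x)\<^sup>2)" and G: "integrable M (\<lambda>x. (G x)\<^sup>2)"
  shows "integrable M (\<lambda>x. F x * G x)"
    and "(\<integral>x. F x * G x \<partial>M)\<^sup>2 \<le> (\<integral>x. (F x)\<^sup>2 \<partial>M) * (\<integral>x. (G x)\<^sup>2 \<partial>M)"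
proof -
  show FG: "integrable M (\<lambda>x. F x * G x)"
  proof (rule Bochner_Integration.integrable_bound[OF Bochner_Integration.integrable_add[OF F G]])
    show "AE x in M. norm (F x * G x) \<le> norm ((F x)\<^sup>2 + (G x)\<^sup>2)"
    proof (rule AE_I2)
      fix x
      have "2 * (\<bar>F x\<bar> * \<bar>G x\<bar>) \<le> (F x)\<^sup>2 + (G x)\<^sup>2"
        using sum_squares_bound[of "\<bar>F x\<bar>" "\<bar>G x\<bar>"] by simp
      moreover have "0 \<le> \<bar>F x\<bar> * \<bar>G x\<bar>" by simp
      ultimately show "norm (F x * G x) \<le> norm ((F x)\<^sup>2 + (G x)\<^sup>2)"
        unfolding real_norm_def abs_mult by linarith
    qed
  qed simp
  let ?a = "\<integral>x. (F x)\<^sup>2 \<partial>M" and ?b = "\<integral>x. F x * G x \<partial>M" and ?c = "\<integral>x. (G x)\<^sup>2 \<partial>M"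
  have quad: "0 \<le> ?a - 2 * t * ?b + t\<^sup>2 * ?c" for t :: real
  proof -
    have "0 \<le> (\<integral>x. (F x - t * G x)\<^sup>2 \<partial>M)" by simp
    also have "(\<lambda>x. (F x - t * G x)\<^sup>2) = (\<lambda>x. (F x)\<^sup>2 - 2 * t * (F x * G x) + t\<^sup>2 * (G x)\<^sup>2)"
      by (auto simp: power2_eq_square algebra_simps)
    also have "(\<integral>x. (F x)\<^sup>2 - 2 * t * (F x * G x) + t\<^sup>2 * (G x)\<^sup>2 \<partial>M) = ?a - 2 * t * ?b + t\<^sup>2 * ?c"
      using F G FG by simp
    finally show ?thesis .
  qed
  have c0: "0 \<le> ?c" by simp
  show "?b\<^sup>2 \<le> ?a * ?c"
  proof (cases "?c = 0")
    case True
    have "?b = 0"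
    proof (rule ccontr)
      assume "?b \<noteq> 0"
      \<comment> \<open>With leading coefficient 0 the expression is linear in t, and at this t it
        equals -1.\<close>
      then show False using quad[of "(?a + 1) / (2 * ?b)"] True by simp
    qed
    then show ?thesis using True by simp
  next
    case False
    then have "0 < ?c" using c0 by linarith
    then show ?thesis using quad[of "?b / ?c"] by (simp add: field_simps power2_eq_square)
  qed
qed

definition sqnorm :: "complex set \<Rightarrow> (complex \<Rightarrow> complex) \<Rightarrow> real" where
  "sqnorm D f = (LINT z:D|lborel. (cmod (f z))\<^sup>2)"

definition L2_inner :: "complex set \<Rightarrow> (complex \<Rightarrow> complex) \<Rightarrow> (complex \<Rightarrow> complex) \<Rightarrow> complex" where
  "L2_inner D f g = (LINT z:D|lborel. f z * cnj (g z))"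

lemma sqnorm_nonneg: "0 \<le> sqnorm D f"
  unfolding sqnorm_def set_lebesgue_integral_def by simp

lemma L2_norm_power2: "(L2_norm D f)\<^sup>2 = sqnorm D f"
  unfolding L2_norm_def using sqnorm_nonneg by (simp add: sqnorm_def)

lemma set_borel_measurable_continuous_on_open:
  fixes f :: "complex \<Rightarrow> 'b::real_normed_vector"
  assumes "open D" "continuous_on D f"
  shows "set_borel_measurable lborel D f"
  using borel_measurable_continuous_on_indicator[of D f] assms
  unfolding set_borel_measurable_def by simp

lemma L2h_inner_integrable:
  assumes D: "open D" and f: "f \<in> L2h D" and g: "g \<in> L2h D"
  shows "set_integrable lborel D (\<lambda>z. f z * cnj (g z))"
proof -
  have "continuous_on D f" "continuous_on D g"
    using f g by (auto simp: L2h_def intro: holomorphic_on_imp_continuous_on)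
  then have "continuous_on D (\<lambda>z. f z * cnj (g z))" by (intro continuous_intros)
  then have meas: "(\<lambda>z. indicat_real D z *\<^sub>R (f z * cnj (g z))) \<in> borel_measurable lborel"
    using set_borel_measurable_continuous_on_open[OF D] unfolding set_borel_measurable_def by blast
  have "integrable lborel (\<lambda>z. indicat_real D z *\<^sub>R (cmod (f z))\<^sup>2 + indicat_real D z *\<^sub>R (cmod (g z))\<^sup>2)"
    using f g by (auto simp: L2h_def set_integrable_def)
  then show ?thesis
    unfolding set_integrable_def
  proof (rule Bochner_Integration.integrable_bound[OF _ meas], intro AE_I2)
    fix z
    have "2 * (cmod (f z) * cmod (g z)) \<le> (cmod (f z))\<^sup>2 + (cmod (g z))\<^sup>2"
      using sum_squares_bound[of "cmod (f z)" "cmod (g z)"] by simp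
    moreover have "0 \<le> cmod (f z) * cmod (g z)" by simp
    ultimately have "cmod (f z) * cmod (g z) \<le> (cmod (f z))\<^sup>2 + (cmod (g z))\<^sup>2" by linarith
    then show "norm (indicat_real D z *\<^sub>R (f z * cnj (g z)))
        \<le> norm (indicat_real D z *\<^sub>R (cmod (f z))\<^sup>2 + indicat_real D z *\<^sub>R (cmod (g z))\<^sup>2)"
      by (auto simp: indicator_def norm_mult)
  qed
qed

lemma cmod_add_mult_power2:
  "(cmod (a + c * b))\<^sup>2 = (cmod a)\<^sup>2 + 2 * Re (cnj c * (a * cnj b)) + (cmod c)\<^sup>2 * (cmod b)\<^sup>2"
  unfolding cmod_power2 by (simp add: power2_eq_square algebra_simps)

lemma
  assumes D: "open D" and f: "f \<in> L2h D" and g: "g \<in> L2h D"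
  shows L2h_add_mult: "(\<lambda>z. f z + c * g z) \<in> L2h D"
    and sqnorm_add_mult: "sqnorm D (\<lambda>z. f z + c * g z) = sqnorm D f + 2 * Re (cnj c * L2_inner D f g) + (cmod c)\<^sup>2 * sqnorm D g"
proof -
  note I = L2h_inner_integrable[OF D f g]
  have fi: "set_integrable lborel D (\<lambda>z. (cmod (f z))\<^sup>2)" and gi: "set_integrable lborel D (\<lambda>z. (cmod (g z))\<^sup>2)"
    using f g by (auto simp: L2h_def)
  have gi': "set_integrable lborel D (\<lambda>z. (cmod c)\<^sup>2 * (cmod (g z))\<^sup>2)" using gi by simp
  have cI: "set_integrable lborel D (\<lambda>z. cnj c * (f z * cnj (g z)))" using I by simp
  have RI: "set_integrable lborel D (\<lambda>z. 2 * Re (cnj c * (f z * cnj (g z))))"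
  proof -
    have "integrable lborel (\<lambda>z. 2 * Re (indicat_real D z *\<^sub>R (cnj c * (f z * cnj (g z)))))"
      using cI unfolding set_integrable_def by (intro integrable_mult_right integrable_Re)
    moreover have "2 * Re (indicat_real D z *\<^sub>R (cnj c * (f z * cnj (g z))))
        = indicat_real D z *\<^sub>R (2 * Re (cnj c * (f z * cnj (g z))))" for z
      by (simp only: scaleR_complex.simps real_scaleR_def mult.left_commute)
    ultimately show ?thesis unfolding set_integrable_def by (simp only:)
  qed
  show "(\<lambda>z. f z + c * g z) \<in> L2h D"
    unfolding L2h_def mem_Collect_eq cmod_add_mult_power2
    using f g fi RI gi' by (auto simp: L2h_def intro!: holomorphic_intros set_integral_add)
  have "sqnorm D (\<lambda>z. f z + c * g z) = sqnorm D f + (LINT z:D|lborel. 2 * Re (cnj c * (f z * cnj (g z)))) + (cmod c)\<^sup>2 * sqnorm D g"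
    unfolding sqnorm_def cmod_add_mult_power2 using fi RI gi' by (simp add: set_integral_add)
  also have "(LINT z:D|lborel. 2 * Re (cnj c * (f z * cnj (g z)))) = 2 * Re (LINT z:D|lborel. cnj c * (f z * cnj (g z)))"
  proof -
    have "(LINT z:D|lborel. 2 * Re (cnj c * (f z * cnj (g z))))
        = (LINT z|lborel. 2 * Re (indicat_real D z *\<^sub>R (cnj c * (f z * cnj (g z)))))"
      unfolding set_lebesgue_integral_def
      by (rule Bochner_Integration.integral_cong[OF refl])
         (simp only: scaleR_complex.simps real_scaleR_def mult.left_commute)
    also have "\<dots> = 2 * Re (LINT z:D|lborel. cnj c * (f z * cnj (g z)))"
      unfolding set_lebesgue_integral_def integral_mult_right_zero
      using cI unfolding set_integrable_def by (simp only: integral_Re)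
    finally show ?thesis .
  qed
  also have "(LINT z:D|lborel. cnj c * (f z * cnj (g z))) = cnj c * L2_inner D f g"
    unfolding L2_inner_def by simp
  finally show "sqnorm D (\<lambda>z. f z + c * g z) = sqnorm D f + 2 * Re (cnj c * L2_inner D f g) + (cmod c)\<^sup>2 * sqnorm D g" .
qed

lemma L2_inner_add_mult_left:
  assumes "open D" "f \<in> L2h D" "g \<in> L2h D" "h \<in> L2h D"
  shows "L2_inner D (\<lambda>z. f z + c * g z) h = L2_inner D f h + c * L2_inner D g h"
proof -
  note 1 = L2h_inner_integrable[OF assms(1,2,4)] and 2 = L2h_inner_integrable[OF assms(1,3,4)]
  have "set_integrable lborel D (\<lambda>z. c * (g z * cnj (h z)))" using 2 by simp
  then have "(LINT z:D|lborel. f z * cnj (h z) + c * (g z * cnj (h z))) = L2_inner D f h + c * L2_inner D g h"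
    unfolding L2_inner_def using 1 by (simp add: set_integral_add)
  then show ?thesis unfolding L2_inner_def by (simp add: algebra_simps)
qed

lemma L2_inner_cnj: "L2_inner D g f = cnj (L2_inner D f g)"
proof -
  have "cnj (L2_inner D f g) = (LINT z|lborel. cnj (indicat_real D z *\<^sub>R (f z * cnj (g z))))"
    unfolding L2_inner_def set_lebesgue_integral_def by (rule Bochner_Integration.integral_cnj[symmetric])
  also have "\<dots> = L2_inner D g f"
    unfolding L2_inner_def set_lebesgue_integral_def
    by (rule Bochner_Integration.integral_cong) (auto simp: mult.commute)
  finally show ?thesis by simp
qed

lemma L2_inner_self:  "L2_inner D f f = of_real (sqnorm D f)"
  unfolding L2_inner_def sqnorm_def complex_norm_square[symmetric] set_lebesgue_integral_def
  by (subst integral_complex_of_real[symmetric])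
     (auto intro!: Bochner_Integration.integral_cong simp: scaleR_conv_of_real)

lemma L2h_Cauchy_Schwarz:
  assumes D: "open D" and f: "f \<in> L2h D" and g: "g \<in> L2h D"
  shows "(cmod (L2_inner D f g))\<^sup>2 \<le> sqnorm D f * sqnorm D g"
proof (cases "sqnorm D g = 0")
  case True
  have "L2_inner D f g = 0"
  proof (rule ccontr)
    assume nz: "L2_inner D f g \<noteq> 0"
    \<comment> \<open>Only the linear term in c survives; this t makes the squared norm of f + c g
      equal to \<open>- sqnorm D f - 2\<close>.\<close>
    define t where "t = (sqnorm D f + 1) / (cmod (L2_inner D f g))\<^sup>2"
    define c where "c = - of_real t * L2_inner D f g"
    have "cnj c * L2_inner D f g = - of_real (t * (cmod (L2_inner D f g))\<^sup>2)"
      unfolding c_def of_real_mult complex_norm_square by simp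
    also have "t * (cmod (L2_inner D f g))\<^sup>2 = sqnorm D f + 1" using nz by (simp add: t_def)
    finally have "Re (cnj c * L2_inner D f g) = - (sqnorm D f + 1)" by simp
    moreover have "0 \<le> sqnorm D f + 2 * Re (cnj c * L2_inner D f g)"
      using sqnorm_nonneg[of D "\<lambda>z. f z + c * g z"] sqnorm_add_mult[OF assms, of c] True by simp
    ultimately show False using sqnorm_nonneg[of D f] by simp
  qed
  then show ?thesis using True by simp
next
  case False
  then have pos: "0 < sqnorm D g" using sqnorm_nonneg[of D g] by simp
  \<comment> \<open>With this c, f + c g is the component of f orthogonal to g.\<close>
  define c where "c = - L2_inner D f g / of_real (sqnorm D g)"
  have "0 \<le> sqnorm D f + 2 * Re (cnj c * L2_inner D f g) + (cmod c)\<^sup>2 * sqnorm D g"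
    using sqnorm_nonneg[of D "\<lambda>z. f z + c * g z"] sqnorm_add_mult[OF assms, of c] by simp
  also have "cnj c * L2_inner D f g = of_real (- (cmod (L2_inner D f g))\<^sup>2 / sqnorm D g)"
    unfolding c_def by (simp add: complex_norm_square[symmetric] mult.commute del: of_real_power)
  also have "cmod c = cmod (L2_inner D f g) / sqnorm D g"
    unfolding c_def using pos by (simp add: norm_divide)
  finally show ?thesis using pos by (simp add: field_simps power2_eq_square)
qed

text \<open>By continuity the set where f does not vanish is open, and an open null set is
  empty.\<close>

lemma sqnorm_eq_0_imp:
  assumes D: "open D" and f: "f \<in> L2h D" and 0: "sqnorm D f = 0" and z: "z \<in> D"
  shows "f z = 0"
proof (rule ccontr)
  assume nz: "f z \<noteq> 0"
  have cont: "continuous_on D f" using f by (auto simp: L2h_def intro: holomorphic_on_imp_continuous_on)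
  have op: "open {w \<in> D. f w \<noteq> 0}"
    using continuous_open_preimage[OF cont D, of "- {0}"] by (simp add: vimage_def Int_def open_Compl)
  have "AE w in lborel. indicat_real D w *\<^sub>R (cmod (f w))\<^sup>2 = 0"
    using f 0 unfolding L2h_def sqnorm_def set_integrable_def set_lebesgue_integral_def
    by (subst integral_nonneg_eq_0_iff_AE[symmetric]) auto
  then have "AE w in lborel. w \<notin> {w \<in> D. f w \<noteq> 0}" by eventually_elim auto
  then have "AE w in lebesgue. w \<notin> {w \<in> D. f w \<noteq> 0}" by (rule AE_completion)
  then have "negligible {w \<in> D. f w \<noteq> 0}"
    by (simp add: negligible_iff_null_sets AE_iff_null_sets op)
  then show False using op z nz open_not_negligible[OF op] by blast
qed

section \<open>Logarithmic cutoffs and a plane Stokes identity\<close>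

text \<open>The squared positive part is C^1 on the whole line; the cutoffs and
  \<open>root_ramp\<close> are smoothed with it.\<close>

definition pos_sq :: "real \<Rightarrow> real" where "pos_sq x = (max 0 x)\<^sup>2"

lemma pos_sq_nonneg [simp]: "0 \<le> pos_sq x"
  by (simp add: pos_sq_def)

lemma has_derivative_pos_sq: "(pos_sq has_real_derivative 2 * max 0 x) (at x)"
  unfolding has_field_derivative_def has_derivative_at
proof (intro conjI bounded_linear_mult_right)
  \<comment> \<open>The first-order remainder is at most quadratic in each of the four sign cases,
    so the kink at 0 needs no separate treatment.\<close>
  have *: "\<bar>pos_sq y - pos_sq x - 2 * max 0 x * (y - x)\<bar> \<le> (y - x)\<^sup>2" for y
  proof (cases "x \<ge> 0"; cases "y \<ge> 0")
    assume "x \<ge> 0" "y \<ge> 0"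
    then have "pos_sq y - pos_sq x - 2 * max 0 x * (y - x) = (y - x)\<^sup>2"
      by (simp add: pos_sq_def power2_eq_square algebra_simps)
    then show ?thesis by simp
  next
    assume xy: "x \<ge> 0" "\<not> y \<ge> 0"
    then have "pos_sq y - pos_sq x - 2 * max 0 x * (y - x) = x\<^sup>2 - 2 * x * y"
      by (simp add: pos_sq_def power2_eq_square algebra_simps)
    moreover have "x * y \<le> 0" using xy by (simp add: mult_nonneg_nonpos)
    moreover have "(y - x)\<^sup>2 = y\<^sup>2 - 2 * x * y + x\<^sup>2"  by (simp add: power2_eq_square algebra_simps)
    moreover have "0 \<le> x\<^sup>2" "0 \<le> y\<^sup>2" by simp_all
    ultimately show ?thesis by linarith
  next
    assume xy: "\<not> x \<ge> 0" "y \<ge> 0"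
    then show ?thesis by (simp add: pos_sq_def)
  next
    assume xy: "\<not> x \<ge> 0" "\<not> y \<ge> 0"
    then show ?thesis by (simp add: pos_sq_def)
  qed
  show "(\<lambda>h. norm (pos_sq (x + h) - pos_sq x - 2 * max 0 x * h) / norm h) \<midarrow>0\<rightarrow> 0"
  proof (rule Lim_null_comparison)
    show "(\<lambda>h::real. \<bar>h\<bar>) \<midarrow>0\<rightarrow> 0" by (rule tendsto_rabs_zero[OF tendsto_ident_at])
    show "\<forall>\<^sub>F h in at 0. norm (norm (pos_sq (x + h) - pos_sq x - 2 * max 0 x * h) / norm h) \<le> \<bar>h\<bar>"
    proof (intro eventually_at_filter[THEN iffD2] always_eventually allI impI)
      fix h :: real assume "h \<noteq> 0"
      then show "norm (norm (pos_sq (x + h) - pos_sq x - 2 * max 0 x * h) / norm h) \<le> \<bar>h\<bar>"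
        using *[of "x + h"] by (simp add: divide_le_eq power2_eq_square abs_mult_self_eq)
    qed
  qed
qed

abbreviation ln_ratio :: "real \<Rightarrow> real \<Rightarrow> real \<Rightarrow> real" where
  "ln_ratio A B t \<equiv> (ln t - ln A) / (ln B - ln A)"

text \<open>A C^1 transition from 1 to 0, on a logarithmic scale, between t = A and t = B. The
  argument t will be a squared distance. The inner \<open>pos_sq\<close> flattens the transition at
  A, the outer one at B; the case split keeps nonpositive t away from \<open>ln\<close>.\<close>

definition logcut :: "real \<Rightarrow> real \<Rightarrow> real \<Rightarrow> real" where
  "logcut A B t = (if t \<le> A then 1 else pos_sq (1 - pos_sq (ln_ratio A B t)))"

definition logcut' :: "real \<Rightarrow> real \<Rightarrow> real \<Rightarrow> real" where
  "logcut' A B t = (if t \<le> A then 0 else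
     - (4 * max 0 (1 - pos_sq (ln_ratio A B t)) * max 0 (ln_ratio A B t))
       / (t * (ln B - ln A)))"

context
  fixes A B :: real
  assumes AB: "0 < A" "A < B"
begin

lemma logcut_ln_pos: "0 < ln B - ln A"
  using AB by simp

text \<open>One formula is valid for all positive t, across A as well. Together with the constant
  branch on t < A this covers the line by two open sets, so neither differentiability nor continuity
  needs an argument at the point A.\<close>

lemma logcut_pos_eq:
  assumes "0 < t"
  shows "logcut A B t = pos_sq (1 - pos_sq (ln_ratio A B t))"
    and "logcut' A B t = - (4 * max 0 (1 - pos_sq (ln_ratio A B t)) * max 0 (ln_ratio A B t))
       / (t * (ln B - ln A))"
proof -
  have "max 0 (ln_ratio A B t) = 0" if "t \<le> A"
    using that assms AB by (simp add: divide_nonpos_pos)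
  then show "logcut A B t = pos_sq (1 - pos_sq (ln_ratio A B t))"
    "logcut' A B t = - (4 * max 0 (1 - pos_sq (ln_ratio A B t)) * max 0 (ln_ratio A B t))
       / (t * (ln B - ln A))"
    by (auto simp: logcut_def logcut'_def pos_sq_def)
qed

lemma has_derivative_logcut: "(logcut A B has_real_derivative logcut' A B t) (at t)"
proof (cases "t < A")
  case True
  have "((\<lambda>_. 1) has_real_derivative 0) (at t)" by simp
  then have "(logcut A B has_real_derivative 0) (at t)"
    by (rule DERIV_cong_ev[THEN iffD1, OF refl _ refl, rotated])
       (auto simp: logcut_def intro!: eventually_mono[OF order_tendstoD(2)[OF tendsto_ident_at True]]
         intro: eventually_mono[OF eventually_nhds_in_open[of "{..<A}" t]] True)
  then show ?thesis using True by (simp add: logcut'_def)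
next
  case False
  then have t: "0 < t" using AB by simp
  let ?u = "\<lambda>t. ln_ratio A B t"
  have u: "(?u has_real_derivative (1 / t) / (ln B - ln A)) (at t)"
    using t logcut_ln_pos by (auto intro!: derivative_eq_intros)
  have "((\<lambda>t. pos_sq (1 - pos_sq (?u t))) has_real_derivative
      2 * max 0 (1 - pos_sq (?u t)) * (0 - 2 * max 0 (?u t) * ((1 / t) / (ln B - ln A)))) (at t)"
    by (rule DERIV_chain2[OF has_derivative_pos_sq] DERIV_diff DERIV_const u)+
  also have "2 * max 0 (1 - pos_sq (?u t)) * (0 - 2 * max 0 (?u t) * ((1 / t) / (ln B - ln A))) = logcut' A B t"
    unfolding logcut_pos_eq(2)[OF t] by simp
  finally show ?thesis
  proof (rule DERIV_cong_ev[THEN iffD1, OF refl _ refl, rotated])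
    show "\<forall>\<^sub>F x in nhds t. pos_sq (1 - pos_sq (?u x)) = logcut A B x"
      using eventually_nhds_in_open[of "{0<..}" t] t
      by (auto elim!: eventually_mono simp: logcut_pos_eq(1))
  qed
qed

lemma continuous_logcut': "continuous_on UNIV (logcut' A B)"
proof -
  have pos_sq: "continuous_on UNIV pos_sq" unfolding pos_sq_def by (intro continuous_intros)
  have 1: "continuous_on {..<A} (logcut' A B)"
    by (rule continuous_on_eq[of _ "\<lambda>_. 0"]) (auto simp: logcut'_def)
  have "continuous_on {0<..} (\<lambda>t. - (4 * max 0 (1 - pos_sq (ln_ratio A B t)) * max 0 (ln_ratio A B t))
       / (t * (ln B - ln A)))"
    using logcut_ln_pos unfolding pos_sq_def by (intro continuous_intros) auto
  then have 2: "continuous_on {0<..} (logcut' A B)"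
    by (rule continuous_on_eq) (simp add: logcut_pos_eq(2))
  have "continuous_on ({..<A} \<union> {0<..}) (logcut' A B)"
    by (rule continuous_on_open_Un[OF _ _ 1 2]) auto
  moreover have "{..<A} \<union> {0<..} = UNIV" using AB by auto
  ultimately show ?thesis by simp
qed

lemma logcut_below: "t \<le> A \<Longrightarrow> logcut A B t = 1"
  by (simp add: logcut_def)

lemma logcut_above: "B \<le> t \<Longrightarrow> logcut A B t = 0"
proof -
  assume t: "B \<le> t"
  then have "1 \<le> ln_ratio A B t" using AB logcut_ln_pos by (simp add: le_divide_eq)
  then have "1 \<le> pos_sq (ln_ratio A B t)" by (simp add: pos_sq_def)
  then have "pos_sq (1 - pos_sq (ln_ratio A B t)) = 0" by (simp add: pos_sq_def)
  then show ?thesis using t AB by (simp add: logcut_def)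
qed

lemma logcut'_below: "t \<le> A \<Longrightarrow> logcut' A B t = 0"
  by (simp add: logcut'_def)

lemma logcut'_above: "B \<le> t \<Longrightarrow> logcut' A B t = 0"
proof -
  assume t: "B \<le> t"
  then have "1 \<le> ln_ratio A B t" using AB logcut_ln_pos by (simp add: le_divide_eq)
  then have "1 \<le> pos_sq (ln_ratio A B t)" by (simp add: pos_sq_def)
  then show ?thesis by (simp add: logcut'_def)
qed

lemma logcut'_nonpos: "logcut' A B t \<le> 0"
  using logcut_ln_pos AB by (auto simp: logcut'_def divide_nonpos_pos intro!: divide_nonneg_pos mult_nonneg_nonneg)

text \<open>Both truncated factors in the numerator lie between 0 and 1 on the transition interval,
  which leaves the constant 4.\<close>

lemma abs_logcut'_le: "\<bar>logcut' A B t\<bar> \<le> (if A < t \<and> t < B then 4 / (t * (ln B - ln A)) else 0)"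
proof (cases "A < t \<and> t < B")
  case True
  let ?u = "ln_ratio A B t"
  have u: "0 < ?u" "?u < 1" using True AB logcut_ln_pos by (auto simp: divide_less_eq)
  have "max 0 (1 - pos_sq ?u) * max 0 ?u \<le> 1 * 1"
    by (rule mult_mono) (use u in auto)
  moreover have "0 \<le> max 0 (1 - pos_sq ?u) * max 0 ?u" by simp
  ultimately have "\<bar>4 * max 0 (1 - pos_sq ?u) * max 0 ?u\<bar> \<le> 4" by simp
  moreover have "0 < t * (ln B - ln A)" using True AB logcut_ln_pos by simp
  ultimately have "\<bar>4 * max 0 (1 - pos_sq ?u) * max 0 ?u\<bar> / (t * (ln B - ln A)) \<le> 4 / (t * (ln B - ln A))"
    by (intro divide_right_mono) auto
  moreover have "\<bar>t * (ln B - ln A)\<bar> = t * (ln B - ln A)" using \<open>0 < t * (ln B - ln A)\<close> by simp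
  moreover have "\<not> t \<le> A" using True by simp
  ultimately show ?thesis
    unfolding logcut'_def if_P[OF True] if_not_P[OF \<open>\<not> t \<le> A\<close>] abs_divide abs_minus_cancel by simp
next
  case False
  then show ?thesis using logcut'_below logcut'_above by force
qed

end

text \<open>The squared distance is differentiable at c too, unlike the distance itself; this is why
  radial functions are written in it.\<close>

lemma has_derivative_radial:
  fixes c z :: complex
  assumes "(H has_real_derivative H') (at ((cmod (z - c))\<^sup>2))"
  shows "((\<lambda>z. H ((cmod (z - c))\<^sup>2)) has_derivative (\<lambda>v. ((2 * H') *\<^sub>R (z - c)) \<bullet> v)) (at z)"
proof -
  have "((\<lambda>z. (z - c) \<bullet> (z - c)) has_derivative (\<lambda>v. (z - c) \<bullet> v + v \<bullet> (z - c))) (at z)"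
    by (auto intro!: derivative_eq_intros)
  then have "((\<lambda>z. (cmod (z - c))\<^sup>2) has_derivative (\<lambda>v. 2 * ((z - c) \<bullet> v))) (at z)"
    unfolding power2_norm_eq_inner by (simp add: inner_commute)
  from has_derivative_compose[OF this assms[unfolded has_field_derivative_def]]
  show ?thesis by (simp add: mult.assoc mult.left_commute)
qed

text \<open>Difference quotients have integral 0 by translation invariance of Lebesgue measure. They
  are bounded by the maximum of the derivative on a fixed ball, so dominated convergence passes this
  on to the derivative.\<close>

lemma integral_directional_derivative_eq_0:
  fixes g :: "complex \<Rightarrow> complex"
  assumes der: "\<And>z. (g has_derivative g' z) (at z)"
    and cont: "continuous_on UNIV (\<lambda>z. g' z e)"
    and supp: "\<And>z. R < cmod z \<Longrightarrow> g z = 0"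
  shows "integrable lborel (\<lambda>z. g' z e)" and "(\<integral>z. g' z e \<partial>lborel) = 0"
proof -
  have contg: "continuous_on UNIV g"
    using der has_derivative_continuous_on[of UNIV g g'] by simp
  have supp': "g' z e = 0" if "R < cmod z" for z
  proof -
    have "open {z. R < cmod z}" by (intro open_Collect_less continuous_intros)
    then have "((\<lambda>_. 0) has_derivative g' z) (at z)"
      using has_derivative_transform_within_open[OF der, of "{z. R < cmod z}" z "\<lambda>_. 0"] that supp by auto
    then show ?thesis using has_derivative_unique[OF has_derivative_const] by metis
  qed
  \<comment> \<open>Enlarged by |e| so that it contains the support of every difference quotient
    with step at most 1.\<close>
  let ?S = "cball (0::complex) (R + cmod e)"
  have int: "integrable lborel f" if "continuous_on UNIV f" "\<And>z. R < cmod z \<Longrightarrow> f z = 0" for f :: "complex \<Rightarrow> complex"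
  proof -
    have "integrable lborel (\<lambda>z. indicat_real ?S z *\<^sub>R f z)"
      using that(1) by (intro borel_integrable_compact) (auto intro: continuous_on_subset)
    moreover have "(\<lambda>z. indicat_real ?S z *\<^sub>R f z) = f"
    proof
      fix z show "indicat_real ?S z *\<^sub>R f z = f z"
      proof (cases "R < cmod z")
        case False
        then have "z \<in> ?S" using norm_ge_zero[of e] unfolding mem_cball_0 by linarith
        then show ?thesis by simp
      qed (simp add: that(2))
    qed
    ultimately show ?thesis by simp
  qed
  show int': "integrable lborel (\<lambda>z. g' z e)" by (rule int[OF cont supp'])
  have intg: "integrable lborel g" by (rule int[OF contg supp])
  have "\<exists>M. \<forall>z\<in>?S. cmod (g' z e) \<le> M"
    using compact_imp_bounded[OF compact_continuous_image[OF continuous_on_subset[OF cont] compact_cball[of 0 "R + cmod e"]]]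
    unfolding bounded_iff by simp
  then obtain M where M: "\<And>z. z \<in> ?S \<Longrightarrow> cmod (g' z e) \<le> M" by blast
  have M0: "cmod (g' z e) \<le> max 0 M" for z
  proof (cases "z \<in> ?S")
    case False
    then have "R + cmod e < cmod z" by simp
    then have "R < cmod z" using norm_ge_zero[of e] by linarith
    then show ?thesis using supp' by simp
  qed (use M in \<open>auto simp: le_max_iff_disj\<close>)
  define h where "h n = 1 / real (Suc n)" for n
  have h: "0 < h n" "h n \<le> 1" for n by (auto simp: h_def)
  have h0: "h \<longlonglongrightarrow> 0" unfolding h_def using LIMSEQ_inverse_real_of_nat by (simp add: inverse_eq_divide)
  define F where "F n z = (1 / h n) *\<^sub>R (g (z + h n *\<^sub>R e) - g z)" for n z
  have dir: "((\<lambda>t. g (z + t *\<^sub>R e)) has_vector_derivative g' (z + t *\<^sub>R e) e) (at t)" for z t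
  proof -
    have "((\<lambda>t. z + t *\<^sub>R e) has_vector_derivative e) (at t)"
      by (auto intro!: derivative_eq_intros simp: has_vector_derivative_def)
    from vector_derivative_diff_chain_within[OF this, of g "g' (z + t *\<^sub>R e)"]
    show ?thesis using has_derivative_at_withinI[OF der] by (auto simp: o_def)
  qed
  have lim: "(\<lambda>n. F n z) \<longlonglongrightarrow> g' z e" for z
  proof -
    have "((\<lambda>t. (1 / t) *\<^sub>R (g (z + t *\<^sub>R e) - g z)) \<longlongrightarrow> g' z e) (at 0)"
    proof (rule LIM_zero_cancel, rule tendsto_norm_zero_cancel)
      have "((\<lambda>t. norm (g (z + t *\<^sub>R e) - g z - t *\<^sub>R g' z e) / norm t) \<longlongrightarrow> 0) (at 0)"
        using dir[of z 0] unfolding has_vector_derivative_def has_derivative_at by simp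
      then show "((\<lambda>t. norm ((1 / t) *\<^sub>R (g (z + t *\<^sub>R e) - g z) - g' z e)) \<longlongrightarrow> 0) (at 0)"
      proof (rule Lim_transform_eventually)
        show "\<forall>\<^sub>F t in at 0. norm (g (z + t *\<^sub>R e) - g z - t *\<^sub>R g' z e) / norm t
            = norm ((1 / t) *\<^sub>R (g (z + t *\<^sub>R e) - g z) - g' z e)"
        proof (intro eventually_at_filter[THEN iffD2] always_eventually allI impI)
          fix t :: real assume t: "t \<noteq> 0"
          have "(1 / t) *\<^sub>R (g (z + t *\<^sub>R e) - g z) - g' z e = (1 / t) *\<^sub>R (g (z + t *\<^sub>R e) - g z - t *\<^sub>R g' z e)"
            using t by (simp add: algebra_simps)
          then show "norm (g (z + t *\<^sub>R e) - g z - t *\<^sub>R g' z e) / norm t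
            = norm ((1 / t) *\<^sub>R (g (z + t *\<^sub>R e) - g z) - g' z e)"
            by simp
        qed
      qed
    qed
    moreover have "filterlim h (at 0) sequentially"
      using h0 h by (auto simp: filterlim_at intro!: always_eventually less_imp_neq[symmetric])
    ultimately show ?thesis unfolding F_def by (rule filterlim_compose)
  qed
  have bound: "cmod (F n z) \<le> indicat_real ?S z * max 0 M" for n z
  proof (cases "z \<in> ?S")
    case True
    have "norm (g (z + h n *\<^sub>R e) - g (z + 0 *\<^sub>R e)) \<le> max 0 M * norm (h n - 0)"
    proof (rule differentiable_bound[of UNIV "\<lambda>t. g (z + t *\<^sub>R e)" "\<lambda>t s. s *\<^sub>R g' (z + t *\<^sub>R e) e"])
      show "((\<lambda>t. g (z + t *\<^sub>R e)) has_derivative (\<lambda>s. s *\<^sub>R g' (z + t *\<^sub>R e) e)) (at t within UNIV)" for t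
        using dir[of z t] by (simp add: has_vector_derivative_def)
      show "onorm (\<lambda>s. s *\<^sub>R g' (z + t *\<^sub>R e) e) \<le> max 0 M" for t
      proof (rule onorm_bound)
        fix s :: real
        show "norm (s *\<^sub>R g' (z + t *\<^sub>R e) e) \<le> max 0 M * norm s"
          using mult_left_mono[OF M0[of "z + t *\<^sub>R e"], of "norm s"] by (simp add: mult.commute)
      qed simp
    qed auto
    then have "norm (g (z + h n *\<^sub>R e) - g z) / h n \<le> max 0 M"
      using h[of n] by (simp add: divide_le_eq)
    then show ?thesis using True h[of n] by (simp add: F_def del: scaleR_right_diff_distrib)
  next
    case False
    have "R + cmod e < cmod z" using False by simp
    moreover have "cmod (h n *\<^sub>R e) \<le> cmod e" using h[of n] by (simp add: mult_left_le_one_le)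
    moreover have "cmod z - cmod (h n *\<^sub>R e) \<le> cmod (z + h n *\<^sub>R e)" by (rule norm_diff_ineq)
    ultimately have "R < cmod (z + h n *\<^sub>R e)" "R < cmod z" using norm_ge_zero[of e] by linarith+
    then show ?thesis using supp False by (simp add: F_def)
  qed
  have F0: "(\<integral>z. F n z \<partial>lborel) = 0" for n
  proof -
    have d: "distr lborel borel (\<lambda>z. z + h n *\<^sub>R e) = lborel"
    proof -
      have "(\<lambda>z. z + h n *\<^sub>R e) = (+) (h n *\<^sub>R e)" by (auto simp: fun_eq_iff)
      then show ?thesis using lborel_distr_plus[of "h n *\<^sub>R e"] by (simp only:)
    qed
    have gm: "g \<in> borel_measurable borel" using contg by (rule borel_measurable_continuous_onI)
    have "integrable lborel (\<lambda>z. g (z + h n *\<^sub>R e))"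
      using intg integrable_distr_eq[of "\<lambda>z. z + h n *\<^sub>R e" lborel borel g] gm unfolding d by simp
    moreover have "(\<integral>z. g (z + h n *\<^sub>R e) \<partial>lborel) = (\<integral>z. g z \<partial>lborel)"
      using integral_distr[of "\<lambda>z. z + h n *\<^sub>R e" lborel borel g] gm unfolding d by simp
    ultimately show ?thesis unfolding F_def using intg by simp
  qed
  have "(\<lambda>n. \<integral>z. F n z \<partial>lborel) \<longlonglongrightarrow> (\<integral>z. g' z e \<partial>lborel)"
  proof (rule integral_dominated_convergence)
    show "(\<lambda>z. g' z e) \<in> borel_measurable lborel" using int' by simp
    have "continuous_on UNIV (\<lambda>z. F n z)" for n unfolding F_def
      by (intro continuous_intros continuous_on_compose2[OF contg]) auto
    then show "(\<lambda>z. F n z) \<in> borel_measurable lborel" for n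
      by (simp add: borel_measurable_continuous_onI)
    have "integrable lborel (\<lambda>z. indicat_real ?S z *\<^sub>R max 0 M)"
      by (intro borel_integrable_compact) auto
    then show "integrable lborel (\<lambda>z. indicat_real ?S z * max 0 M)" by simp
  qed (use lim bound in auto)
  then show "(\<integral>z. g' z e \<partial>lborel) = 0" using F0 by (simp add: LIMSEQ_const_iff)
qed

section \<open>Gradients of cutoffs against holomorphic functions and the Cauchy kernel\<close>

lemma complex_eq_0_of_inner:
  fixes a :: complex
  assumes "\<And>v. a \<bullet> v = 0" shows "a = 0"
  using assms[of a] by simp

lemma gradient_zero_off_support:
  fixes \<phi> :: "complex \<Rightarrow> real"
  assumes der: "\<And>z. (\<phi> has_derivative (\<lambda>v. d\<phi> z \<bullet> v)) (at z)"
    and U: "open U" "z \<in> U" "\<And>z. z \<in> U \<Longrightarrow> \<phi> z = k"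
  shows "d\<phi> z = 0"
proof -
  have "((\<lambda>_. k) has_derivative (\<lambda>v. d\<phi> z \<bullet> v)) (at z)"
    using has_derivative_transform_within_open[OF der U(1,2), of "\<lambda>_. k"] U(3) by auto
  then have "(\<lambda>v. d\<phi> z \<bullet> v) = (\<lambda>v. 0)"
    using has_derivative_unique[OF has_derivative_const] by metis
  then show ?thesis by (intro complex_eq_0_of_inner) metis
qed

text \<open>Read as a complex number, the gradient is \<phi>_x + i \<phi>_y, twice the conjugate
  Wirtinger derivative. Since (d/dx + i d/dy) q = 0, the integrand is (d/dx + i d/dy)(\<phi> q), and
  both directional derivatives integrate to 0. The product is differentiable on D and vanishes off
  S, and these two open sets cover the plane.\<close>

lemma integral_gradient_mult_holomorphic:
  fixes q :: "complex \<Rightarrow> complex" and \<phi> :: "complex \<Rightarrow> real"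
  assumes D: "open D" and q: "q holomorphic_on D" and S: "compact S" "S \<subseteq> D"
    and der: "\<And>z. (\<phi> has_derivative (\<lambda>v. d\<phi> z \<bullet> v)) (at z)"
    and cont: "continuous_on UNIV d\<phi>" and supp: "\<And>z. z \<notin> S \<Longrightarrow> \<phi> z = 0"
  shows "integrable lborel (\<lambda>z. d\<phi> z * q z)" "(\<integral>z. d\<phi> z * q z \<partial>lborel) = 0"
proof -
  have opS: "open (- S)" using compact_imp_closed[OF S(1)] by (simp add: open_Compl)
  have d0: "d\<phi> z = 0" if "z \<notin> S" for z
    by (rule gradient_zero_off_support[OF der opS, of z 0]) (use that supp in auto)
  define g where "g z = complex_of_real (\<phi> z) * q z" for z
  define g' where "g' z v = complex_of_real (d\<phi> z \<bullet> v) * q z + of_real (\<phi> z) * (deriv q z * v)" for z v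
  have g0: "g z = 0" "g' z = (\<lambda>v. 0)" if "z \<notin> S" for z using that d0 supp by (auto simp: g_def g'_def fun_eq_iff)
  have derg: "(g has_derivative g' z) (at z)" for z
  proof (cases "z \<in> S")
    case True
    then have "(q has_field_derivative deriv q z) (at z)"
      using S q D holomorphic_derivI by blast
    then have "(q has_derivative (\<lambda>v. deriv q z * v)) (at z)" by (simp add: has_field_derivative_def)
    from has_derivative_mult[OF has_derivative_of_real[OF der] this]
    have "(g has_derivative (\<lambda>v. of_real (\<phi> z) * (deriv q z * v) + of_real (d\<phi> z \<bullet> v) * q z)) (at z)"
      unfolding g_def .
    then show ?thesis unfolding g'_def by (simp add: add.commute)
  next
    case False
    show ?thesis unfolding g0(2)[OF False]
      by (rule has_derivative_transform_within_open[OF has_derivative_const opS, of z 0 g])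
         (use False g0 in auto)
  qed
  have contg': "continuous_on UNIV (\<lambda>z. g' z e)" for e
  proof -
    have "continuous_on D (\<lambda>z. g' z e)"
      unfolding g'_def
      by (intro continuous_intros holomorphic_on_imp_continuous_on[OF q]
          holomorphic_on_imp_continuous_on[OF holomorphic_deriv[OF q D]] continuous_on_subset[OF cont]
          continuous_at_imp_continuous_on ballI has_derivative_continuous[OF der]) auto
    moreover have "continuous_on (- S) (\<lambda>z. g' z e)"
      by (rule continuous_on_eq[of _ "\<lambda>_. 0"]) (auto simp: g0)
    ultimately have "continuous_on (D \<union> - S) (\<lambda>z. g' z e)"
      using D opS by (intro continuous_on_open_Un)
    moreover have "D \<union> - S = UNIV" using S by auto
    ultimately show ?thesis by simp
  qed
  obtain R where R: "\<And>z. z \<in> S \<Longrightarrow> cmod z \<le> R"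
    using compact_imp_bounded[OF S(1)] unfolding bounded_iff by blast
  have supg: "g z = 0" if "R < cmod z" for z using R[of z] that g0 by (cases "z \<in> S") auto
  note I = integral_directional_derivative_eq_0[OF derg contg' supg]
  have eq: "d\<phi> z * q z = g' z 1 + \<i> * g' z \<i>" for z
  proof -
    have "complex_of_real (d\<phi> z \<bullet> 1) + \<i> * complex_of_real (d\<phi> z \<bullet> \<i>) = d\<phi> z"
      by (simp add: inner_complex_def complex_eq_iff)
    then have "d\<phi> z * q z = (complex_of_real (d\<phi> z \<bullet> 1) + \<i> * complex_of_real (d\<phi> z \<bullet> \<i>)) * q z" by simp
    also have "\<dots> = g' z 1 + \<i> * g' z \<i>"
    proof -
      have "(a + \<i> * b) * Q = (a * Q + c * (P * 1)) + \<i> * (b * Q + c * (P * \<i>))" for a b c P Q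
        by (simp add: complex_eq_iff algebra_simps)
      then show ?thesis unfolding g'_def .
    qed
    finally show ?thesis .
  qed
  have "integrable lborel (\<lambda>z. \<i> * g' z \<i>)" by (intro integrable_mult_right I(1))
  moreover have "(\<integral>z. \<i> * g' z \<i> \<partial>lborel) = 0"
    by (simp only: integral_mult_right_zero I(2) mult_zero_right)
  ultimately show "integrable lborel (\<lambda>z. d\<phi> z * q z)" "(\<integral>z. d\<phi> z * q z \<partial>lborel) = 0"
    unfolding eq
    by (simp_all only: Bochner_Integration.integrable_add Bochner_Integration.integral_add I(1) I(2) add_0_left)
qed

text \<open>Polar coordinates would give the value 2 pi; the estimates rely only on its being
  positive.\<close>

definition cut_const :: real where
  "cut_const = (\<integral>z. - 2 * logcut' 1 4 ((cmod z)\<^sup>2) \<partial>(lborel :: complex measure))"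

definition rad :: "complex \<Rightarrow> real \<Rightarrow> real \<Rightarrow> complex \<Rightarrow> real" where
  "rad c A B z = logcut A B ((cmod (z - c))\<^sup>2)"

definition drad :: "complex \<Rightarrow> real \<Rightarrow> real \<Rightarrow> complex \<Rightarrow> complex" where
  "drad c A B z = (2 * logcut' A B ((cmod (z - c))\<^sup>2)) *\<^sub>R (z - c)"

lemma has_derivative_rad:
  assumes "0 < A" "A < B"
  shows "(rad c A B has_derivative (\<lambda>v. drad c A B z \<bullet> v)) (at z)"
  using has_derivative_radial[OF has_derivative_logcut[OF assms], where c = c and z = z]
  by (simp add: rad_def[abs_def] drad_def)

lemma continuous_drad:
  assumes "0 < A" "A < B"
  shows "continuous_on X (drad c A B)"
  unfolding drad_def
  by (intro continuous_intros continuous_on_compose2[OF continuous_logcut'[OF assms]]) auto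

lemma cmod_drad_le:
  assumes "0 < A" "A < B"
  shows "cmod (drad c A B z) \<le> (if A < (cmod (z - c))\<^sup>2 \<and> (cmod (z - c))\<^sup>2 < B
    then 8 / (cmod (z - c) * (ln B - ln A)) else 0)"
proof -
  let ?t = "(cmod (z - c))\<^sup>2"
  have eq: "cmod (drad c A B z) = 2 * \<bar>logcut' A B ?t\<bar> * cmod (z - c)"
    by (simp add: drad_def abs_mult)
  show ?thesis
  proof (cases "A < ?t \<and> ?t < B")
    case True
    then have "\<bar>logcut' A B ?t\<bar> \<le> 4 / (?t * (ln B - ln A))" using abs_logcut'_le[OF assms, of ?t] by simp
    then have "2 * \<bar>logcut' A B ?t\<bar> * cmod (z - c) \<le> 2 * (4 / (?t * (ln B - ln A))) * cmod (z - c)"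
      by (intro mult_right_mono mult_left_mono) auto
    also have "\<dots> = 8 / (cmod (z - c) * (ln B - ln A))"
      by (cases "z = c") (auto simp: power2_eq_square)
    finally show ?thesis using True eq by simp
  next
    case False
    then show ?thesis using abs_logcut'_le[OF assms, of ?t] eq by auto
  qed
qed

lemma cut_const_pos: "0 < cut_const"
proof -
  have cont: "continuous_on UNIV (\<lambda>z::complex. - 2 * logcut' 1 4 ((cmod z)\<^sup>2))"
    by (intro continuous_intros continuous_on_compose2[OF continuous_logcut'[of 1 4]]) auto
  have eq: "(\<lambda>z::complex. - 2 * logcut' 1 4 ((cmod z)\<^sup>2)) = (\<lambda>z. indicat_real (cball 0 2) z *\<^sub>R (- 2 * logcut' 1 4 ((cmod z)\<^sup>2)))"
  proof
    fix z :: complex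
    have "logcut' 1 4 ((cmod z)\<^sup>2) = 0" if "2 < cmod z"
      using power_mono[of 2 "cmod z" 2] that by (intro logcut'_above) auto
    then show "- 2 * logcut' 1 4 ((cmod z)\<^sup>2) = indicat_real (cball 0 2) z *\<^sub>R (- 2 * logcut' 1 4 ((cmod z)\<^sup>2))"
      by (auto simp: indicator_def)
  qed
  have int: "integrable lborel (\<lambda>z::complex. - 2 * logcut' 1 4 ((cmod z)\<^sup>2))"
    by (subst eq, rule borel_integrable_compact) (use cont in \<open>auto intro: continuous_on_subset\<close>)
  have nn: "0 \<le> - 2 * logcut' 1 4 t" for t using logcut'_nonpos[of 1 4 t] by simp
  have "cut_const \<noteq> 0"
  proof
    assume "cut_const = 0"
    then have "AE z in lborel. - 2 * logcut' 1 4 ((cmod (z::complex))\<^sup>2) = 0"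
      unfolding cut_const_def using integral_nonneg_eq_0_iff_AE[OF int] nn by simp
    then have "AE z in lborel. z \<notin> {z::complex. - 2 * logcut' 1 4 ((cmod z)\<^sup>2) \<noteq> 0}" by eventually_elim auto
    moreover have op: "open {z::complex. - 2 * logcut' 1 4 ((cmod z)\<^sup>2) \<noteq> 0}"
      using cont by (intro open_Collect_neq) auto
    ultimately have "{z::complex. - 2 * logcut' 1 4 ((cmod z)\<^sup>2) \<noteq> 0} \<in> null_sets lborel"
      by (simp add: AE_iff_null_sets)
    then have "negligible {z::complex. - 2 * logcut' 1 4 ((cmod z)\<^sup>2) \<noteq> 0}"
      by (simp add: negligible_iff_null_sets null_sets_completionI)
    \<comment> \<open>A sample point whose squared modulus 9/4 lies strictly inside the transition
      interval from 1 to 4.\<close>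
    then have "complex_of_real (3/2) \<notin> {z::complex. - 2 * logcut' 1 4 ((cmod z)\<^sup>2) \<noteq> 0}"
      using open_not_negligible[OF op] by blast
    then have "logcut' 1 4 (9/4) = 0" by (simp add: power2_eq_square)
    moreover have "0 < ln (9/4 :: real)" "ln (9/4 :: real) < ln 4" by simp_all
    then have "0 < ln (9/4 :: real) / ln 4" "ln (9/4 :: real) / ln 4 < 1" by simp_all
    then have "pos_sq (ln (9/4) / ln 4) < 1" by (simp add: pos_sq_def abs_square_less_1)
    ultimately show False using \<open>0 < ln (9/4 :: real) / ln 4\<close> by (simp add: logcut'_def)
  qed
  moreover have "0 \<le> cut_const" unfolding cut_const_def using nn by (intro integral_nonneg_AE) auto
  ultimately show ?thesis by simp
qed

text \<open>The integral is the same for all cutoffs that equal 1 near w: the difference from the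
  model cutoff \<open>rad w 1 4\<close> vanishes near w, where 1 / (z - w) is singular, so the
  previous identity applies to it. For the model the integrand is radial and real, and
  \<open>cut_const\<close> is its value by definition.\<close>

lemma integral_gradient_Cauchy_kernel:
  fixes \<phi> :: "complex \<Rightarrow> real"
  assumes der: "\<And>z. (\<phi> has_derivative (\<lambda>v. d\<phi> z \<bullet> v)) (at z)"
    and cont: "continuous_on UNIV d\<phi>" and S: "compact S" and supp: "\<And>z. z \<notin> S \<Longrightarrow> \<phi> z = 0"
    and r: "0 < r" "\<And>z. z \<in> ball w r \<Longrightarrow> \<phi> z = 1"
  shows "integrable lborel (\<lambda>z. d\<phi> z / (z - w))" "(\<integral>z. d\<phi> z / (z - w) \<partial>lborel) = - of_real cut_const"
proof -
  \<comment> \<open>Both \<phi> and the model cutoff are 1 on the ball of this radius.\<close>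
  define r' where "r' = min r 1"
  have r': "0 < r'" "r' \<le> r" "r' \<le> 1" using r by (auto simp: r'_def)
  let ?D = "- cball w (r' / 2)"
  let ?S = "(S \<union> cball w 2) - ball w r'"
  define \<psi> where "\<psi> z = \<phi> z - rad w 1 4 z" for z
  define d\<psi> where "d\<psi> z = d\<phi> z - drad w 1 4 z" for z
  have 1: "(\<psi> has_derivative (\<lambda>v. d\<psi> z \<bullet> v)) (at z)" for z
    unfolding \<psi>_def d\<psi>_def inner_diff_left
    by (intro has_derivative_diff der has_derivative_rad) auto
  have 2: "continuous_on UNIV d\<psi>"
    unfolding d\<psi>_def by (intro continuous_intros cont continuous_drad) auto
  have 3: "\<psi> z = 0" if "z \<notin> ?S" for z
  proof (cases "z \<in> ball w r'")
    case True
    then have "(cmod (z - w))\<^sup>2 \<le> 1" using r' by (auto simp: dist_norm norm_minus_commute abs_square_le_1)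
    then have "rad w 1 4 z = 1" by (simp add: rad_def logcut_below)
    moreover have "\<phi> z = 1" using True r' by (intro r) auto
    ultimately show ?thesis by (simp add: \<psi>_def)
  next
    case False
    then have "z \<notin> S" "z \<notin> cball w 2" using that by auto
    then have "2 \<le> cmod (z - w)" by (auto simp: dist_norm norm_minus_commute)
    then have "4 \<le> (cmod (z - w))\<^sup>2" using power_mono[of 2 "cmod (z - w)" 2] by simp
    then show ?thesis using supp \<open>z \<notin> S\<close> by (simp add: \<psi>_def rad_def logcut_above)
  qed
  have hol: "(\<lambda>z. 1 / (z - w)) holomorphic_on ?D"
    using r' by (intro holomorphic_intros) auto
  have SD: "compact ?S" "?S \<subseteq> ?D" "open ?D"
    using S r' by (auto intro!: compact_diff compact_Un)
  note I = integral_gradient_mult_holomorphic[OF SD(3) hol SD(1,2) 1 2 3]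
  have R: "drad w 1 4 z / (z - w) = complex_of_real (2 * logcut' 1 4 ((cmod (z - w))\<^sup>2))" for z
    by (cases "z = w") (auto simp: drad_def scaleR_conv_of_real logcut'_below)
  have d: "distr lborel borel (\<lambda>z. z - w) = lborel"
  proof -
    have "(\<lambda>z. z - w) = (+) (- w)" by (auto simp: fun_eq_iff)
    then show ?thesis using lborel_distr_plus[of "- w"] by (simp only:)
  qed
  let ?h = "\<lambda>z::complex. complex_of_real (2 * logcut' 1 4 ((cmod z)\<^sup>2))"
  have hm: "continuous_on UNIV ?h"
    by (intro continuous_intros continuous_on_compose2[OF continuous_logcut'[of 1 4]]) auto
  have hm': "?h \<in> borel_measurable borel" by (rule borel_measurable_continuous_onI[OF hm])
  have heq: "?h = (\<lambda>z. indicat_real (cball 0 2) z *\<^sub>R ?h z)"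
  proof
    fix z :: complex
    have "logcut' 1 4 ((cmod z)\<^sup>2) = 0" if "2 < cmod z"
      using power_mono[of 2 "cmod z" 2] that by (intro logcut'_above) auto
    then show "?h z = indicat_real (cball 0 2) z *\<^sub>R ?h z"
      by (auto simp: indicator_def)
  qed
  have hint: "integrable lborel ?h"
    by (subst heq, rule borel_integrable_compact) (use hm in \<open>auto intro: continuous_on_subset\<close>)
  have int1: "integrable lborel (\<lambda>z. drad w 1 4 z / (z - w))"
    unfolding R using hint integrable_distr_eq[of "\<lambda>z. z - w" lborel borel ?h] hm' unfolding d by simp
  have "(\<integral>z. drad w 1 4 z / (z - w) \<partial>lborel) = (\<integral>z. ?h z \<partial>lborel)"
    unfolding R using integral_distr[of "\<lambda>z. z - w" lborel borel ?h] hm' unfolding d by simp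
  also have "\<dots> = of_real (\<integral>z. 2 * logcut' 1 4 ((cmod z)\<^sup>2) \<partial>(lborel::complex measure))"
    by (rule integral_complex_of_real)
  also have "\<dots> = - of_real cut_const" unfolding cut_const_def by simp
  finally have int2: "(\<integral>z. drad w 1 4 z / (z - w) \<partial>lborel) = - of_real cut_const" .
  have eq: "d\<phi> z / (z - w) = d\<psi> z * (1 / (z - w)) + drad w 1 4 z / (z - w)" for z
    by (simp add: d\<psi>_def diff_divide_distrib)
  show "integrable lborel (\<lambda>z. d\<phi> z / (z - w))" "(\<integral>z. d\<phi> z / (z - w) \<partial>lborel) = - of_real cut_const"
    unfolding eq using I int1 int2 by simp_all
qed

text \<open>Evaluation at an interior point by an area integral: apply the previous identities to the
  holomorphic difference quotient of \<open>f\<close> at \<open>w\<close>.\<close>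

lemma evaluation_formula:
  fixes \<phi> :: "complex \<Rightarrow> real"
  assumes D: "open D" and f: "f holomorphic_on D" and w: "w \<in> D" and S: "compact S" "S \<subseteq> D"
    and der: "\<And>z. (\<phi> has_derivative (\<lambda>v. d\<phi> z \<bullet> v)) (at z)"
    and cont: "continuous_on UNIV d\<phi>" and supp: "\<And>z. z \<notin> S \<Longrightarrow> \<phi> z = 0"
    and r: "0 < r" "\<And>z. z \<in> ball w r \<Longrightarrow> \<phi> z = 1"
  shows "f w * of_real cut_const = - (\<integral>z. d\<phi> z / (z - w) * f z \<partial>lborel)"
proof -
  define q where "q z = (if z = w then deriv f w else (f z - f w) / (z - w))" for z
  have q: "q holomorphic_on D"
    unfolding q_def using f w D by (intro pole_lemma) (auto simp: interior_open)
  have I: "integrable lborel (\<lambda>z. d\<phi> z * q z)" "(\<integral>z. d\<phi> z * q z \<partial>lborel) = 0"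
    by (rule integral_gradient_mult_holomorphic[OF D q S der cont]; use supp in blast)+
  have J: "integrable lborel (\<lambda>z. d\<phi> z / (z - w))" "(\<integral>z. d\<phi> z / (z - w) \<partial>lborel) = - of_real cut_const"
    by (rule integral_gradient_Cauchy_kernel[where S = S and r = r, OF der cont S(1)]; use supp r in blast)+
  have dw: "d\<phi> w = 0"
    by (rule gradient_zero_off_support[OF der, of "ball w r" w 1]) (use r in auto)
  \<comment> \<open>At z = w both sides are 0, because the gradient vanishes there and division by 0
    yields 0.\<close>
  have eq: "d\<phi> z / (z - w) * f z = d\<phi> z * q z + f w * (d\<phi> z / (z - w))" for z
    by (cases "z = w") (auto simp: q_def dw diff_divide_distrib right_diff_distrib)
  have "integrable lborel (\<lambda>z. f w * (d\<phi> z / (z - w)))" by (intro integrable_mult_right J(1))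
  then have "(\<integral>z. d\<phi> z / (z - w) * f z \<partial>lborel) = f w * (\<integral>z. d\<phi> z / (z - w) \<partial>lborel)"
    unfolding eq by (subst Bochner_Integration.integral_add[OF I(1)]) (simp_all only: I(2) integral_mult_right_zero add_0_left)
  then show ?thesis by (simp only: J(2)) simp
qed

text \<open>Cauchy-Schwarz in the evaluation formula. Every admissible cutoff thus yields a kernel
  bound, namely the energy of its weight divided by \<open>cut_const\<^sup>2\<close>, and kernel
  estimates become a matter of choosing cutoffs well.\<close>

lemma evaluation_bound:
  fixes \<phi> :: "complex \<Rightarrow> real"
  assumes D: "open D" and f: "f \<in> L2h D" and w: "w \<in> D" and S: "compact S" "S \<subseteq> D"
    and der: "\<And>z. (\<phi> has_derivative (\<lambda>v. d\<phi> z \<bullet> v)) (at z)"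
    and cont: "continuous_on UNIV d\<phi>" and supp: "\<And>z. z \<notin> S \<Longrightarrow> \<phi> z = 0"
    and r: "0 < r" "\<And>z. z \<in> ball w r \<Longrightarrow> \<phi> z = 1"
  shows "(cmod (f w) * cut_const)\<^sup>2 \<le> sqnorm D f * (\<integral>z. (cmod (d\<phi> z / (z - w)))\<^sup>2 \<partial>lborel)"
proof -
  have hol: "f holomorphic_on D" using f by (simp add: L2h_def)
  have opS: "open (- S)" using compact_imp_closed[OF S(1)] by (simp add: open_Compl)
  have d0: "d\<phi> z = 0" if "z \<notin> S" for z
    by (rule gradient_zero_off_support[OF der opS, of z 0]) (use that supp in auto)
  have d1: "d\<phi> z = 0" if "z \<in> ball w r" for z
    by (rule gradient_zero_off_support[OF der, of "ball w r" z 1]) (use that r in auto)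
  define G where "G z = cmod (d\<phi> z / (z - w))" for z
  define F where "F z = indicat_real D z * cmod (f z)" for z
  have fD: "(\<lambda>z. indicat_real D z *\<^sub>R f z) \<in> borel_measurable lborel"
    using set_borel_measurable_continuous_on_open[OF D holomorphic_on_imp_continuous_on[OF hol]]
    by (simp add: set_borel_measurable_def)
  then have Fm: "F \<in> borel_measurable lborel"
  proof -
    have "F = (\<lambda>z. cmod (indicat_real D z *\<^sub>R f z))" by (auto simp: F_def fun_eq_iff)
    then show ?thesis using measurable_compose[OF fD borel_measurable_norm] by (simp only:)
  qed
  have "d\<phi> \<in> borel_measurable lborel" using borel_measurable_continuous_onI[OF cont] by simp
  then have gm: "(\<lambda>z. d\<phi> z / (z - w)) \<in> borel_measurable lborel" by measurable
  then have Gm: "G \<in> borel_measurable lborel" unfolding G_def by measurable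
  have F2: "integrable lborel (\<lambda>z. (F z)\<^sup>2)" "(\<integral>z. (F z)\<^sup>2 \<partial>lborel) = sqnorm D f"
  proof -
    have eq: "(F z)\<^sup>2 = indicat_real D z *\<^sub>R (cmod (f z))\<^sup>2" for z by (auto simp: F_def indicator_def)
    show "integrable lborel (\<lambda>z. (F z)\<^sup>2)" "(\<integral>z. (F z)\<^sup>2 \<partial>lborel) = sqnorm D f"
      unfolding eq using f by (auto simp: L2h_def set_integrable_def sqnorm_def set_lebesgue_integral_def)
  qed
  have G2: "integrable lborel (\<lambda>z. (G z)\<^sup>2)"
  proof -
    \<comment> \<open>The weight vanishes off this compact set, which excludes the singularity at w,
      and it is continuous on it.\<close>
    let ?K = "S - ball w r"
    have K: "compact ?K" using S by (auto intro: compact_diff)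
    have "continuous_on ?K (\<lambda>z. (G z)\<^sup>2)"
      unfolding G_def using r by (intro continuous_intros continuous_on_subset[OF cont]) auto
    then have "integrable lborel (\<lambda>z. indicat_real ?K z *\<^sub>R (G z)\<^sup>2)"
      by (rule borel_integrable_compact[OF K])
    moreover have "(\<lambda>z. indicat_real ?K z *\<^sub>R (G z)\<^sup>2) = (\<lambda>z. (G z)\<^sup>2)"
      using d0 d1 by (fastforce simp: G_def indicator_def)
    ultimately show ?thesis by simp
  qed
  note CS = Cauchy_Schwarz_integral[OF Fm Gm F2(1) G2]
  have "cmod (f w) * cut_const = cmod (f w * of_real cut_const)"
    using cut_const_pos by (simp add: norm_mult)
  also have "\<dots> = cmod (\<integral>z. d\<phi> z / (z - w) * f z \<partial>lborel)"
    by (subst evaluation_formula[where r = r, OF D hol w S der cont]) (use supp r in auto)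
  also have "\<dots> \<le> (\<integral>z. F z * G z \<partial>lborel)"
  proof (rule order_trans[OF integral_norm_bound])
    have eq: "norm (d\<phi> z / (z - w) * f z) = F z * G z" for z
      using d0[of z] S by (cases "z \<in> D") (auto simp: F_def G_def norm_mult norm_divide)
    show "(\<integral>z. norm (d\<phi> z / (z - w) * f z) \<partial>lborel) \<le> (\<integral>z. F z * G z \<partial>lborel)"
      unfolding eq by simp
  qed
  finally have "(cmod (f w) * cut_const)\<^sup>2 \<le> (\<integral>z. F z * G z \<partial>lborel)\<^sup>2"
    using cut_const_pos by (intro power_mono) auto
  then show ?thesis using CS(2) F2(2) by (simp add: G_def)
qed

section \<open>Kernels of evaluation functionals\<close>

lemma measure_cball_complex:
  "0 \<le> r \<Longrightarrow> measure lborel (cball (c::complex) r) = pi * r\<^sup>2"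
  using content_cball[of r c] by (simp add: unit_ball_vol_2)

lemma integral_le_bound_cball:
  fixes G :: "complex \<Rightarrow> real"
  assumes "0 \<le> r" "0 \<le> M" "\<And>z. z \<in> cball c r \<Longrightarrow> G z \<le> M" "\<And>z. z \<notin> cball c r \<Longrightarrow> G z \<le> 0"
  shows "(\<integral>z. G z \<partial>lborel) \<le> pi * r\<^sup>2 * M"
proof -
  have int: "integrable lborel (\<lambda>z. indicat_real (cball c r) z * M)"
    using borel_integrable_compact[of "cball c r" "\<lambda>_. M"] by simp
  have "(\<integral>z. G z \<partial>lborel) \<le> (\<integral>z. indicat_real (cball c r) z * M \<partial>lborel)"
    by (rule integral_mono'[OF int]) (use assms in \<open>auto simp: indicator_def\<close>)
  also have "\<dots> = pi * r\<^sup>2 * M"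
    using measure_cball_complex[OF assms(1), of c] by simp
  finally show ?thesis .
qed

text \<open>The energy of the cutoff between radii r / 2 and r is at most
  \<open>pi * r\<^sup>2 * (32 / r\<^sup>2)\<^sup>2\<close>, which is
  \<open>1024 * pi / r\<^sup>2\<close>.\<close>

definition point_const :: real where "point_const = 1024 * pi / cut_const\<^sup>2"

lemma point_const_pos: "0 < point_const"
  using cut_const_pos by (simp add: point_const_def)

lemma ln4_ge_1: "1 \<le> ln (4::real)"
  using exp_le by (subst ln_ge_iff) auto

lemma L2h_point_bound:
  assumes D: "open D" and f: "f \<in> L2h D" and r: "0 < r" "cball w r \<subseteq> D"
  shows "(cmod (f w))\<^sup>2 \<le> point_const / r\<^sup>2 * sqnorm D f"
proof -
  have w: "w \<in> D" using r by auto
  let ?A = "(r / 2)\<^sup>2" and ?B = "r\<^sup>2"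
  have AB: "0 < ?A" "?A < ?B" using r by (auto simp: power_divide)
  have "?B = 4 * ?A" by (simp add: power_divide)
  then have ln: "ln ?B - ln ?A = ln 4" using r AB by (simp add: ln_mult)
  have "(cmod (f w) * cut_const)\<^sup>2 \<le> sqnorm D f * (\<integral>z. (cmod (drad w ?A ?B z / (z - w)))\<^sup>2 \<partial>lborel)"
  proof (rule evaluation_bound[OF D f w compact_cball r(2), where r = "r / 2" and \<phi> = "rad w ?A ?B"])
    show "rad w ?A ?B z = 0" if "z \<notin> cball w r" for z
      using that r by (auto simp: rad_def dist_norm norm_minus_commute intro!: logcut_above[OF AB] power_mono)
    show "rad w ?A ?B z = 1" if "z \<in> ball w (r/2)" for z
      using that r by (auto simp: rad_def dist_norm norm_minus_commute intro!: logcut_below[OF AB] power_mono)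
  qed (use r in \<open>auto intro!: has_derivative_rad AB continuous_drad\<close>)
  also have "(\<integral>z. (cmod (drad w ?A ?B z / (z - w)))\<^sup>2 \<partial>lborel) \<le> pi * r\<^sup>2 * (32 / r\<^sup>2)\<^sup>2"
  proof (rule integral_le_bound_cball)
    have b: "cmod (drad w ?A ?B z / (z - w)) \<le> (if ?A < (cmod (z - w))\<^sup>2 \<and> (cmod (z - w))\<^sup>2 < ?B then 32 / r\<^sup>2 else 0)" for z
    proof (cases "?A < (cmod (z - w))\<^sup>2 \<and> (cmod (z - w))\<^sup>2 < ?B")
      case True
      have zw: "0 < cmod (z - w)" using True AB(1) by auto
      have "cmod (drad w ?A ?B z) \<le> 8 / (cmod (z - w) * ln 4)"
        using cmod_drad_le[OF AB, of w z] True by (simp add: ln)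
      also have "\<dots> \<le> 8 / (cmod (z - w) * 1)"
        using ln4_ge_1 zw by (intro divide_left_mono mult_left_mono) auto
      finally have "cmod (drad w ?A ?B z) / cmod (z - w) \<le> 8 / (cmod (z - w))\<^sup>2"
        using zw by (simp add: divide_le_eq power2_eq_square)
      also have "\<dots> \<le> 8 / ?A"
        by (rule divide_left_mono[OF less_imp_le[OF conjunct1[OF True]]])
           (simp, intro mult_pos_pos zero_less_power zw AB(1))
      also have "\<dots> = 32 / r\<^sup>2" by (simp add: power_divide)
      finally show ?thesis using True by (simp add: norm_divide)
    next
      case False
      then show ?thesis using cmod_drad_le[OF AB, of w z] by (auto simp: norm_divide)
    qed
    show "(cmod (drad w ?A ?B z / (z - w)))\<^sup>2 \<le> (32 / r\<^sup>2)\<^sup>2" for z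
      using b[of z] by (intro power_mono) (auto split: if_splits intro: order_trans)
    show "(cmod (drad w ?A ?B z / (z - w)))\<^sup>2 \<le> 0" if "z \<notin> cball w r" for z
    proof -
      have "r\<^sup>2 \<le> (cmod (z - w))\<^sup>2"
        using that r by (intro power_mono) (auto simp: dist_norm norm_minus_commute)
      then show ?thesis using b[of z] by auto
    qed
  qed (use r in auto)
  also have "pi * r\<^sup>2 * (32 / r\<^sup>2)\<^sup>2 = 1024 * pi / r\<^sup>2" using r by (simp add: power2_eq_square)
  finally have "(cmod (f w) * cut_const)\<^sup>2 \<le> sqnorm D f * (1024 * pi / r\<^sup>2)"
    using sqnorm_nonneg[of D f] by (simp add: mult_left_mono)
  then show ?thesis using cut_const_pos r by (simp add: point_const_def power_mult_distrib field_simps)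
qed

lemma L2h_bounded_holomorphic:
  assumes D: "open D" "D \<subseteq> cball 0 R" "0 \<le> R" and f: "f holomorphic_on D" and M: "\<And>z. z \<in> D \<Longrightarrow> cmod (f z) \<le> M"
    "0 \<le> M"
  shows "f \<in> L2h D" "sqnorm D f \<le> pi * R\<^sup>2 * M\<^sup>2"
proof -
  have "continuous_on D (\<lambda>z. (cmod (f z))\<^sup>2)"
    using f by (intro continuous_intros holomorphic_on_imp_continuous_on)
  then have meas: "(\<lambda>z. indicat_real D z *\<^sub>R (cmod (f z))\<^sup>2) \<in> borel_measurable lborel"
    using set_borel_measurable_continuous_on_open[OF D(1)] unfolding set_borel_measurable_def by blast
  have int: "integrable lborel (\<lambda>z. indicat_real (cball (0::complex) R) z * M\<^sup>2)"
    using borel_integrable_compact[of "cball (0::complex) R" "\<lambda>_. M\<^sup>2"] by simp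
  have "(cmod (f z))\<^sup>2 \<le> M\<^sup>2" if "z \<in> D" for z using M that by (intro power_mono) auto
  then have "norm (indicat_real D z *\<^sub>R (cmod (f z))\<^sup>2) \<le> norm (indicat_real (cball 0 R) z * M\<^sup>2)" for z
    using D(2) by (auto simp: indicator_def)
  then show "f \<in> L2h D"
    using Bochner_Integration.integrable_bound[OF int meas] f by (simp add: L2h_def set_integrable_def)
  show "sqnorm D f \<le> pi * R\<^sup>2 * M\<^sup>2"
    unfolding sqnorm_def set_lebesgue_integral_def
    by (rule integral_le_bound_cball[of R _ 0])
      (use D M \<open>\<And>z. z \<in> D \<Longrightarrow> (cmod (f z))\<^sup>2 \<le> M\<^sup>2\<close> in \<open>auto simp: indicator_def\<close>)
qed

section \<open>Limits in the space and Riesz representation\<close>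

lemma nn_integral_L2h:
  assumes "f \<in> L2h D"
  shows "(\<integral>\<^sup>+z. ennreal (indicat_real D z *\<^sub>R (cmod (f z))\<^sup>2) \<partial>lborel) = ennreal (sqnorm D f)"
  using assms unfolding L2h_def sqnorm_def set_lebesgue_integral_def set_integrable_def
  by (intro nn_integral_eq_integral) auto

text \<open>Lower semicontinuity of the norm. The bounds \<open>B n\<close> may vary with n so that
  the limit of a minimising sequence attains the infimum.\<close>

lemma L2h_Fatou:
  assumes D: "open D" and F: "\<And>n. F n \<in> L2h D" and g: "g holomorphic_on D"
    and lim: "\<And>z. z \<in> D \<Longrightarrow> (\<lambda>n. F n z) \<longlonglongrightarrow> g z"
    and B: "\<And>n. sqnorm D (F n) \<le> B n" "B \<longlonglongrightarrow> b"
  shows "g \<in> L2h D" "sqnorm D g \<le> b"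
proof -
  have meas: "(\<lambda>z. indicat_real D z *\<^sub>R (cmod (f z))\<^sup>2) \<in> borel_measurable lborel" if "f holomorphic_on D" for f
  proof -
    have "continuous_on D (\<lambda>z. (cmod (f z))\<^sup>2)"
      using that by (intro continuous_intros holomorphic_on_imp_continuous_on)
    then show ?thesis
      using set_borel_measurable_continuous_on_open[OF D] unfolding set_borel_measurable_def by blast
  qed
  have holF: "F n holomorphic_on D" for n using F by (simp add: L2h_def)
  let ?u = "\<lambda>n z. ennreal (indicat_real D z *\<^sub>R (cmod (F n z))\<^sup>2)"
  have pt: "liminf (\<lambda>n. ?u n z) = ennreal (indicat_real D z *\<^sub>R (cmod (g z))\<^sup>2)" for z
  proof (rule lim_imp_Liminf)
    show "(\<lambda>n. ?u n z) \<longlonglongrightarrow> ennreal (indicat_real D z *\<^sub>R (cmod (g z))\<^sup>2)"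
      by (cases "z \<in> D") (auto intro!: tendsto_ennrealI tendsto_intros lim)
  qed simp
  have "(\<integral>\<^sup>+z. ennreal (indicat_real D z *\<^sub>R (cmod (g z))\<^sup>2) \<partial>lborel) \<le> liminf (\<lambda>n. \<integral>\<^sup>+z. ?u n z \<partial>lborel)"
    unfolding pt[symmetric] using meas[OF holF] by (intro nn_integral_liminf) simp
  also have "\<dots> \<le> liminf (\<lambda>n. ennreal (B n))"
    unfolding nn_integral_L2h[OF F] using B(1) by (intro Liminf_mono always_eventually allI ennreal_leI)
  also have "\<dots> = ennreal b"
    by (intro lim_imp_Liminf tendsto_ennrealI B(2)) simp
  finally have le: "(\<integral>\<^sup>+z. ennreal (indicat_real D z *\<^sub>R (cmod (g z))\<^sup>2) \<partial>lborel) \<le> ennreal b" .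
  have "integrable lborel (\<lambda>z. indicat_real D z *\<^sub>R (cmod (g z))\<^sup>2)"
    using meas[OF g] le by (intro integrableI_bounded) (auto intro: le_less_trans)
  then show gL: "g \<in> L2h D" using g by (simp add: L2h_def set_integrable_def)
  have "0 \<le> B n" for n using B(1)[of n] sqnorm_nonneg[of D "F n"] by linarith
  then have "0 \<le> b" by (intro LIMSEQ_le_const[OF B(2)]) auto
  then show "sqnorm D g \<le> b" using le unfolding nn_integral_L2h[OF gL] by simp
qed

lemma L2h_scale:
  assumes "open D" "f \<in> L2h D"
  shows "(\<lambda>z. c * f z) \<in> L2h D"
  using L2h_add_mult[OF assms assms(2), of "c - 1"] by (simp add: algebra_simps)

text \<open>The element of least norm with \<phi> = 1 is orthogonal to the kernel of \<phi>, so a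
  multiple of it represents \<phi>. Montel's theorem extracts a locally uniform limit from a
  minimising sequence, and Fatou shows that it is minimal. Continuity of \<phi> is therefore
  required for locally uniform convergence, which evaluation and differentiation respect.\<close>

lemma L2h_Riesz:
  assumes D: "open D"
    and add: "\<And>f g c. f \<in> L2h D \<Longrightarrow> g \<in> L2h D \<Longrightarrow> \<phi> (\<lambda>z. f z + c * g z) = \<phi> f + c * \<phi> g"
    and cont: "\<And>F g. (\<And>n. F n \<in> L2h D) \<Longrightarrow> g \<in> L2h D \<Longrightarrow>
        (\<And>K. compact K \<Longrightarrow> K \<subseteq> D \<Longrightarrow> uniform_limit K F g sequentially) \<Longrightarrow> (\<lambda>n. \<phi> (F n)) \<longlonglongrightarrow> \<phi> g"
    and u: "u \<in> L2h D" "\<phi> u \<noteq> 0"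
  shows "\<exists>k\<in>L2h D. \<forall>f\<in>L2h D. L2_inner D f k = \<phi> f"
proof -
  have scale: "\<phi> (\<lambda>z. c * f z) = c * \<phi> f" if "f \<in> L2h D" for f c
    using add[OF that that, of "c - 1"] by (simp add: algebra_simps)
  define A where "A = {f \<in> L2h D. \<phi> f = 1}"
  have "(\<lambda>z. inverse (\<phi> u) * u z) \<in> A"
    using u by (simp add: A_def L2h_scale[OF D] scale)
  then have ne: "sqnorm D ` A \<noteq> {}" by auto
  define m where "m = Inf (sqnorm D ` A)"
  have bdd: "bdd_below (sqnorm D ` A)" using sqnorm_nonneg by (intro bdd_belowI[of _ 0]) auto
  have m_le: "m \<le> sqnorm D f" if "f \<in> A" for f unfolding m_def using that bdd by (intro cInf_lower) auto
  have "\<exists>f\<in>A. sqnorm D f < m + 1 / real (Suc n)" for n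
    using cInf_lessD[OF ne, of "m + 1 / real (Suc n)"] unfolding m_def by auto
  then obtain F where F: "\<And>n. F n \<in> A" "\<And>n. sqnorm D (F n) < m + 1 / real (Suc n)" by metis
  have FL: "F n \<in> L2h D" "\<phi> (F n) = 1" for n using F(1)[of n] by (auto simp: A_def)
  obtain g r where g: "g holomorphic_on D" and r: "strict_mono (r :: nat \<Rightarrow> nat)"
    and lim: "\<And>z. z \<in> D \<Longrightarrow> (\<lambda>n. F (r n) z) \<longlonglongrightarrow> g z"
    and ulim: "\<And>K. compact K \<Longrightarrow> K \<subseteq> D \<Longrightarrow> uniform_limit K (F \<circ> r) g sequentially"
  proof (rule Montel[OF D, of "range F" F])
    show "f holomorphic_on D" if "f \<in> range F" for f using that FL by (auto simp: L2h_def)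
    show "\<exists>B. \<forall>h\<in>range F. \<forall>z\<in>K. norm (h z) \<le> B" if K: "compact K" "K \<subseteq> D" for K
    proof -
      obtain e where e: "0 < e" "(\<Union>x\<in>K. cball x e) \<subseteq> D"
        using compact_subset_open_imp_cball_epsilon_subset[OF K(1) D K(2)] by blast
      have "cmod (F n z) \<le> sqrt (point_const / e\<^sup>2 * (m + 1))" if "z \<in> K" for n z
      proof (rule real_le_rsqrt)
        have "(cmod (F n z))\<^sup>2 \<le> point_const / e\<^sup>2 * sqnorm D (F n)"
          using e that by (intro L2h_point_bound[OF D FL(1)]) auto
        also have "1 / real (Suc n) \<le> 1" by simp
        then have "sqnorm D (F n) \<le> m + 1" using F(2)[of n] by linarith
        then have "point_const / e\<^sup>2 * sqnorm D (F n) \<le> point_const / e\<^sup>2 * (m + 1)"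
          using point_const_pos by (intro mult_left_mono) auto
        finally show "(cmod (F n z))\<^sup>2 \<le> point_const / e\<^sup>2 * (m + 1)" .
      qed
      then show ?thesis by blast
    qed
  qed auto
  have "(\<lambda>n. m + 1 / real (Suc n)) \<longlonglongrightarrow> m + 0"
    using LIMSEQ_inverse_real_of_nat by (intro tendsto_intros) (simp add: inverse_eq_divide)
  from LIMSEQ_subseq_LIMSEQ[OF this r]
  have Bl: "(\<lambda>n. m + 1 / real (Suc (r n))) \<longlonglongrightarrow> m" by (simp add: o_def)
  have gL: "g \<in> L2h D" and gm: "sqnorm D g \<le> m"
    using L2h_Fatou[OF D FL(1) g lim less_imp_le[OF F(2)] Bl] by auto
  have "(\<lambda>n. \<phi> ((F \<circ> r) n)) \<longlonglongrightarrow> \<phi> g" using FL gL ulim by (intro cont) (auto simp: o_def)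
  then have g1: "\<phi> g = 1" using FL by (simp add: LIMSEQ_const_iff)
  have orth: "L2_inner D g h = 0" if h: "h \<in> L2h D" "\<phi> h = 0" for h
  proof (rule ccontr)
    assume nz: "L2_inner D g h \<noteq> 0"
    have min: "sqnorm D g \<le> sqnorm D g + 2 * Re (cnj c * L2_inner D g h) + (cmod c)\<^sup>2 * sqnorm D h" for c
    proof -
      have "(\<lambda>z. g z + c * h z) \<in> A"
        unfolding A_def using L2h_add_mult[OF D gL h(1)] add[OF gL h(1)] g1 h(2) by simp
      then show ?thesis using m_le gm sqnorm_add_mult[OF D gL h(1), of c] by fastforce
    qed
    \<comment> \<open>Small enough that the quadratic term in c cannot compensate the linear gain: t
      times \<open>sqnorm D h\<close> is at most 1, but minimality would force it to be at least
      2.\<close>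
    define t where "t = 1 / (sqnorm D h + 1)"
    have t: "0 < t" using sqnorm_nonneg[of D h] by (simp add: t_def)
    define c where "c = - of_real t * L2_inner D g h"
    have "cnj c * L2_inner D g h = - of_real (t * (cmod (L2_inner D g h))\<^sup>2)"
      unfolding c_def of_real_mult complex_norm_square by simp
    then have 1: "Re (cnj c * L2_inner D g h) = - t * (cmod (L2_inner D g h))\<^sup>2" by simp
    have 2: "(cmod c)\<^sup>2 = t\<^sup>2 * (cmod (L2_inner D g h))\<^sup>2" unfolding c_def by (simp add: norm_mult power_mult_distrib)
    have "0 \<le> (cmod (L2_inner D g h))\<^sup>2 * (t\<^sup>2 * sqnorm D h - 2 * t)"
      using min[of c] unfolding 1 2 by (simp add: algebra_simps)
    moreover have "0 < (cmod (L2_inner D g h))\<^sup>2" using nz by simp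
    ultimately have "0 \<le> t\<^sup>2 * sqnorm D h - 2 * t" by (simp only: zero_le_mult_iff) linarith
    then have "0 \<le> t * (t * sqnorm D h - 2)" by (simp add: power2_eq_square algebra_simps)
    then have "2 \<le> t * sqnorm D h" using t by (simp add: zero_le_mult_iff)
    moreover have "t * sqnorm D h \<le> 1" using sqnorm_nonneg[of D h] by (simp add: t_def)
    ultimately show False by simp
  qed
  have pos: "0 < sqnorm D g"
  proof (rule ccontr)
    assume "\<not> 0 < sqnorm D g"
    then have "sqnorm D g = 0" using sqnorm_nonneg[of D g] by simp
    then have 0: "g z = 0" if "z \<in> D" for z using sqnorm_eq_0_imp[OF D gL _ that] by simp
    have zL: "(\<lambda>z. 0) \<in> L2h D" using L2h_scale[OF D gL, of 0] by simp
    \<comment> \<open>The function g vanishes on D but is arbitrary outside, so g and 0 may differ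
      as arguments of \<phi>. Continuity along the constant sequence 0 identifies their
      values.\<close>
    have "(\<lambda>n::nat. \<phi> (\<lambda>z. 0)) \<longlonglongrightarrow> \<phi> g"
    proof (rule cont)
      fix K assume "compact K" "K \<subseteq> D"
      then show "uniform_limit K (\<lambda>n z. 0) g sequentially"
        using 0 by (subst uniform_limit_cong'[where g = "\<lambda>n z. 0" and i = "\<lambda>z. 0"])
          (auto intro: uniform_limit_const)
    qed (use zL gL in auto)
    moreover have "\<phi> (\<lambda>z. 0) = 0" using scale[OF gL, of 0] by simp
    ultimately show False using g1 by (simp add: LIMSEQ_const_iff)
  qed
  define k where "k z = inverse (complex_of_real (sqnorm D g)) * g z" for z
  have kL: "k \<in> L2h D" unfolding k_def by (rule L2h_scale[OF D gL])
  have "L2_inner D f k = \<phi> f" if f: "f \<in> L2h D" for f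
  proof -
    define h where "h z = f z + (- \<phi> f) * g z" for z
    have hL: "h \<in> L2h D" unfolding h_def by (rule L2h_add_mult[OF D f gL])
    have "\<phi> h = 0" unfolding h_def add[OF f gL] using g1 by simp
    then have "L2_inner D h g = 0" using orth[OF hL] L2_inner_cnj[of D h g] by simp
    then have "L2_inner D f g = \<phi> f * of_real (sqnorm D g)"
      unfolding h_def L2_inner_add_mult_left[OF D f gL gL] by (simp add: L2_inner_self)
    moreover have "L2_inner D f k = inverse (of_real (sqnorm D g)) * L2_inner D f g"
    proof -
      have "cnj (L2_inner D k f) = cnj (inverse (of_real (sqnorm D g)) * L2_inner D g f)"
        using L2_inner_add_mult_left[OF D gL gL f, of "inverse (of_real (sqnorm D g)) - 1"]
        unfolding k_def by (simp add: algebra_simps)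
      then show ?thesis using L2_inner_cnj[of D f k] L2_inner_cnj[of D f g] by simp
    qed
    ultimately show ?thesis using pos by simp
  qed
  then show ?thesis using kL by blast
qed

text \<open>The Bergman kernel function K(., w) of two variables; the choice is unique on D
  only.\<close>

definition eval_rep :: "complex set \<Rightarrow> complex \<Rightarrow> complex \<Rightarrow> complex" where
  "eval_rep D w = (SOME k. k \<in> L2h D \<and> (\<forall>f\<in>L2h D. L2_inner D f k = f w))"

text \<open>The derivative of K(., w) with respect to the conjugate of w.\<close>

definition deriv_rep :: "complex set \<Rightarrow> complex \<Rightarrow> complex \<Rightarrow> complex" where
  "deriv_rep D w = (SOME k. k \<in> L2h D \<and> (\<forall>f\<in>L2h D. L2_inner D f k = deriv f w))"

lemma has_derivative_0_of_bound:
  fixes e :: "complex \<Rightarrow> complex"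
  assumes "open U" "w \<in> U" "e w = 0" "\<And>v. v \<in> U \<Longrightarrow> cmod (e v) \<le> g v * cmod (v - w)" "(g \<longlongrightarrow> 0) (at w)"
  shows "(e has_derivative (\<lambda>_. 0)) (at w)"
proof -
  have "((\<lambda>v. norm (e v - e w - 0) / norm (v - w)) \<longlongrightarrow> 0) (at w)"
  proof (rule Lim_null_comparison[OF _ assms(5)])
    have "eventually (\<lambda>v. v \<in> U) (at w)" using assms by (simp add: eventually_at_topological, blast)
    moreover have "eventually (\<lambda>v. v \<noteq> w) (at w)" by (simp add: eventually_at_filter)
    ultimately show "\<forall>\<^sub>F v in at w. norm (norm (e v - e w - 0) / norm (v - w)) \<le> g v"
      by eventually_elim (use assms in \<open>simp add: divide_le_eq\<close>)
  qed
  then show ?thesis by (simp add: has_derivative_iff_norm)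
qed

lemma cball_subset_of_ball:
  fixes w :: complex
  assumes "x \<in> ball w r"
  shows "cball x (2 * r) \<subseteq> cball w (3 * r)"
proof
  fix y assume "y \<in> cball x (2 * r)"
  then show "y \<in> cball w (3 * r)" using assms dist_triangle[of w y x] by auto
qed

section \<open>Representers of evaluation and of the derivative, and their dependence on the
  point\<close>

context
  fixes D :: "complex set"
  assumes D: "open D" "bounded D"
begin

lemma const_L2h: "(\<lambda>_. c) \<in> L2h D" and affine_L2h: "(\<lambda>z. z - w) \<in> L2h D"
proof -
  obtain R where R: "0 < R" "\<And>z. z \<in> D \<Longrightarrow> cmod z \<le> R" using D(2) bounded_pos by blast
  then have "D \<subseteq> cball 0 R" by auto
  note L = L2h_bounded_holomorphic(1)[OF D(1) this]
  show "(\<lambda>_. c) \<in> L2h D" using R by (intro L[of _ "cmod c"]) auto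
  show "(\<lambda>z. z - w) \<in> L2h D"
  proof (rule L[of _ "R + cmod w"])
    show "cmod (z - w) \<le> R + cmod w" if "z \<in> D" for z
      using R(2)[OF that] norm_triangle_ineq4[of z w] by linarith
  qed (use R in \<open>auto intro!: holomorphic_intros\<close>)
qed

lemma eval_rep:
  assumes w: "w \<in> D"
  shows "eval_rep D w \<in> L2h D" "f \<in> L2h D \<Longrightarrow> L2_inner D f (eval_rep D w) = f w"
proof -
  have "\<exists>k\<in>L2h D. \<forall>f\<in>L2h D. L2_inner D f k = f w"
  proof (rule L2h_Riesz[OF D(1), where u = "\<lambda>_. 1" and \<phi> = "\<lambda>f. f w"])
    fix F g assume "\<And>K. compact K \<Longrightarrow> K \<subseteq> D \<Longrightarrow> uniform_limit K F g sequentially"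
    from this[of "{w}"] show "(\<lambda>n. F n w) \<longlonglongrightarrow> g w"
      using w by (auto intro: tendsto_uniform_limitI[where S = "{w}"])
  qed (auto simp: const_L2h)
  then have "\<exists>k. k \<in> L2h D \<and> (\<forall>f\<in>L2h D. L2_inner D f k = f w)" by blast
  from someI_ex[OF this, folded eval_rep_def]
  show "eval_rep D w \<in> L2h D" "f \<in> L2h D \<Longrightarrow> L2_inner D f (eval_rep D w) = f w" by auto
qed

lemma L2h_differentiable: "f \<in> L2h D \<Longrightarrow> w \<in> D \<Longrightarrow> (f has_field_derivative deriv f w) (at w)"
  using D(1) by (auto simp: L2h_def intro: holomorphic_derivI)

lemma deriv_rep:
  assumes w: "w \<in> D"
  shows "deriv_rep D w \<in> L2h D" "f \<in> L2h D \<Longrightarrow> L2_inner D f (deriv_rep D w) = deriv f w"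
proof -
  obtain r where r: "0 < r" "cball w r \<subseteq> D" using D(1) w open_contains_cball by blast
  have "\<exists>k\<in>L2h D. \<forall>f\<in>L2h D. L2_inner D f k = deriv f w"
  proof (rule L2h_Riesz[OF D(1), where u = "\<lambda>z. z - w" and \<phi> = "\<lambda>f. deriv f w"])
    fix f g c assume "f \<in> L2h D" "g \<in> L2h D"
    then have "((\<lambda>z. f z + c * g z) has_field_derivative deriv f w + c * deriv g w) (at w)"
      by (intro DERIV_add DERIV_cmult L2h_differentiable w)
    then show "deriv (\<lambda>z. f z + c * g z) w = deriv f w + c * deriv g w" by (rule DERIV_imp_deriv)
  next
    fix F g assume F: "\<And>n. F n \<in> L2h D" and "\<And>K. compact K \<Longrightarrow> K \<subseteq> D \<Longrightarrow> uniform_limit K F g sequentially"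
    from this(2)[of "cball w r"] have "uniform_limit (cball w r) F g sequentially" using r by auto
    then have "uniform_limit (ball w r) F g sequentially" by (rule uniform_limit_on_subset) auto
    moreover have "F n holomorphic_on ball w r" for n
    proof -
      have "ball w r \<subseteq> D" using r ball_subset_cball by blast
      then show ?thesis using F[of n] holomorphic_on_subset unfolding L2h_def by blast
    qed
    ultimately show "(\<lambda>n. deriv (F n) w) \<longlonglongrightarrow> deriv g w"
      using r by (intro deriv_complex_uniform_limit[where A = "ball w r"]) auto
  next
    have "((\<lambda>z. z - w) has_field_derivative 1) (at w)" by (auto intro!: derivative_eq_intros)
    then show "deriv (\<lambda>z. z - w) w \<noteq> 0" by (simp add: DERIV_imp_deriv)
  qed (rule affine_L2h)
  then have "\<exists>k. k \<in> L2h D \<and> (\<forall>f\<in>L2h D. L2_inner D f k = deriv f w)" by blast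
  from someI_ex[OF this, folded deriv_rep_def]
  show "deriv_rep D w \<in> L2h D" "f \<in> L2h D \<Longrightarrow> L2_inner D f (deriv_rep D w) = deriv f w" by auto
qed

lemma L2h_near_bound:
  assumes f: "f \<in> L2h D" and r: "0 < r" "cball w (2 * r) \<subseteq> D" and v: "v \<in> cball w r"
  shows "cmod (f v) \<le> sqrt (point_const / r\<^sup>2 * sqnorm D f)"
proof (rule real_le_rsqrt, rule L2h_point_bound[OF D(1) f r(1)])
  have "cball v r \<subseteq> cball w (2 * r)" using v
    by (auto simp: subset_iff intro: order_trans[OF dist_triangle[of w _ v]])
  then show "cball v r \<subseteq> D" using r by blast
qed

lemma L2h_deriv_bound:
  assumes f: "f \<in> L2h D" and r: "0 < r" "cball w (2 * r) \<subseteq> D"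
  shows "(cmod (deriv f w))\<^sup>2 \<le> point_const / r ^ 4 * sqnorm D f"
proof -
  let ?B = "sqrt (point_const / r\<^sup>2 * sqnorm D f)"
  have hol: "f holomorphic_on cball w r"
  proof -
    have "cball w r \<subseteq> cball w (2 * r)" using r by (intro subset_cball) auto
    then have "cball w r \<subseteq> D" using r by blast
    then show ?thesis using f holomorphic_on_subset unfolding L2h_def by blast
  qed
  have "cmod ((deriv ^^ 1) f w) \<le> fact 1 * ?B / r ^ 1"
    by (intro Cauchy_inequality L2h_near_bound[OF f r] holomorphic_on_imp_continuous_on hol r
        holomorphic_on_subset[OF hol ball_subset_cball]) (simp add: dist_norm)
  then have "(cmod (deriv f w))\<^sup>2 \<le> (?B / r)\<^sup>2" by (intro power_mono) auto
  also have "\<dots> = point_const / r ^ 4 * sqnorm D f"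
    using point_const_pos sqnorm_nonneg[of D f] by (simp add: power_divide power2_eq_square power4_eq_xxxx)
  finally show ?thesis .
qed

text \<open>Cauchy's estimate bounds the second derivative at points of the ball of radius r; it
  uses values within a further r, each of which needs a disc of radius r in D, hence the total
  radius 3 r.\<close>

lemma L2h_Taylor_bound:
  assumes f: "f \<in> L2h D" and r: "0 < r" "cball w (3 * r) \<subseteq> D" and v: "v \<in> ball w r"
  shows "cmod (f v - f w - deriv f w * (v - w)) \<le> 2 * sqrt (point_const / r\<^sup>2 * sqnorm D f) / r\<^sup>2 * (cmod (v - w))\<^sup>2"
proof -
  let ?B = "sqrt (point_const / r\<^sup>2 * sqnorm D f)"
  have hol: "f holomorphic_on D" using f by (simp add: L2h_def)
  have sub: "cball x (2 * r) \<subseteq> D" if "x \<in> ball w r" for x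
    using cball_subset_of_ball[OF that] r by blast
  have ballD: "x \<in> D" if "x \<in> ball w r" for x using sub[OF that] r by auto
  have "cmod ((deriv ^^ 0) f v - (\<Sum>i\<le>1. (deriv ^^ i) f w * (v - w) ^ i / fact i))
      \<le> (2 * ?B / r\<^sup>2) * cmod (v - w) ^ Suc 1 / fact 1"
  proof (rule complex_Taylor[of "ball w r" 1 "\<lambda>i. (deriv ^^ i) f"])
    fix i x assume x: "x \<in> ball w r" "i \<le> (1::nat)"
    have "((deriv ^^ i) f has_field_derivative deriv ((deriv ^^ i) f) x) (at x)"
      using holomorphic_derivI[OF holomorphic_higher_deriv[OF hol D(1)] D(1) ballD[OF x(1)]] .
    then show "((deriv ^^ i) f has_field_derivative (deriv ^^ Suc i) f x) (at x within ball w r)"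
      by (simp add: has_field_derivative_at_within)
  next
    fix x assume x: "x \<in> ball w r"
    have "cball x r \<subseteq> D" using sub[OF x] r subset_cball[of r "2*r" x] by auto
    then have "f holomorphic_on cball x r" using hol holomorphic_on_subset by blast
    then have hx: "f holomorphic_on cball x r" .
    have "cmod ((deriv ^^ 2) f x) \<le> fact 2 * ?B / r ^ 2"
      by (intro Cauchy_inequality L2h_near_bound[OF f r(1) sub[OF x]] holomorphic_on_imp_continuous_on hx r
        holomorphic_on_subset[OF hx ball_subset_cball]) (simp add: dist_norm)
    then show "cmod ((deriv ^^ Suc 1) f x) \<le> 2 * ?B / r\<^sup>2" by (simp add: numeral_2_eq_2)
  qed (use v r in auto)
  then show ?thesis by (simp add: algebra_simps power2_eq_square)
qed

text \<open>Differentiation of P v v when P v is holomorphic in its argument and antiholomorphic in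
  v. Taylor expansion at w splits it into three terms: P v w, which is the conjugate of p; deriv (P
  v) w times v - w, where continuity of q allows q w in place of q v; and a remainder that is O(|v -
  w|^2) uniformly in v, because M bounds the norms of the P v near w.\<close>

lemma has_derivative_diagonal:
  assumes w: "w \<in> D" and P: "\<And>v. v \<in> D \<Longrightarrow> P v \<in> L2h D"
    and M: "open U" "w \<in> U" "\<And>v. v \<in> U \<Longrightarrow> v \<in> D \<and> sqnorm D (P v) \<le> M"
    and p: "\<And>v. v \<in> D \<Longrightarrow> P v w = cnj (p v)" "(p has_field_derivative p') (at w)"
    and q: "\<And>v. v \<in> D \<Longrightarrow> deriv (P v) w = cnj (q v)" "isCont q w"
  shows "((\<lambda>v. P v v) has_derivative (\<lambda>h. cnj (q w) * h + cnj (p' * h))) (at w)"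
proof -
  obtain R where R: "0 < R" "cball w R \<subseteq> D" using D(1) w open_contains_cball by blast
  define r where "r = R / 3"
  have r: "0 < r" "cball w (3 * r) \<subseteq> D" using R by (auto simp: r_def)
  let ?C = "2 * sqrt (point_const / r\<^sup>2 * M) / r\<^sup>2"
  have 1: "((\<lambda>v. P v v - P v w - deriv (P v) w * (v - w)) has_derivative (\<lambda>_. 0)) (at w)"
  proof (rule has_derivative_0_of_bound[of "U \<inter> ball w r" w _ "\<lambda>v. ?C * cmod (v - w)"])
    fix v assume v: "v \<in> U \<inter> ball w r"
    then have "cmod (P v v - P v w - deriv (P v) w * (v - w)) \<le> 2 * sqrt (point_const / r\<^sup>2 * sqnorm D (P v)) / r\<^sup>2 * (cmod (v - w))\<^sup>2"
      using M by (intro L2h_Taylor_bound P r) auto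
    also have "\<dots> \<le> ?C * (cmod (v - w))\<^sup>2"
      using M(3)[of v] v point_const_pos by (intro mult_right_mono divide_right_mono mult_left_mono real_sqrt_le_mono) auto
    finally show "cmod (P v v - P v w - deriv (P v) w * (v - w)) \<le> ?C * cmod (v - w) * cmod (v - w)"
      by (simp add: power2_eq_square mult.assoc)
  next
    show "((\<lambda>v. ?C * cmod (v - w)) \<longlongrightarrow> 0) (at w)"
      by (rule tendsto_eq_intros refl | simp)+
  qed (use M r in auto)
  have 2: "((\<lambda>v. cnj (q v) * (v - w) - cnj (q w) * (v - w)) has_derivative (\<lambda>_. 0)) (at w)"
  proof (rule has_derivative_0_of_bound[of UNIV w _ "\<lambda>v. cmod (cnj (q v) - cnj (q w))"])
    have "((\<lambda>v. cmod (cnj (q v) - cnj (q w))) \<longlongrightarrow> cmod (cnj (q w) - cnj (q w))) (at w)"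
      using q(2) by (intro tendsto_intros) (simp add: isCont_def)
    then show "((\<lambda>v. cmod (cnj (q v) - cnj (q w))) \<longlongrightarrow> 0) (at w)" by simp
    show "cmod (cnj (q v) * (v - w) - cnj (q w) * (v - w)) \<le> cmod (cnj (q v) - cnj (q w)) * cmod (v - w)" for v
      by (simp add: norm_mult flip: left_diff_distrib)
  qed auto
  have 3: "((\<lambda>v. cnj (p v)) has_derivative (\<lambda>h. cnj (p' * h))) (at w)"
    using p(2) unfolding has_field_derivative_def by (rule has_derivative_cnj)
  have 4: "((\<lambda>v. cnj (q w) * (v - w)) has_derivative (\<lambda>h. cnj (q w) * h)) (at w)"
    by (auto intro!: derivative_eq_intros)
  from has_derivative_add[OF has_derivative_add[OF has_derivative_add[OF 1 2] 3] 4]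
  have "((\<lambda>v. P v v - P v w - deriv (P v) w * (v - w) + (cnj (q v) * (v - w) - cnj (q w) * (v - w)) + cnj (p v) + cnj (q w) * (v - w))
      has_derivative (\<lambda>h. cnj (q w) * h + cnj (p' * h))) (at w)"
    by (simp add: add.commute)
  then show ?thesis
    by (rule has_derivative_transform_within_open[OF _ D(1) w]) (simp add: p q)
qed

lemma sqnorm_eval_rep: "w \<in> D \<Longrightarrow> of_real (sqnorm D (eval_rep D w)) = eval_rep D w w"
  using eval_rep(2)[OF _ eval_rep(1), of w w] by (simp add: L2_inner_self)

lemma sqnorm_deriv_rep: "w \<in> D \<Longrightarrow> of_real (sqnorm D (deriv_rep D w)) = deriv (deriv_rep D w) w"
  using deriv_rep(2)[OF _ deriv_rep(1), of w w] by (simp add: L2_inner_self)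

text \<open>Hermitian symmetry turns the parameter v into an argument. This and the two analogous
  rules show the antiholomorphic dependence on v that \<open>has_derivative_diagonal\<close>
  expects.\<close>

lemma eval_rep_sym: "v \<in> D \<Longrightarrow> w \<in> D \<Longrightarrow> eval_rep D v w = cnj (eval_rep D w v)"
  using eval_rep L2_inner_cnj by metis

lemma eval_deriv_rep: "v \<in> D \<Longrightarrow> w \<in> D \<Longrightarrow> deriv (eval_rep D v) w = cnj (deriv_rep D w v)"
  using eval_rep deriv_rep L2_inner_cnj by metis

lemma deriv_rep_sym: "v \<in> D \<Longrightarrow> w \<in> D \<Longrightarrow> deriv (deriv_rep D v) w = cnj (deriv (deriv_rep D w) v)"
  using deriv_rep L2_inner_cnj by metis

text \<open>A representer tested on itself gives its own squared norm x, so the point bound reads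
  x^2 \<le> c x and improves to x \<le> c.\<close>

lemma sqnorm_rep_bound:
  assumes r: "0 < r" "cball w (2 * r) \<subseteq> D"
  shows "sqnorm D (eval_rep D w) \<le> point_const / r\<^sup>2" "sqnorm D (deriv_rep D w) \<le> point_const / r ^ 4"
proof -
  have w: "w \<in> D" using r by auto
  have *: "x \<le> c" if "x\<^sup>2 \<le> c * x" "0 \<le> x" "0 \<le> c" for x c :: real
    using that by (cases "x = 0") (auto simp: power2_eq_square)
  have "cball w r \<subseteq> D" using r subset_cball[of r "2*r" w] by auto
  then have "(cmod (eval_rep D w w))\<^sup>2 \<le> point_const / r\<^sup>2 * sqnorm D (eval_rep D w)"
    by (intro L2h_point_bound D(1) eval_rep w r)
  then have "(sqnorm D (eval_rep D w))\<^sup>2 \<le> point_const / r\<^sup>2 * sqnorm D (eval_rep D w)"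
    by (simp only: sqnorm_eval_rep[OF w, symmetric] norm_of_real power2_abs)
  then show "sqnorm D (eval_rep D w) \<le> point_const / r\<^sup>2"
    by (rule * [OF _ sqnorm_nonneg]) (use point_const_pos in simp)
  have "(cmod (deriv (deriv_rep D w) w))\<^sup>2 \<le> point_const / r ^ 4 * sqnorm D (deriv_rep D w)"
    by (intro L2h_deriv_bound deriv_rep w r)
  then have "(sqnorm D (deriv_rep D w))\<^sup>2 \<le> point_const / r ^ 4 * sqnorm D (deriv_rep D w)"
    by (simp only: sqnorm_deriv_rep[OF w, symmetric] norm_of_real power2_abs)
  then show "sqnorm D (deriv_rep D w) \<le> point_const / r ^ 4"
    by (rule * [OF _ sqnorm_nonneg]) (use point_const_pos in simp)
qed

lemma sqnorm_rep_locally_bounded: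
  assumes w: "w \<in> D"
  obtains U M where "open U" "w \<in> U" "U \<subseteq> D" "\<And>v. v \<in> U \<Longrightarrow> sqnorm D (eval_rep D v) \<le> M"
    "\<And>v. v \<in> U \<Longrightarrow> sqnorm D (deriv_rep D v) \<le> M"
proof -
  obtain R where R: "0 < R" "cball w R \<subseteq> D" using D(1) w open_contains_cball by blast
  define r where "r = R / 3"
  have r: "0 < r" "cball w (3 * r) \<subseteq> D" using R by (auto simp: r_def)
  have sub: "cball x (2 * r) \<subseteq> D" if "x \<in> ball w r" for x
    using cball_subset_of_ball[OF that] r by blast
  show ?thesis
  proof (rule that[of "ball w r" "max (point_const / r\<^sup>2) (point_const / r ^ 4)"])
    show "ball w r \<subseteq> D" using sub r by force
  qed (use r sqnorm_rep_bound[OF r(1) sub] in \<open>auto simp: le_max_iff_disj\<close>)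
qed

text \<open>Cauchy-Schwarz bounds the supremum and the representer attains it; evaluating the
  constant 1 shows that the representer is not zero.\<close>

lemma bergman_kernel_eq:
  assumes w: "w \<in> D"
  shows "bergman_kernel D w = sqnorm D (eval_rep D w)" "0 < bergman_kernel D w"
proof -
  let ?k = "eval_rep D w"
  have k: "?k \<in> L2h D" by (rule eval_rep(1)[OF w])
  have kw: "?k w = of_real (sqnorm D ?k)" using sqnorm_eval_rep[OF w] by simp
  have "L2_inner D (\<lambda>_. 1) ?k = 1" using eval_rep(2)[OF w const_L2h] by simp
  moreover have "(cmod (L2_inner D (\<lambda>_. 1) ?k))\<^sup>2 \<le> sqnorm D (\<lambda>_. 1) * sqnorm D ?k"
    by (rule L2h_Cauchy_Schwarz[OF D(1) const_L2h k])
  ultimately have "sqnorm D ?k \<noteq> 0" by auto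
  then have pos: "0 < sqnorm D ?k" using sqnorm_nonneg[of D ?k] by simp
  show "bergman_kernel D w = sqnorm D ?k"
    unfolding bergman_kernel_def L2_norm_power2
  proof (rule cSup_eq_maximum)
    show "sqnorm D ?k \<in> {(cmod (f w))\<^sup>2 / sqnorm D f |f. f \<in> L2h D \<and> (\<exists>w\<in>D. f w \<noteq> 0)}"
    proof (intro CollectI exI conjI)
      show "sqnorm D ?k = (cmod (?k w))\<^sup>2 / sqnorm D ?k" using pos by (simp add: kw power2_eq_square)
      show "\<exists>w\<in>D. ?k w \<noteq> 0" using kw pos w by (intro bexI[of _ w]) auto
    qed (rule k)
    fix x assume "x \<in> {(cmod (f w))\<^sup>2 / sqnorm D f |f. f \<in> L2h D \<and> (\<exists>w\<in>D. f w \<noteq> 0)}"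
    then obtain f where f: "x = (cmod (f w))\<^sup>2 / sqnorm D f" "f \<in> L2h D" by blast
    have "(cmod (f w))\<^sup>2 \<le> sqnorm D f * sqnorm D ?k"
      using L2h_Cauchy_Schwarz[OF D(1) f(2) k] eval_rep(2)[OF w f(2)] by simp
    then show "x \<le> sqnorm D ?k"
      using sqnorm_nonneg[of D f] pos by (cases "sqnorm D f = 0") (auto simp: f(1) divide_le_eq mult.commute)
  qed
  then show "0 < bergman_kernel D w" using pos by simp
qed

lemma bergman_kernel_le:
  assumes w: "w \<in> D" and C: "\<And>f. f \<in> L2h D \<Longrightarrow> (cmod (f w))\<^sup>2 \<le> C * sqnorm D f"
  shows "bergman_kernel D w \<le> C"
proof -
  have "(sqnorm D (eval_rep D w))\<^sup>2 \<le> C * sqnorm D (eval_rep D w)"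
    using C[OF eval_rep(1)[OF w]] by (simp only: sqnorm_eval_rep[OF w, symmetric] norm_of_real power2_abs)
  then show ?thesis using bergman_kernel_eq[OF w] by (simp add: power2_eq_square)
qed

lemma has_derivative_bergman_kernel:
  assumes w: "w \<in> D"
  shows "(bergman_kernel D has_derivative (\<lambda>h. 2 * Re (deriv (eval_rep D w) w * h))) (at w)"
proof -
  obtain U M where U: "open U" "w \<in> U" "U \<subseteq> D" "\<And>v. v \<in> U \<Longrightarrow> sqnorm D (eval_rep D v) \<le> M"
    using sqnorm_rep_locally_bounded[OF w] by metis
  have "((\<lambda>v. eval_rep D v v) has_derivative
      (\<lambda>h. cnj (deriv_rep D w w) * h + cnj (deriv (eval_rep D w) w * h))) (at w)"
  proof (rule has_derivative_diagonal[where M = M and P = "eval_rep D" and p = "eval_rep D w" and q = "deriv_rep D w", OF w eval_rep(1) U(1,2)])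
    show "isCont (deriv_rep D w) w"
      using L2h_differentiable[OF deriv_rep(1)[OF w] w] by (rule DERIV_isCont)
  qed (use U w in \<open>auto intro: eval_rep_sym eval_deriv_rep L2h_differentiable eval_rep\<close>)
  then have "((\<lambda>v. Re (eval_rep D v v)) has_derivative
      (\<lambda>h. Re (deriv (eval_rep D w) w * h + cnj (deriv (eval_rep D w) w * h)))) (at w)"
    using eval_deriv_rep[OF w w] by (intro has_derivative_Re) simp
  moreover have "(\<lambda>h. Re (deriv (eval_rep D w) w * h + cnj (deriv (eval_rep D w) w * h)))
      = (\<lambda>h. 2 * Re (deriv (eval_rep D w) w * h))" by (auto simp: fun_eq_iff)
  ultimately have "((\<lambda>v. Re (eval_rep D v v)) has_derivative (\<lambda>h. 2 * Re (deriv (eval_rep D w) w * h))) (at w)"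
    by (simp only:)
  then show ?thesis
    by (rule has_derivative_transform_within_open[OF _ D(1) w])
       (simp add: bergman_kernel_eq flip: sqnorm_eval_rep)
qed

text \<open>On the diagonal \<open>deriv_rep\<close> is the conjugate Wirtinger derivative of K, so
  the coefficient of h is the mixed second derivative of K.\<close>

lemma has_derivative_deriv_rep_diagonal:
  assumes w: "w \<in> D"
  shows "((\<lambda>v. deriv_rep D v v) has_derivative
    (\<lambda>h. of_real (sqnorm D (deriv_rep D w)) * h + cnj (deriv (deriv (eval_rep D w)) w * h))) (at w)"
proof -
  obtain U M where U: "open U" "w \<in> U" "U \<subseteq> D" "\<And>v. v \<in> U \<Longrightarrow> sqnorm D (deriv_rep D v) \<le> M"
    using sqnorm_rep_locally_bounded[OF w] by metis
  have hol: "deriv (eval_rep D w) holomorphic_on D" "deriv (deriv_rep D w) holomorphic_on D"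
    using eval_rep(1)[OF w] deriv_rep(1)[OF w] D(1) by (auto simp: L2h_def intro: holomorphic_deriv)
  have "((\<lambda>v. deriv_rep D v v) has_derivative
      (\<lambda>h. cnj (deriv (deriv_rep D w) w) * h + cnj (deriv (deriv (eval_rep D w)) w * h))) (at w)"
  proof (rule has_derivative_diagonal[where M = M and P = "deriv_rep D" and p = "deriv (eval_rep D w)" and q = "deriv (deriv_rep D w)", OF w deriv_rep(1) U(1,2)])
    show "isCont (deriv (deriv_rep D w)) w"
      using holomorphic_derivI[OF hol(2) D(1) w] by (rule DERIV_isCont)
    show "deriv_rep D v w = cnj (deriv (eval_rep D w) v)" if "v \<in> D" for v
      using eval_deriv_rep[OF w that] by simp
    show "(deriv (eval_rep D w) has_field_derivative deriv (deriv (eval_rep D w)) w) (at w)"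
      using holomorphic_derivI[OF hol(1) D(1) w] .
  qed (use U w in \<open>auto intro: deriv_rep_sym\<close>)
  then show ?thesis by (simp flip: sqnorm_deriv_rep[OF w])
qed

end

section \<open>The Bergman metric\<close>

lemma wirtinger_eqs:
  assumes "(u has_derivative (\<lambda>h. a * h + b * cnj h)) (at z)"
  shows "wirtinger_z u z = a" "wirtinger_zbar u z = b"
proof -
  have *: "vector_derivative (\<lambda>t::real. u (z + e * of_real t)) (at 0) = a * e + b * cnj e" for e
  proof -
    have 1: "((\<lambda>t::real. z + e * of_real t) has_derivative (\<lambda>t. e * of_real t)) (at 0)"
      by (auto intro!: derivative_eq_intros)
    have "((\<lambda>t::real. u (z + e * of_real t)) has_derivative (\<lambda>t. a * (e * of_real t) + b * cnj (e * of_real t))) (at 0)"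
      by (rule has_derivative_compose[OF 1]) (simp add: assms)
    then have "((\<lambda>t::real. u (z + e * of_real t)) has_vector_derivative a * e + b * cnj e) (at 0)"
      unfolding has_vector_derivative_def
      by (rule has_derivative_eq_rhs) (auto simp: fun_eq_iff scaleR_conv_of_real algebra_simps)
    then show ?thesis by (rule vector_derivative_at)
  qed
  have x: "partial_x u z = a + b" using *[of 1] by (simp add: partial_x_def)
  have y: "partial_y u z = \<i> * a - \<i> * b" using *[of \<i>] by (simp add: partial_y_def algebra_simps)
  show "wirtinger_z u z = a" "wirtinger_zbar u z = b"
    unfolding wirtinger_z_def wirtinger_zbar_def x y by (auto simp: algebra_simps)
qed

context
  fixes D :: "complex set"
  assumes D: "open D" "bounded D"
begin

lemma wirtinger_zbar_ln_bergman_kernel: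
  assumes w: "w \<in> D"
  shows "wirtinger_zbar (\<lambda>w. of_real (ln (bergman_kernel D w))) w = deriv_rep D w w / of_real (bergman_kernel D w)"
proof -
  let ?K = "bergman_kernel D w" and ?A = "deriv (eval_rep D w) w"
  have K: "0 < ?K" using bergman_kernel_eq[OF D w] by simp
  have "((\<lambda>w. ln (bergman_kernel D w)) has_derivative (\<lambda>h. 2 * Re (?A * h) * inverse ?K)) (at w)"
    using DERIV_compose_FDERIV[OF DERIV_ln[OF K] has_derivative_bergman_kernel[OF D w]] .
  then have "((\<lambda>w. complex_of_real (ln (bergman_kernel D w))) has_derivative (\<lambda>h. complex_of_real (2 * Re (?A * h) * inverse ?K))) (at w)"
    by (rule has_derivative_of_real)
  moreover have "(\<lambda>h. complex_of_real (2 * Re (?A * h) * inverse ?K)) = (\<lambda>h. (?A / of_real ?K) * h + (cnj ?A / of_real ?K) * cnj h)"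
    using K by (auto simp: fun_eq_iff complex_eq_iff field_simps)
  ultimately have "wirtinger_zbar (\<lambda>w. of_real (ln (bergman_kernel D w))) w = cnj ?A / of_real ?K"
    by (simp only: wirtinger_eqs(2))
  then show ?thesis using eval_deriv_rep[OF D w w] by simp
qed

text \<open>The quotient rule for the conjugate derivative of log K. The mixed derivative of K is
  the squared norm of \<open>deriv_rep D w\<close>, and its conjugate derivative is
  \<open>deriv_rep D w w\<close>; the coefficient of cnj h, which involves the second derivative of
  the kernel function, is not seen by \<open>wirtinger_z\<close>.\<close>

lemma bergman_metric_eq:
  assumes w: "w \<in> D"
  shows "bergman_metric D w X = sqrt ((sqnorm D (deriv_rep D w) - (cmod (deriv_rep D w w))\<^sup>2 / bergman_kernel D w)
     / bergman_kernel D w * (cmod X)\<^sup>2)"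
proof -
  let ?K = "bergman_kernel D w" and ?A = "deriv (eval_rep D w) w" and ?d = "deriv_rep D w w"
    and ?N = "sqnorm D (deriv_rep D w)" and ?B = "deriv (deriv (eval_rep D w)) w"
  have K: "0 < ?K" using bergman_kernel_eq[OF D w] by simp
  have dA: "?A = cnj ?d" using eval_deriv_rep[OF D w w] by simp
  have 1: "((\<lambda>v. complex_of_real (bergman_kernel D v)) has_derivative (\<lambda>h. complex_of_real (2 * Re (?A * h)))) (at w)"
    by (rule has_derivative_of_real[OF has_derivative_bergman_kernel[OF D w]])
  let ?\<alpha> = "of_real ?N / of_real ?K - ?d * ?A / (of_real ?K)\<^sup>2"
    and ?\<beta> = "cnj ?B / of_real ?K - ?d * cnj ?A / (of_real ?K)\<^sup>2"
  have "((\<lambda>v. deriv_rep D v v / of_real (bergman_kernel D v)) has_derivative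
     (\<lambda>h. - ?d * (inverse (of_real ?K) * complex_of_real (2 * Re (?A * h)) * inverse (of_real ?K))
        + (of_real ?N * h + cnj (?B * h)) / of_real ?K)) (at w)"
    by (rule has_derivative_divide[OF has_derivative_deriv_rep_diagonal[OF D w] 1]) (use K in simp)
  then have "((\<lambda>v. deriv_rep D v v / of_real (bergman_kernel D v)) has_derivative
     (\<lambda>h. ?\<alpha> * h + ?\<beta> * cnj h)) (at w)"
  proof (rule has_derivative_eq_rhs, intro ext)
    fix h
    have "complex_of_real (2 * Re (?A * h)) = ?A * h + cnj ?A * cnj h"
      by (simp add: complex_eq_iff)
    then show "- ?d * (inverse (of_real ?K) * complex_of_real (2 * Re (?A * h)) * inverse (of_real ?K))
        + (of_real ?N * h + cnj (?B * h)) / of_real ?K = ?\<alpha> * h + ?\<beta> * cnj h"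
      using K by (simp add: field_simps power2_eq_square)
  qed
  then have "(wirtinger_zbar (\<lambda>w. of_real (ln (bergman_kernel D w))) has_derivative
     (\<lambda>h. ?\<alpha> * h + ?\<beta> * cnj h)) (at w)"
    by (rule has_derivative_transform_within_open[OF _ D(1) w]) (simp add: wirtinger_zbar_ln_bergman_kernel)
  from wirtinger_eqs(1)[OF this]
  have "wirtinger_z (wirtinger_zbar (\<lambda>w. of_real (ln (bergman_kernel D w)))) w
     = of_real ?N / of_real ?K - ?d * ?A / (of_real ?K)\<^sup>2" .
  also have "\<dots> = of_real ((?N - (cmod ?d)\<^sup>2 / ?K) / ?K)"
    unfolding dA complex_norm_square[symmetric] using K by (simp add: power2_eq_square diff_divide_distrib)
  finally show ?thesis unfolding bergman_metric_def by simp
qed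

lemma bergman_metric_scale:
  "w \<in> D \<Longrightarrow> bergman_metric D w X = bergman_metric D w 1 * cmod X"
  unfolding bergman_metric_eq real_sqrt_mult by simp

text \<open>A function vanishing at \<open>w\<close> is orthogonal to the evaluation functional, so only the component
  of the derivative functional orthogonal to it matters; the squared norm of that component is the
  numerator of the metric.\<close>

lemma bergman_metric_ge:
  assumes w: "w \<in> D" and f: "f \<in> L2h D" "f w = 0"
    and P: "sqnorm D f \<le> P" "bergman_kernel D w \<le> Q" "0 < P"
    and c: "0 \<le> c" "c\<^sup>2 * (P * Q) \<le> (cmod (deriv f w))\<^sup>2"
  shows "c * cmod X \<le> bergman_metric D w X"
proof -
  let ?K = "bergman_kernel D w" and ?d = "deriv_rep D w w" and ?N = "sqnorm D (deriv_rep D w)"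
  let ?S = "?N - (cmod ?d)\<^sup>2 / ?K"
  have K: "0 < ?K" "sqnorm D (eval_rep D w) = ?K" using bergman_kernel_eq[OF D w] by auto
  \<comment> \<open>The Gram-Schmidt coefficient that makes d' orthogonal to
    \<open>eval_rep D w\<close>.\<close>
  define c' where "c' = - ?d / of_real ?K"
  define d' where "d' z = deriv_rep D w z + c' * eval_rep D w z" for z
  note dL = deriv_rep(1)[OF D w] and kL = eval_rep(1)[OF D w]
  have d'L: "d' \<in> L2h D" unfolding d'_def by (rule L2h_add_mult[OF D(1) dL kL])
  have "L2_inner D d' f = cnj (deriv f w)"
    unfolding d'_def L2_inner_add_mult_left[OF D(1) dL kL f(1)]
    using L2_inner_cnj[of D "deriv_rep D w" f] L2_inner_cnj[of D "eval_rep D w" f] deriv_rep(2)[OF D w f(1)] eval_rep(2)[OF D w f(1)] f(2)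
    by simp
  then have CS: "(cmod (deriv f w))\<^sup>2 \<le> sqnorm D d' * sqnorm D f"
    using L2h_Cauchy_Schwarz[OF D(1) d'L f(1)] by simp
  have "sqnorm D d' = ?N + 2 * Re (cnj c' * ?d) + (cmod c')\<^sup>2 * ?K"
    unfolding d'_def sqnorm_add_mult[OF D(1) dL kL] K(2) eval_rep(2)[OF D w dL] ..
  also have "cnj c' * ?d = - of_real ((cmod ?d)\<^sup>2 / ?K)"
    unfolding c'_def by (simp add: complex_norm_square mult.commute del: of_real_power)
  also have "(cmod c')\<^sup>2 * ?K = (cmod ?d)\<^sup>2 / ?K"
    unfolding c'_def using K(1) by (simp add: norm_divide power_divide power2_eq_square)
  finally have S: "sqnorm D d' = ?S" by simp
  have "c\<^sup>2 * (P * ?K) \<le> c\<^sup>2 * (P * Q)" using P by (intro mult_left_mono) auto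
  also have "\<dots> \<le> ?S * sqnorm D f" using c CS S by simp
  also have "\<dots> \<le> ?S * P" using P sqnorm_nonneg[of D d'] S by (intro mult_left_mono) auto
  finally have "c\<^sup>2 * ?K \<le> ?S" using P(3) by (simp add: mult.left_commute mult.commute[of _ P])
  then have "c\<^sup>2 \<le> ?S / ?K" using K by (simp add: le_divide_eq)
  then have "(c * cmod X)\<^sup>2 \<le> ?S / ?K * (cmod X)\<^sup>2"
    unfolding power_mult_distrib by (rule mult_right_mono) simp
  then show ?thesis unfolding bergman_metric_eq[OF w] by (rule real_le_rsqrt)
qed

end

section \<open>Lengths of curves\<close>

text \<open>Dyadic shells in place of polar coordinates: on the k-th shell the integrand is at most
  its value on the inner circle, and the area is at most that of the outer disc,
  \<open>4 * pi * (2 ^ k * s)\<^sup>2\<close>.\<close>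

lemma annulus_integral_aux:
  fixes c :: complex
  assumes s: "0 < s"
  shows "integrable lborel (\<lambda>z. if s \<le> cmod (z - c) \<and> cmod (z - c) < 2 ^ n * s then 1 / cmod (z - c) ^ p else 0)"
    (is "integrable lborel (?G n)")
    and "(\<integral>z. (if s \<le> cmod (z - c) \<and> cmod (z - c) < 2 ^ n * s then 1 / cmod (z - c) ^ p else 0) \<partial>lborel)
      \<le> (\<Sum>k<n. 4 * pi * (2 ^ k * s)\<^sup>2 / (2 ^ k * s) ^ p)"
proof -
  have inv: "1 / x ^ p \<le> 1 / y ^ p" if "0 < y" "y \<le> x" for x y :: real
    using that by (intro frac_le power_mono zero_less_power) auto
  have int: "integrable lborel (?G n)" for n
  proof (rule Bochner_Integration.integrable_bound)
    show "integrable lborel (\<lambda>z. indicat_real (cball c (2 ^ n * s)) z * (1 / s ^ p))"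
      using borel_integrable_compact[of "cball c (2 ^ n * s)" "\<lambda>_. 1 / s ^ p"] by simp
    show "?G n \<in> borel_measurable lborel" by measurable
    show "AE z in lborel. norm (?G n z) \<le> norm (indicat_real (cball c (2 ^ n * s)) z * (1 / s ^ p))"
      using s by (intro AE_I2) (auto simp: indicator_def dist_norm norm_minus_commute intro!: inv)
  qed
  show "integrable lborel (?G n)" by (rule int)
  show "(\<integral>z. ?G n z \<partial>lborel) \<le> (\<Sum>k<n. 4 * pi * (2 ^ k * s)\<^sup>2 / (2 ^ k * s) ^ p)"
  proof (induction n)
    case 0
    have "?G 0 = (\<lambda>z. 0)" by (auto simp: fun_eq_iff)
    then show ?case by simp
  next
    case (Suc n)
    have mono: "2 ^ n * s \<le> 2 ^ Suc n * s" "s \<le> 2 ^ n * s" using s by auto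
    have "(\<integral>z. ?G (Suc n) z \<partial>lborel) = (\<integral>z. ?G n z + (?G (Suc n) z - ?G n z) \<partial>lborel)" by simp
    also have "\<dots> = (\<integral>z. ?G n z \<partial>lborel) + (\<integral>z. ?G (Suc n) z - ?G n z \<partial>lborel)"
      by (rule Bochner_Integration.integral_add[OF int Bochner_Integration.integrable_diff[OF int int]])
    also have "(\<integral>z. ?G (Suc n) z - ?G n z \<partial>lborel) \<le> pi * (2 ^ Suc n * s)\<^sup>2 * (1 / (2 ^ n * s) ^ p)"
    proof (rule integral_le_bound_cball)
      show "?G (Suc n) z - ?G n z \<le> 0" if "z \<notin> cball c (2 ^ Suc n * s)" for z
        using that s by (auto simp: dist_norm norm_minus_commute)
      show "?G (Suc n) z - ?G n z \<le> 1 / (2 ^ n * s) ^ p" for z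
      proof (cases "2 ^ n * s \<le> cmod (z - c)")
        case True
        then have "1 / cmod (z - c) ^ p \<le> 1 / (2 ^ n * s) ^ p"
          using s by (intro inv) auto
        then show ?thesis using True s by auto
      next
        case False
        then show ?thesis using mono s by auto
      qed
    qed (use s in auto)
    also have "pi * (2 ^ Suc n * s)\<^sup>2 * (1 / (2 ^ n * s) ^ p) = 4 * pi * (2 ^ n * s)\<^sup>2 / (2 ^ n * s) ^ p"
      by (simp add: power_mult_distrib power2_eq_square)
    finally show ?case using Suc by simp
  qed
qed

text \<open>For the exponent 2 every shell contributes the same amount 4 pi, so the bound is the
  number of shells, which is logarithmic in R / s; the factor 2 comes from ln 2 \<ge> 1/2.\<close>

lemma integral_le_quadratic_annulus:
  fixes c :: complex
  assumes s: "0 < s" "s < R" and M: "0 \<le> M"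
    and G: "\<And>z. s \<le> cmod (z - c) \<Longrightarrow> cmod (z - c) < R \<Longrightarrow> G z \<le> M / (cmod (z - c))\<^sup>2"
      "\<And>z. \<not> (s \<le> cmod (z - c) \<and> cmod (z - c) < R) \<Longrightarrow> G z \<le> 0"
  shows "(\<integral>z. G z \<partial>lborel) \<le> 4 * pi * M * (2 * ln (R / s) + 1)"
proof -
  define n where "n = nat \<lceil>log 2 (R / s)\<rceil>"
  have Rs: "1 < R / s" using s by simp
  have l0: "0 < log 2 (R / s)" using Rs by simp
  have n: "real n \<le> log 2 (R / s) + 1" "log 2 (R / s) \<le> real n" using l0 unfolding n_def by linarith+
  have "R / s = 2 powr log 2 (R / s)" using Rs by simp
  also have "\<dots> \<le> 2 powr real n" using n by (intro powr_mono) auto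
  finally have Rn: "R \<le> 2 ^ n * s" using s by (simp add: powr_realpow divide_le_eq)
  let ?H = "\<lambda>z. M * (if s \<le> cmod (z - c) \<and> cmod (z - c) < 2 ^ n * s then 1 / cmod (z - c) ^ 2 else 0)"
  have "(\<integral>z. G z \<partial>lborel) \<le> (\<integral>z. ?H z \<partial>lborel)"
  proof (rule integral_mono')
    show "integrable lborel ?H" by (intro integrable_mult_right annulus_integral_aux s)
    show "G z \<le> ?H z" for z
    proof (cases "s \<le> cmod (z - c) \<and> cmod (z - c) < R")
      case True then show ?thesis using G(1)[of z] Rn by auto
    next
      case False then show ?thesis using G(2)[of z] M by (auto intro: order_trans)
    qed
  qed (use M in auto)
  also have "\<dots> \<le> M * (\<Sum>k<n. 4 * pi * (2 ^ k * s)\<^sup>2 / (2 ^ k * s) ^ 2)"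
    unfolding integral_mult_right_zero by (intro mult_left_mono annulus_integral_aux s M)
  also have "(\<Sum>k<n. 4 * pi * (2 ^ k * s)\<^sup>2 / (2 ^ k * s) ^ 2) = 4 * pi * real n" using s by simp
  also have "real n \<le> 2 * ln (R / s) + 1"
  proof -
    have "1 / 2 \<le> ln (2::real)" using ln2_ge_two_thirds by simp
    then have "ln (R / s) / ln 2 \<le> ln (R / s) / (1 / 2)" using Rs by (intro divide_left_mono) auto
    then show ?thesis using n by (simp add: log_def)
  qed
  then have "M * (4 * pi * real n) \<le> M * (4 * pi * (2 * ln (R / s) + 1))"
    using M by (intro mult_left_mono) auto
  finally show ?thesis by (simp add: mult_ac)
qed

text \<open>For the exponent 4 the shells form a geometric series of ratio 1/4, so the bound does
  not depend on R; 4 pi times 4/3 is rounded up to 6 pi.\<close>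

lemma integral_le_quartic_annulus:
  fixes c :: complex
  assumes s: "0 < s" "s < R" and M: "0 \<le> M"
    and G: "\<And>z. s \<le> cmod (z - c) \<Longrightarrow> cmod (z - c) < R \<Longrightarrow> G z \<le> M / cmod (z - c) ^ 4"
      "\<And>z. \<not> (s \<le> cmod (z - c) \<and> cmod (z - c) < R) \<Longrightarrow> G z \<le> 0"
  shows "(\<integral>z. G z \<partial>lborel) \<le> 6 * pi * M / s\<^sup>2"
proof -
  obtain n :: nat where "R / s < 2 ^ n" using real_arch_pow[of 2 "R / s"] by auto
  then have Rn: "R \<le> 2 ^ n * s" using s by (simp add: divide_less_eq)
  let ?H = "\<lambda>z. M * (if s \<le> cmod (z - c) \<and> cmod (z - c) < 2 ^ n * s then 1 / cmod (z - c) ^ 4 else 0)"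
  have "(\<integral>z. G z \<partial>lborel) \<le> (\<integral>z. ?H z \<partial>lborel)"
  proof (rule integral_mono')
    show "integrable lborel ?H" by (intro integrable_mult_right annulus_integral_aux s)
    show "G z \<le> ?H z" for z
    proof (cases "s \<le> cmod (z - c) \<and> cmod (z - c) < R")
      case True then show ?thesis using G(1)[of z] Rn by auto
    next
      case False then show ?thesis using G(2)[of z] M by (auto intro: order_trans)
    qed
  qed (use M in auto)
  also have "\<dots> \<le> M * (\<Sum>k<n. 4 * pi * (2 ^ k * s)\<^sup>2 / (2 ^ k * s) ^ 4)"
    unfolding integral_mult_right_zero by (intro mult_left_mono annulus_integral_aux s M)
  also have "(\<Sum>k<n. 4 * pi * (2 ^ k * s)\<^sup>2 / (2 ^ k * s) ^ 4) = (\<Sum>k<n. 4 * pi / s\<^sup>2 * (1 / 4) ^ k)"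
  proof (rule sum.cong[OF refl])
    fix k :: nat
    have "(2::real) ^ k * 2 ^ k = 4 ^ k" by (simp flip: power_mult_distrib)
    then show "4 * pi * (2 ^ k * s)\<^sup>2 / (2 ^ k * s) ^ 4 = 4 * pi / s\<^sup>2 * (1 / 4) ^ k"
      using s by (simp add: power4_eq_xxxx power2_eq_square power_divide field_simps)
  qed
  also have "\<dots> = 4 * pi / s\<^sup>2 * (\<Sum>k<n. (1 / 4) ^ k)" by (rule sum_distrib_left[symmetric])
  also have "(\<Sum>k<n. (1 / 4 :: real) ^ k) \<le> 4 / 3"
    by (subst sum_gp_strict) auto
  then have "M * (4 * pi / s\<^sup>2 * (\<Sum>k<n. (1 / 4) ^ k)) \<le> M * (4 * pi / s\<^sup>2 * (4 / 3))"
    using M s by (intro mult_left_mono) auto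
  also have "\<dots> \<le> 6 * pi * M / s\<^sup>2" using M s by (simp add: field_simps)
  finally show ?thesis .
qed

text \<open>The indicator of the open interval makes the integrands of consecutive pieces of a curve
  disjoint, so that they can be summed under one integral.\<close>

lemma ennreal_increment_le_nn_integral:
  fixes \<psi> g :: "real \<Rightarrow> real"
  assumes ab: "a < b" and cont: "continuous_on {a..b} g"
    and der: "\<And>s. s \<in> {a..b} \<Longrightarrow> (\<psi> has_vector_derivative g s) (at s within {a..b})"
  shows "ennreal \<bar>\<psi> b - \<psi> a\<bar> \<le> (\<integral>\<^sup>+s. ennreal (indicat_real {a<..<b} s * \<bar>g s\<bar>) \<partial>lborel)"
    and "(\<lambda>s. ennreal (indicat_real {a<..<b} s * \<bar>g s\<bar>)) \<in> borel_measurable lborel"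
proof -
  have cont': "continuous_on {a..b} (\<lambda>s. \<bar>g s\<bar>)" using cont by (intro continuous_intros)
  have "continuous_on {a<..<b} (\<lambda>s. \<bar>g s\<bar>)" by (rule continuous_on_subset[OF cont']) auto
  then have "(\<lambda>s. indicat_real {a<..<b} s *\<^sub>R \<bar>g s\<bar>) \<in> borel_measurable borel"
    by (intro borel_measurable_continuous_on_indicator) auto
  then show "(\<lambda>s. ennreal (indicat_real {a<..<b} s * \<bar>g s\<bar>)) \<in> borel_measurable lborel" by simp
  have int: "set_integrable lborel {a..b} (\<lambda>s. \<bar>g s\<bar>)"
    unfolding set_integrable_def by (rule borel_integrable_compact[OF compact_Icc cont'])
  have "(g has_integral \<psi> b - \<psi> a) {a..b}"
    using ab der by (intro fundamental_theorem_of_calculus) auto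
  then have "\<bar>\<psi> b - \<psi> a\<bar> = \<bar>integral {a..b} g\<bar>" by (simp add: integral_unique)
  also have "\<dots> \<le> integral {a..b} (\<lambda>s. \<bar>g s\<bar>)"
    using integral_norm_bound_integral[OF integrable_continuous_real[OF cont] integrable_continuous_real[OF cont']] by simp
  also have "\<dots> = (\<integral>s. indicat_real {a..b} s *\<^sub>R \<bar>g s\<bar> \<partial>lborel)"
    using set_borel_integral_eq_integral(2)[OF int] by (simp add: set_lebesgue_integral_def)
  finally have "ennreal \<bar>\<psi> b - \<psi> a\<bar> \<le> ennreal (\<integral>s. indicat_real {a..b} s *\<^sub>R \<bar>g s\<bar> \<partial>lborel)" by (rule ennreal_leI)
  also have "\<dots> = (\<integral>\<^sup>+s. ennreal (indicat_real {a..b} s *\<^sub>R \<bar>g s\<bar>) \<partial>lborel)"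
    using int unfolding set_integrable_def by (intro nn_integral_eq_integral[symmetric]) auto
  also have "\<dots> = (\<integral>\<^sup>+s. ennreal (indicat_real {a<..<b} s * \<bar>g s\<bar>) \<partial>lborel)"
  proof (rule nn_integral_cong_AE)
    show "AE s in lborel. ennreal (indicat_real {a..b} s *\<^sub>R \<bar>g s\<bar>) = ennreal (indicat_real {a<..<b} s * \<bar>g s\<bar>)"
      using AE_lborel_singleton[of a] AE_lborel_singleton[of b]
      by eventually_elim (auto simp: indicator_def)
  qed
  finally show "ennreal \<bar>\<psi> b - \<psi> a\<bar> \<le> (\<integral>\<^sup>+s. ennreal (indicat_real {a<..<b} s * \<bar>g s\<bar>) \<partial>lborel)" .
qed

text \<open>A function whose gradient is dominated by the metric is 1-Lipschitz for the Bergman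
  distance. All lower bounds for distances come from such functions.\<close>

lemma bergman_length_ge:
  fixes u :: "complex \<Rightarrow> real"
  assumes D: "open D" "bounded D"
    and der: "\<And>w. w \<in> D \<Longrightarrow> (u has_derivative (\<lambda>v. du w \<bullet> v)) (at w)"
    and cont: "continuous_on D du"
    and le: "\<And>w. w \<in> D \<Longrightarrow> cmod (du w) \<le> bergman_metric D w 1"
    and \<alpha>: "piecewise_C1_curve \<alpha>" "path_image \<alpha> \<subseteq> D"
  shows "ennreal \<bar>u (pathfinish \<alpha>) - u (pathstart \<alpha>)\<bar> \<le> bergman_length D \<alpha>"
proof -
  obtain n t where t: "t 0 = 0" "t n = 1" "\<And>i. i < n \<Longrightarrow> t i < t (Suc i)"
    and pc: "\<And>i. i < n \<Longrightarrow> \<exists>\<alpha>'. continuous_on {t i..t (Suc i)} \<alpha>' \<and>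
           (\<forall>s\<in>{t i..t (Suc i)}. (\<alpha> has_vector_derivative \<alpha>' s) (at s within {t i..t (Suc i)}))"
    using \<alpha>(1) unfolding piecewise_C1_curve_def by blast
  obtain \<alpha>' where \<alpha>': "\<And>i. i < n \<Longrightarrow> continuous_on {t i..t (Suc i)} (\<alpha>' i)"
    "\<And>i s. i < n \<Longrightarrow> s \<in> {t i..t (Suc i)} \<Longrightarrow> (\<alpha> has_vector_derivative \<alpha>' i s) (at s within {t i..t (Suc i)})"
    using pc by metis
  have tmono: "t i \<le> t j" if "i \<le> j" "j \<le> n" for i j
    using that by (induction j) (auto simp: le_Suc_eq Suc_le_eq intro: order_trans[OF _ less_imp_le[OF t(3)]])
  have sub: "{t i..t (Suc i)} \<subseteq> {0..1}" if "i < n" for i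
    using tmono[of 0 i] tmono[of "Suc i" n] that t by auto
  have inD: "\<alpha> s \<in> D" if "s \<in> {0..1}" for s using \<alpha>(2) that by (auto simp: path_image_def)
  define g where "g i s = du (\<alpha> s) \<bullet> \<alpha>' i s" for i s
  let ?h = "\<lambda>i s. ennreal (indicat_real {t i<..<t (Suc i)} s * \<bar>g i s\<bar>)"
  have piece: "ennreal \<bar>u (\<alpha> (t (Suc i))) - u (\<alpha> (t i))\<bar> \<le> (\<integral>\<^sup>+s. ?h i s \<partial>lborel)"
    "?h i \<in> borel_measurable lborel" if i: "i < n" for i
  proof -
    have c\<alpha>: "continuous_on {t i..t (Suc i)} \<alpha>"
      using \<alpha>'(2)[OF i] by (intro continuous_on_vector_derivative) auto
    have "continuous_on {t i..t (Suc i)} (\<lambda>s. du (\<alpha> s))"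
      by (rule continuous_on_compose2[OF cont c\<alpha>]) (use sub[OF i] inD in auto)
    then have cg: "continuous_on {t i..t (Suc i)} (g i)"
      unfolding g_def by (intro continuous_intros \<alpha>'(1)[OF i])
    have dg: "((\<lambda>s. u (\<alpha> s)) has_vector_derivative g i s) (at s within {t i..t (Suc i)})"
      if s: "s \<in> {t i..t (Suc i)}" for s
    proof -
      have "(u has_derivative (\<lambda>v. du (\<alpha> s) \<bullet> v)) (at (\<alpha> s) within \<alpha> ` {t i..t (Suc i)})"
        using der[OF inD] sub[OF i] s has_derivative_at_withinI by blast
      from vector_derivative_diff_chain_within[OF \<alpha>'(2)[OF i s] this]
      show ?thesis by (simp add: g_def o_def)
    qed
    show "ennreal \<bar>u (\<alpha> (t (Suc i))) - u (\<alpha> (t i))\<bar> \<le> (\<integral>\<^sup>+s. ?h i s \<partial>lborel)" "?h i \<in> borel_measurable lborel"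
      using ennreal_increment_le_nn_integral[OF t(3)[OF i] cg dg] by auto
  qed
  have "u (\<alpha> 1) - u (\<alpha> 0) = (\<Sum>i<n. u (\<alpha> (t (Suc i))) - u (\<alpha> (t i)))"
    using sum_lessThan_telescope[of "\<lambda>i. u (\<alpha> (t i))" n] t by simp
  then have "\<bar>u (\<alpha> 1) - u (\<alpha> 0)\<bar> \<le> (\<Sum>i<n. \<bar>u (\<alpha> (t (Suc i))) - u (\<alpha> (t i))\<bar>)" by simp
  then have "ennreal \<bar>u (\<alpha> 1) - u (\<alpha> 0)\<bar> \<le> ennreal (\<Sum>i<n. \<bar>u (\<alpha> (t (Suc i))) - u (\<alpha> (t i))\<bar>)" by (rule ennreal_leI)
  also have "\<dots> = (\<Sum>i<n. ennreal \<bar>u (\<alpha> (t (Suc i))) - u (\<alpha> (t i))\<bar>)" by (simp add: sum_ennreal)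
  also have "\<dots> \<le> (\<Sum>i<n. \<integral>\<^sup>+s. ?h i s \<partial>lborel)" by (intro sum_mono piece) auto
  also have "\<dots> = (\<integral>\<^sup>+s. (\<Sum>i<n. ?h i s) \<partial>lborel)"
    by (rule nn_integral_sum[symmetric]) (use piece in auto)
  also have "\<dots> \<le> bergman_length D \<alpha>"
    unfolding bergman_length_def
  \<comment> \<open>Pointwise at most one summand is nonzero, and all vanish at the break points,
    where the two-sided derivative may fail to exist.\<close>
  proof (rule nn_integral_mono)
    fix s :: real
    let ?m = "ennreal (bergman_metric D (\<alpha> s) (vector_derivative \<alpha> (at s))) * indicator {0..1} s"
    show "(\<Sum>i<n. ?h i s) \<le> ?m"
    proof (cases "\<exists>j<n. s \<in> {t j<..<t (Suc j)}")
      case True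
      then obtain j where j: "j < n" "s \<in> {t j<..<t (Suc j)}" by blast
      have other: "s \<notin> {t i<..<t (Suc i)}" if "i < n" "i \<noteq> j" for i
      proof (cases "i < j")
        case True
        then have "t (Suc i) \<le> t j" using j by (intro tmono) auto
        then show ?thesis using j by auto
      next
        case False
        then have "t (Suc j) \<le> t i" using that by (intro tmono) auto
        then show ?thesis using j by auto
      qed
      have "(\<Sum>i<n. ?h i s) = (\<Sum>i\<in>{j}. ?h i s)"
        by (rule sum.mono_neutral_right) (use j other in auto)
      also have "\<dots> = ennreal \<bar>g j s\<bar>" using j by simp
      also have "\<bar>g j s\<bar> \<le> bergman_metric D (\<alpha> s) (vector_derivative \<alpha> (at s))"
      proof -
        have s01: "s \<in> {0..1}" using sub[OF j(1)] j(2) by auto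
        have "at s within {t j..t (Suc j)} = at s" using j by (intro at_within_Icc_at) auto
        then have "(\<alpha> has_vector_derivative \<alpha>' j s) (at s)" using \<alpha>'(2)[OF j(1), of s] j(2) by simp
        then have vd: "vector_derivative \<alpha> (at s) = \<alpha>' j s" by (rule vector_derivative_at)
        have "\<bar>g j s\<bar> \<le> cmod (du (\<alpha> s)) * cmod (\<alpha>' j s)"
          unfolding g_def by (rule Cauchy_Schwarz_ineq2)
        also have "\<dots> \<le> bergman_metric D (\<alpha> s) 1 * cmod (\<alpha>' j s)"
          by (intro mult_right_mono le inD s01) auto
        also have "\<dots> = bergman_metric D (\<alpha> s) (\<alpha>' j s)"
          by (rule bergman_metric_scale[OF D inD[OF s01], symmetric])
        finally show ?thesis unfolding vd .
      qed
      then have "ennreal \<bar>g j s\<bar> \<le> ?m" using sub[OF j(1)] j(2) by (auto intro: ennreal_leI)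
      finally show ?thesis .
    next
      case False
      then have "(\<Sum>i<n. ?h i s) = 0" by (intro sum.neutral) auto
      then show ?thesis by simp
    qed
  qed
  finally show ?thesis by (simp add: pathstart_def pathfinish_def)
qed

lemma bergman_dist_ge:
  fixes u :: "complex \<Rightarrow> real"
  assumes D: "open D" "bounded D"
    and der: "\<And>w. w \<in> D \<Longrightarrow> (u has_derivative (\<lambda>v. du w \<bullet> v)) (at w)"
    and cont: "continuous_on D du"
    and le: "\<And>w. w \<in> D \<Longrightarrow> cmod (du w) \<le> bergman_metric D w 1"
  shows "ennreal \<bar>u z - u w\<bar> \<le> bergman_dist D w z"
  unfolding bergman_dist_def
  by (rule Inf_greatest) (use bergman_length_ge[OF assms] in auto)

section \<open>A Zalcman type domain\<close>

text \<open>The quadratic exponent makes consecutive ratios 16^(2 n + 3) unbounded; the inner cutoff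
  in the kernel bound depends on this growth.\<close>

definition ctr :: "nat \<Rightarrow> real" where "ctr n = (1 / 16) ^ (Suc n)\<^sup>2"

text \<open>The factor 1/8 is chosen so that the cutoff radii \<open>2 * hrad n\<close> and
  \<open>ctr n / 4\<close> have exactly \<open>(real (Suc n) / ctr n)\<^sup>2\<close> as the
  logarithm of their ratio.\<close>

definition hrad :: "nat \<Rightarrow> real" where "hrad n = ctr n / 8 * exp (- (real (Suc n) / ctr n)\<^sup>2)"

definition zalcman :: "complex set" where
  "zalcman = {z. cmod z < 1 \<and> z \<noteq> 0 \<and> (\<forall>n. hrad n < cmod (z - of_real (ctr n)))}"

abbreviation hdist :: "complex \<Rightarrow> nat \<Rightarrow> real" where
  "hdist z n \<equiv> cmod (z - of_real (ctr n))"

lemma ctr_pos [simp]: "0 < ctr n"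
  by (simp add: ctr_def)

lemma ctr_Suc: "ctr (Suc n) = ctr n / 16 ^ (2 * n + 3)"
proof -
  have "(Suc (Suc n))\<^sup>2 = (Suc n)\<^sup>2 + (2 * n + 3)" by (simp add: power2_eq_square)
  then show ?thesis unfolding ctr_def by (simp only: power_add) (simp add: power_one_over divide_simps)
qed

lemma ctr_Suc_le: "ctr (Suc n) \<le> ctr n / 16"
proof -
  have "(16::real) ^ 1 \<le> 16 ^ (2 * n + 3)" by (intro power_increasing) auto
  then show ?thesis unfolding ctr_Suc by (intro divide_left_mono) (auto simp: less_imp_le)
qed

lemma ctr_less: "m < n \<Longrightarrow> ctr n \<le> ctr m / 16"
proof (induction n)
  case (Suc n)
  show ?case
  proof (cases "m = n")
    case False
    then have "ctr n \<le> ctr m / 16" using Suc by simp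
    then show ?thesis using ctr_Suc_le[of n] ctr_pos[of n] by linarith
  qed (use ctr_Suc_le in simp)
qed simp

lemma ctr_mono: "m \<le> n \<Longrightarrow> ctr n \<le> ctr m"
  using ctr_less[of m n] less_imp_le[OF ctr_pos[of m]] by (cases "m = n") auto

lemma ctr_le: "ctr n \<le> 1 / 16"
  using ctr_mono[of 0 n] by (simp add: ctr_def)

lemma ctr_le_power: "ctr n \<le> (1 / 16) ^ n"
  unfolding ctr_def by (intro power_decreasing) (auto simp: power2_eq_square)

lemma ctr_lt:
  assumes "0 < e" obtains N where "ctr N < e" "k \<le> N"
proof -
  obtain j where j: "(1 / 16 :: real) ^ j < e" using real_arch_pow_inv[of e "1/16"] assms by auto
  have "ctr (max j k) \<le> ctr j" by (rule ctr_mono) simp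
  then show ?thesis using that[of "max j k"] ctr_le_power[of j] j by simp
qed

lemma hrad_pos [simp]: "0 < hrad n"
  by (simp add: hrad_def)

lemma hrad_le: "hrad n \<le> ctr n / 8"
proof -
  have "ctr n / 8 * exp (- (real (Suc n) / ctr n)\<^sup>2) \<le> ctr n / 8 * 1"
    by (intro mult_left_mono) (auto simp: less_imp_le)
  then show ?thesis by (simp add: hrad_def)
qed

section \<open>Separation of the holes, openness and connectedness\<close>

lemma dist_ctr:
  "cmod z \<le> hdist z n + ctr n"
  "ctr n \<le> hdist z n + cmod z"
  "hdist z n \<le> cmod z + ctr n"
  using norm_triangle_sub[of z "of_real (ctr n)"] norm_triangle_sub[of "of_real (ctr n)" z]
    norm_triangle_ineq4[of z "of_real (ctr n)"] less_imp_le[OF ctr_pos[of n]]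
  by (simp_all add: norm_minus_commute)

text \<open>Centres drop by a factor of at least 16, so a disc of radius \<open>ctr k / 4\<close>
  about the k-th centre stays in its own scale. This keeps the supports of the hole cutoffs apart
  from each other and from the inner and outer transitions.\<close>

lemma disc_ctr:
  assumes "hdist z k < ctr k / 4"
  shows "cmod z < 5 / 8" "3 / 4 * ctr k < cmod z" "m \<noteq> k \<Longrightarrow> ctr m / 4 < hdist z m"
proof -
  have z: "cmod z < 5/4 * ctr k" "3 / 4 * ctr k < cmod z"
    using dist_ctr(1)[of z k] dist_ctr(2)[of k z] assms by linarith+
  then show "cmod z < 5 / 8" "3 / 4 * ctr k < cmod z" using ctr_le[of k] by linarith+
  assume "m \<noteq> k"
  then consider "m < k" | "k < m" by linarith
  then show "ctr m / 4 < hdist z m"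
  proof cases
    case 1
    then show ?thesis using ctr_less[OF 1] z dist_ctr(2)[of m z] ctr_pos[of m] by linarith
  next
    case 2
    then show ?thesis using ctr_less[OF 2] z dist_ctr(1)[of z m] ctr_pos[of m] by linarith
  qed
qed

text \<open>The holes accumulate only at the origin, so near z all but finitely many are far away:
  for indices from N on they lie within |z| / 2 of the origin.\<close>

lemma open_zalcman: "open zalcman"
proof (subst open_subopen, intro ballI)
  fix z assume z: "z \<in> zalcman"
  then have "0 < cmod z / 4" by (auto simp: zalcman_def)
  then obtain N where N: "ctr N < cmod z / 4" by (rule ctr_lt)
  let ?U = "ball z (cmod z / 2) \<inter> ball 0 1 \<inter> (\<Inter>n\<in>{..<N}. - cball (of_real (ctr n)) (hrad n))"
  have "open ?U" by (intro open_Int open_INT) (auto simp: open_Compl)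
  moreover have "z \<in> ?U" using z by (auto simp: zalcman_def dist_norm norm_minus_commute not_le)
  moreover have "?U \<subseteq> zalcman"
  proof
    fix v assume v: "v \<in> ?U"
    have "cmod z - cmod v \<le> cmod (z - v)" by (rule norm_triangle_ineq2)
    then have v2: "cmod z / 2 < cmod v" using v by (simp add: dist_norm)
    have "hrad n < hdist v n" for n
    proof (cases "n < N")
      case True
      then have "v \<notin> cball (of_real (ctr n)) (hrad n)" using v by blast
      then show ?thesis by (simp add: dist_norm norm_minus_commute not_le)
    next
      case False
      then have "ctr n \<le> ctr N" by (intro ctr_mono) simp
      then show ?thesis using N v2 dist_ctr(1)[of v n] hrad_le[of n] ctr_pos[of n] by linarith
    qed
    then show "v \<in> zalcman" using v v2 by (auto simp: zalcman_def)
  qed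
  ultimately show "\<exists>T. open T \<and> z \<in> T \<and> T \<subseteq> zalcman" by blast
qed

text \<open>Discs are removed one at a time. By Janiszewski's theorem the union of the next disc and
  the complement of the current set has connected complement, since each of the two does and they
  are disjoint.\<close>

lemma connected_diff_disjoint_cballs:
  fixes c :: "'i \<Rightarrow> complex"
  assumes "finite I" "open U" "connected U"
    and "\<And>i. i \<in> I \<Longrightarrow> cball (c i) (r i) \<subseteq> U"
    and "\<And>i j. i \<in> I \<Longrightarrow> j \<in> I \<Longrightarrow> i \<noteq> j \<Longrightarrow> cball (c i) (r i) \<inter> cball (c j) (r j) = {}"
  shows "connected (U - (\<Union>i\<in>I. cball (c i) (r i)))"
  using assms(1,4,5)
proof (induction I)
  case empty
  then show ?case using assms by simp
next
  case (insert i I)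
  let ?V = "U - (\<Union>i\<in>I. cball (c i) (r i))"
  have V: "connected ?V" using insert by (intro insert.IH) auto
  have opV: "open ?V" using insert(1) assms(2) by (intro open_Diff closed_UN) auto
  have "cball (c i) (r i) \<subseteq> ?V" using insert(2,4,5) by blast
  then have dis: "cball (c i) (r i) \<inter> - ?V = {}" by blast
  have "connected (- (cball (c i) (r i) \<union> - ?V))"
  proof (rule Janiszewski_connected)
    show "connected (- cball (c i) (r i))"
      by (rule connected_complement_bounded_convex) auto
    show "closed (- ?V)" using opV by (simp only: closed_Compl)
    show "connected (cball (c i) (r i) \<inter> - ?V)" unfolding dis by simp
    show "connected (- (- ?V))" unfolding double_complement by (rule V)
  qed simp
  also have "- (cball (c i) (r i) \<union> - ?V) = U - (\<Union>i\<in>insert i I. cball (c i) (r i))" by blast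
  finally show ?case .
qed

text \<open>The sets \<open>E N\<close> replace the origin and all holes from the N-th on by a
  single closed disc of radius \<open>2 * ctr N\<close>, so only finitely many disjoint discs are
  removed. They exhaust the domain and all contain 3/4.\<close>

lemma connected_zalcman: "connected zalcman"
proof -
  define c where "c i = (case i of None \<Rightarrow> 0 | Some m \<Rightarrow> complex_of_real (ctr m))" for i
  define r where "r N i = (case i of None \<Rightarrow> 2 * ctr N | Some m \<Rightarrow> hrad m)" for N i
  define E where "E N = ball 0 1 - (\<Union>i\<in>insert None (Some ` {..<N}). cball (c i) (r N i))" for N
  have zero: "ctr m / 4 < hdist z m" if "z \<in> cball 0 (2 * ctr N)" "m < N" for z m N
    using that ctr_less[OF that(2)] dist_ctr(2)[of m z] ctr_pos[of m] unfolding mem_cball_0 by linarith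
  have sm: "hdist z m < ctr m / 4" if "z \<in> cball (of_real (ctr m)) (hrad m)" for z m
  proof -
    have "hdist z m \<le> hrad m" using that by (simp add: dist_norm norm_minus_commute)
    then show ?thesis using hrad_le[of m] ctr_pos[of m] by linarith
  qed
  have mem: "z \<in> E N \<longleftrightarrow> cmod z < 1 \<and> 2 * ctr N < cmod z \<and> (\<forall>m<N. hrad m < hdist z m)" for z N
    by (auto simp: E_def c_def r_def dist_norm norm_minus_commute not_le)
  have conE: "connected (E N)" for N
    unfolding E_def
  proof (rule connected_diff_disjoint_cballs)
    fix i assume "i \<in> insert None (Some ` {..<N})"
    then show "cball (c i) (r N i) \<subseteq> ball 0 1"
    proof
      assume "i = None"
      then show ?thesis using ctr_le[of N] by (auto simp: c_def r_def)
    next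
      assume "i \<in> Some ` {..<N}"
      then obtain m where "i = Some m" by blast
      moreover have "z \<in> ball 0 1" if "z \<in> cball (complex_of_real (ctr m)) (hrad m)" for z
        using disc_ctr(1)[OF sm[OF that]] by simp
      ultimately show ?thesis by (auto simp: c_def r_def)
    qed
  next
    fix i j assume ij: "i \<in> insert None (Some ` {..<N})" "j \<in> insert None (Some ` {..<N})" "i \<noteq> j"
    have A: "cball 0 (2 * ctr N) \<inter> cball (complex_of_real (ctr m)) (hrad m) = {}" if "m < N" for m
    proof -
      have False if "z \<in> cball 0 (2 * ctr N)" "z \<in> cball (complex_of_real (ctr m)) (hrad m)" for z
        using zero[OF that(1) \<open>m < N\<close>] sm[OF that(2)] by linarith
      then show ?thesis by blast
    qed
    have B: "cball (complex_of_real (ctr k)) (hrad k) \<inter> cball (of_real (ctr m)) (hrad m) = {}" if "m \<noteq> k" for m k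
    proof -
      have False if "z \<in> cball (complex_of_real (ctr k)) (hrad k)" "z \<in> cball (of_real (ctr m)) (hrad m)" for z
        using disc_ctr(3)[OF sm[OF that(1)] \<open>m \<noteq> k\<close>] sm[OF that(2)] by linarith
      then show ?thesis by blast
    qed
    show "cball (c i) (r N i) \<inter> cball (c j) (r N j) = {}"
      using ij A B by (cases i; cases j) (auto simp: c_def r_def Int_commute)
  qed auto
  have "zalcman = (\<Union>N. E N)"
  proof (intro equalityI subsetI)
    fix z assume z: "z \<in> zalcman"
    then have "0 < cmod z / 2" by (auto simp: zalcman_def)
    then obtain N where "ctr N < cmod z / 2" by (rule ctr_lt)
    then have "z \<in> E N" using z unfolding mem by (auto simp: zalcman_def)
    then show "z \<in> (\<Union>N. E N)" by blast
  next
    fix z assume "z \<in> (\<Union>N. E N)"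
    then obtain N where z: "z \<in> E N" by blast
    then have z1: "cmod z < 1" "2 * ctr N < cmod z" "\<And>m. m < N \<Longrightarrow> hrad m < hdist z m"
      unfolding mem by auto
    have "hrad n < hdist z n" for n
    proof (cases "n < N")
      case False
      then have "ctr n \<le> ctr N" by (intro ctr_mono) simp
      then show ?thesis using z1(2) dist_ctr(1)[of z n] hrad_le[of n] ctr_pos[of n] by linarith
    qed (use z1 in auto)
    moreover have "0 < cmod z" using z1(2) ctr_pos[of N] by linarith
    then have "z \<noteq> 0" by simp
    ultimately show "z \<in> zalcman" using z1 by (auto simp: zalcman_def)
  qed
  moreover have "connected (\<Union>N. E N)"
  proof (rule connected_Union)
    have far: "hrad m < cmod (3 / 4 - complex_of_real (ctr m))" for m
      using dist_ctr(1)[of "3/4" m] ctr_le[of m] hrad_le[of m] by simp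
    have "(3 / 4 :: complex) \<in> E N" for N
      unfolding mem using far ctr_le[of N] by simp
    then show "\<Inter> (range E) \<noteq> {}" by blast
  qed (use conE in auto)
  ultimately show ?thesis by simp
qed

lemma zalcman_subset: "zalcman \<subseteq> cball 0 1"
  by (auto simp: zalcman_def)

lemma bounded_zalcman: "bounded zalcman"
  using zalcman_subset bounded_subset[OF bounded_cball] by blast

lemma bounded_domain_zalcman: "bounded_domain zalcman"
proof -
  have "hrad m < cmod (3 / 4 - complex_of_real (ctr m))" for m
    using dist_ctr(1)[of "3/4" m] ctr_le[of m] hrad_le[of m] by simp
  then have "3 / 4 \<in> zalcman" by (simp add: zalcman_def)
  then show ?thesis
    using open_zalcman connected_zalcman bounded_zalcman unfolding bounded_domain_def by blast
qed

section \<open>An upper bound for the kernel\<close>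

lemma rad_eq_1: "0 < s \<Longrightarrow> s < R \<Longrightarrow> cmod (z - c) \<le> s \<Longrightarrow> rad c (s\<^sup>2) (R\<^sup>2) z = 1"
  unfolding rad_def by (intro logcut_below power_mono power_strict_mono) auto

lemma rad_eq_0: "0 < s \<Longrightarrow> s < R \<Longrightarrow> R \<le> cmod (z - c) \<Longrightarrow> rad c (s\<^sup>2) (R\<^sup>2) z = 0"
  unfolding rad_def by (intro logcut_above power_mono power_strict_mono) auto

lemma cmod_drad_annulus:
  assumes s: "0 < s" "s < R"
  shows "cmod (drad c (s\<^sup>2) (R\<^sup>2) z) \<le> (if s < cmod (z - c) \<and> cmod (z - c) < R then 4 / (cmod (z - c) * ln (R / s)) else 0)"
proof -
  have AB: "0 < s\<^sup>2" "s\<^sup>2 < R\<^sup>2" using s by (auto intro: power_strict_mono)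
  have "ln (R\<^sup>2) - ln (s\<^sup>2) = 2 * ln (R / s)" using s by (simp add: ln_realpow ln_div)
  moreover have "s\<^sup>2 < (cmod (z - c))\<^sup>2 \<and> (cmod (z - c))\<^sup>2 < R\<^sup>2 \<longleftrightarrow> s < cmod (z - c) \<and> cmod (z - c) < R"
  proof -
    have "x\<^sup>2 < y\<^sup>2 \<longleftrightarrow> x < y" if "0 \<le> x" "0 \<le> y" for x y :: real
      using that by (meson power_less_imp_less_base power_strict_mono zero_less_numeral)
    then show ?thesis using s by simp
  qed
  moreover have "8 / (x * (2 * y)) = 4 / (x * y)" for x y :: real
    by (simp add: divide_simps)
  ultimately show ?thesis using cmod_drad_le[OF AB, of c z] by (simp only:)
qed

lemma drad_eq_0: "0 < s \<Longrightarrow> s < R \<Longrightarrow> \<not> (s < cmod (z - c) \<and> cmod (z - c) < R) \<Longrightarrow> drad c (s\<^sup>2) (R\<^sup>2) z = 0"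
  using cmod_drad_annulus[of s R c z] by auto

text \<open>The squared gradient is of order \<rho>^(-2) \<Lambda>^(-2) at distance \<rho> from c,
  where \<Lambda> = ln (R / s); its integral over the annulus is of order 1 / \<Lambda>. This gain
  is the reason for a logarithmic profile; the distance d to w contributes 1 / d^2.\<close>

lemma drad_energy:
  assumes s: "0 < s" "s < R" and d: "0 < d" "\<And>z. s < cmod (z - c) \<Longrightarrow> cmod (z - c) < R \<Longrightarrow> d \<le> cmod (z - w)"
  shows "(\<integral>z. (cmod (drad c (s\<^sup>2) (R\<^sup>2) z / (z - w)))\<^sup>2 \<partial>lborel) \<le> 64 * pi / (d\<^sup>2 * (ln (R / s))\<^sup>2) * (2 * ln (R / s) + 1)"
    and "integrable lborel (\<lambda>z. (cmod (drad c (s\<^sup>2) (R\<^sup>2) z / (z - w)))\<^sup>2)"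
proof -
  let ?E = "\<lambda>z. (cmod (drad c (s\<^sup>2) (R\<^sup>2) z / (z - w)))\<^sup>2"
  let ?\<Lambda> = "ln (R / s)"
  have L: "0 < ?\<Lambda>" using s by simp
  have AB: "0 < s\<^sup>2" "s\<^sup>2 < R\<^sup>2" using s by (auto intro: power_strict_mono)
  have 0: "drad c (s\<^sup>2) (R\<^sup>2) z = 0" if "\<not> (s < cmod (z - c) \<and> cmod (z - c) < R)" for z
    by (rule drad_eq_0[OF s that])
  have b: "?E z \<le> 16 / (d\<^sup>2 * ?\<Lambda>\<^sup>2) / (cmod (z - c))\<^sup>2"
    if z: "s < cmod (z - c)" "cmod (z - c) < R" for z
  proof -
    have "cmod (drad c (s\<^sup>2) (R\<^sup>2) z / (z - w)) \<le> (4 / (cmod (z - c) * ?\<Lambda>)) / d"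
      unfolding norm_divide using cmod_drad_annulus[OF s, of c z] z d L s
      by (intro frac_le) auto
    then have "?E z \<le> ((4 / (cmod (z - c) * ?\<Lambda>)) / d)\<^sup>2"
      by (intro power_mono) auto
    then show ?thesis by (simp add: power_divide power_mult_distrib mult_ac)
  qed
  have "(\<integral>z. ?E z \<partial>lborel) \<le> 4 * pi * (16 / (d\<^sup>2 * ?\<Lambda>\<^sup>2)) * (2 * ?\<Lambda> + 1)"
  proof (rule integral_le_quadratic_annulus[where c = c, OF s])
    fix z assume "s \<le> cmod (z - c)" "cmod (z - c) < R"
    then show "?E z \<le> 16 / (d\<^sup>2 * ?\<Lambda>\<^sup>2) / (cmod (z - c))\<^sup>2"
      using b[of z] 0[of z] by (cases "s = cmod (z - c)") auto
  next
    fix z assume "\<not> (s \<le> cmod (z - c) \<and> cmod (z - c) < R)"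
    then show "?E z \<le> 0" using 0[of z] by auto
  qed (use d L in auto)
  also have "4 * pi * (16 / (d\<^sup>2 * ?\<Lambda>\<^sup>2)) * (2 * ?\<Lambda> + 1) = 64 * pi / (d\<^sup>2 * ?\<Lambda>\<^sup>2) * (2 * ?\<Lambda> + 1)" by simp
  finally show "(\<integral>z. ?E z \<partial>lborel) \<le> 64 * pi / (d\<^sup>2 * ?\<Lambda>\<^sup>2) * (2 * ?\<Lambda> + 1)" .
  show "integrable lborel (\<lambda>z. ?E z)"
  proof (rule Bochner_Integration.integrable_bound)
    show "integrable lborel (\<lambda>z. indicat_real (cball c R) z * (16 / (d\<^sup>2 * ?\<Lambda>\<^sup>2) / s\<^sup>2))"
      using borel_integrable_compact[of "cball c R" "\<lambda>_. 16 / (d\<^sup>2 * ?\<Lambda>\<^sup>2) / s\<^sup>2"] by simp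
    have "drad c (s\<^sup>2) (R\<^sup>2) \<in> borel_measurable lborel"
      using borel_measurable_continuous_onI[OF continuous_drad[OF AB]] by simp
    then show "(\<lambda>z. ?E z) \<in> borel_measurable lborel" by measurable
    show "AE z in lborel. norm (?E z) \<le> norm (indicat_real (cball c R) z * (16 / (d\<^sup>2 * ?\<Lambda>\<^sup>2) / s\<^sup>2))"
    proof (rule AE_I2)
      fix z
      show "norm (?E z) \<le> norm (indicat_real (cball c R) z * (16 / (d\<^sup>2 * ?\<Lambda>\<^sup>2) / s\<^sup>2))"
      proof (cases "s < cmod (z - c) \<and> cmod (z - c) < R")
        case True
        have "16 / (d\<^sup>2 * ?\<Lambda>\<^sup>2) / (cmod (z - c))\<^sup>2 \<le> 16 / (d\<^sup>2 * ?\<Lambda>\<^sup>2) / s\<^sup>2"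
          using True s by (intro divide_left_mono power_mono mult_pos_pos zero_less_power) auto
        then show ?thesis using b[of z] True by (simp add: dist_norm norm_minus_commute)
      next
        case False
        then show ?thesis using 0[of z] by simp
      qed
    qed
  qed
qed

definition hole_len :: "nat \<Rightarrow> real" where "hole_len n = (real (Suc n) / ctr n)\<^sup>2"

lemma hole_len_ge: "1 \<le> hole_len n" and hole_len_ctr: "hole_len n * (ctr n)\<^sup>2 = (real (Suc n))\<^sup>2"
  and hole_len_ge_ctr: "1 / (ctr n)\<^sup>2 \<le> hole_len n"
proof -
  have "1 \<le> real (Suc n) / ctr n" using ctr_le[of n] by (simp add: le_divide_eq)
  then have "1\<^sup>2 \<le> (real (Suc n) / ctr n)\<^sup>2" by (intro power_mono) auto
  then show "1 \<le> hole_len n" by (simp add: hole_len_def)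
  have "ctr n \<noteq> 0" using ctr_pos[of n] by linarith
  then show "hole_len n * (ctr n)\<^sup>2 = (real (Suc n))\<^sup>2" by (simp add: hole_len_def power_divide)
  have "1\<^sup>2 \<le> (real (Suc n))\<^sup>2" by (intro power_mono) auto
  then show "1 / (ctr n)\<^sup>2 \<le> hole_len n"
    unfolding hole_len_def power_divide by (intro divide_right_mono) auto
qed

lemma hrad_eq: "hrad n = ctr n / 8 * exp (- hole_len n)"
  by (simp add: hrad_def hole_len_def)

lemma hrad_lt: "2 * hrad n < ctr n / 4"
proof -
  have "exp (- hole_len n) < 1" using hole_len_ge[of n] by simp
  then have "ctr n / 8 * exp (- hole_len n) < ctr n / 8 * 1" by (intro mult_strict_left_mono) auto
  then show ?thesis by (simp add: hrad_eq)
qed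

lemma ln_hrad: "ln (ctr n / 4 / (2 * hrad n)) = hole_len n"
proof -
  have "ctr n / 4 / (2 * hrad n) = exp (hole_len n)"
    using ctr_pos[of n] by (simp add: hrad_eq exp_minus field_simps del: ctr_pos)
  then show ?thesis by simp
qed

lemma sum_inverse_squares_le: "(\<Sum>n<N. 1 / (real (Suc n))\<^sup>2) \<le> 2"
proof -
  have *: "(\<Sum>n<N. 1 / (real (Suc n))\<^sup>2) \<le> 2 - 1 / real N" if "N \<noteq> 0" for N
    using that
  proof (induction N)
    case (Suc N)
    show ?case
    proof (cases "N = 0")
      case False
      have "1 / (real (Suc N))\<^sup>2 \<le> 1 / (real N * real (Suc N))"
        using False by (intro divide_left_mono) (auto simp: power2_eq_square)
      also have "\<dots> = 1 / real N - 1 / real (Suc N)" using False by (simp add: field_simps)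
      finally show ?thesis using Suc.IH[OF False] by simp
    qed simp
  qed simp
  have "0 \<le> 1 / real N" by simp
  then show ?thesis using *[of N] by (cases "N = 0") (simp, linarith)
qed

text \<open>The three terms are the energies of the outer cutoff (radii 5/8 and 7/8, at distance 1/8
  from w), of all hole cutoffs (3072 pi times the bound 2 for the sum of inverse squares) and of the
  inner cutoff.\<close>

definition kernel_bound :: real where
  "kernel_bound = (64 * pi / ((1 / 8)\<^sup>2 * (ln (7 / 5))\<^sup>2) * (2 * ln (7 / 5) + 1) + 6144 * pi + 1) / cut_const\<^sup>2"

lemma kernel_bound_pos: "0 < kernel_bound"
  unfolding kernel_bound_def using cut_const_pos
  by (intro divide_pos_pos add_nonneg_pos add_nonneg_nonneg mult_nonneg_nonneg divide_nonneg_nonneg) auto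

text \<open>The cutoff is an outer one minus an inner one minus one for each of the holes 0 to N;
  the inner one removes the origin and all later holes. N depends on w, the bound does not. The
  assumption \<open>far\<close> keeps w at distance at least \<open>ctr m / 4\<close> from the
  transition zone of the m-th hole.\<close>

lemma bergman_kernel_zalcman_le:
  assumes w: "w \<in> zalcman" "cmod w \<le> 1 / 2" and far: "\<And>n. ctr n / 2 \<le> hdist w n"
  shows "bergman_kernel zalcman w \<le> kernel_bound"
proof -
  have w0: "0 < cmod w" using w by (auto simp: zalcman_def)
  \<comment> \<open>The inner cutoff will have energy at most
    \<open>768 * pi / (cmod w)\<^sup>2\<close> divided by \<open>real (Suc N)\<close>; N \<ge> n0
    makes this at most 1.\<close>
  obtain n0 :: nat where n0: "768 * pi / (cmod w)\<^sup>2 \<le> real n0" using real_arch_simple by blast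
  obtain N where N: "ctr N < cmod w" "n0 \<le> N" using ctr_lt[OF w0] by blast
  \<comment> \<open>The smaller radius encloses all holes after the N-th; the larger one stays below
    w and below the discs around the first N + 1 centres.\<close>
  let ?s0 = "2 * ctr (Suc N)" and ?R0 = "ctr N / 2"
  let ?l0 = "ln (?R0 / ?s0)"
  have s0: "0 < ?s0" "?s0 < ?R0" using ctr_Suc_le[of N] ctr_pos[of "Suc N"] ctr_pos[of N] by (simp, linarith)
  let ?sm = "\<lambda>m. 2 * hrad m" and ?Rm = "\<lambda>m. ctr m / 4"
  have sm: "0 < ?sm m" "?sm m < ?Rm m" for m using hrad_lt by auto
  define out where "out = rad 0 ((5 / 8)\<^sup>2) ((7 / 8)\<^sup>2)"
  define dout where "dout = drad 0 ((5 / 8)\<^sup>2) ((7 / 8)\<^sup>2)"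
  define inn where "inn = rad 0 (?s0\<^sup>2) (?R0\<^sup>2)"
  define dinn where "dinn = drad 0 (?s0\<^sup>2) (?R0\<^sup>2)"
  define hol where "hol m = rad (of_real (ctr m)) ((?sm m)\<^sup>2) ((?Rm m)\<^sup>2)" for m
  define dhol where "dhol m = drad (of_real (ctr m)) ((?sm m)\<^sup>2) ((?Rm m)\<^sup>2)" for m
  define \<phi> where "\<phi> z = out z - inn z - (\<Sum>m\<le>N. hol m z)" for z
  define d\<phi> where "d\<phi> z = dout z - dinn z - (\<Sum>m\<le>N. dhol m z)" for z
  have der: "(\<phi> has_derivative (\<lambda>v. d\<phi> z \<bullet> v)) (at z)" for z
    unfolding \<phi>_def d\<phi>_def out_def dout_def inn_def dinn_def hol_def dhol_def inner_diff_left inner_sum_left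
    using s0 sm by (intro has_derivative_diff has_derivative_sum has_derivative_rad power_strict_mono zero_less_power)
      (auto simp: less_imp_le)
  have cont: "continuous_on UNIV d\<phi>"
    unfolding d\<phi>_def dout_def dinn_def dhol_def
    using s0 sm by (intro continuous_intros continuous_drad power_strict_mono zero_less_power) (auto simp: less_imp_le)
  have ctrN: "ctr N \<le> ctr m" if "m \<le> N" for m using that by (rule ctr_mono)
  define S where "S = cball 0 (7 / 8) \<inter> ({z. ?s0 \<le> cmod z} \<inter> (\<Inter>m\<le>N. {z. ?sm m \<le> hdist z m}))"
  have S: "compact S"
    unfolding S_def
    by (intro compact_Int_closed compact_cball closed_Int closed_INT ballI closed_Collect_le continuous_intros)
  have SD: "S \<subseteq> zalcman"
  proof
    fix z assume z: "z \<in> S"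
    then have "?s0 \<le> cmod z" by (simp add: S_def)
    have "hrad n < hdist z n" for n
    proof (cases "n \<le> N")
      case True
      then have "?sm n \<le> hdist z n" using z by (auto simp: S_def)
      then show ?thesis using hrad_pos[of n] by linarith
    next
      case False
      then have "ctr n \<le> ctr (Suc N)" by (intro ctr_mono) simp
      then show ?thesis using \<open>?s0 \<le> cmod z\<close> dist_ctr(1)[of z n] hrad_le[of n] ctr_pos[of n] by linarith
    qed
    moreover have "0 < cmod z" using \<open>?s0 \<le> cmod z\<close> s0(1) by linarith
    then have "z \<noteq> 0" by simp
    ultimately show "z \<in> zalcman" using z by (auto simp: S_def zalcman_def)
  qed
  have hol0: "hol m z = 0" if "ctr m / 4 \<le> hdist z m" for m z
    unfolding hol_def using sm that by (intro rad_eq_0)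
  \<comment> \<open>Far out all cutoffs vanish; elsewhere off S exactly one of the subtracted
    cutoffs equals 1 and cancels \<open>out\<close>.\<close>
  have supp: "\<phi> z = 0" if zS: "z \<notin> S" for z
  proof -
    consider "7 / 8 < cmod z" | "cmod z < ?s0" | k where "k \<le> N" "hdist z k < ?sm k"
      using zS by (auto simp: S_def not_le)
    then show ?thesis
    proof cases
      case 1
      have "out z = 0" unfolding out_def by (rule rad_eq_0) (use 1 in auto)
      moreover have "inn z = 0" unfolding inn_def by (rule rad_eq_0[OF s0]) (use 1 ctr_le[of N] in simp)
      moreover have "hol m z = 0" for m
        by (rule hol0) (use 1 dist_ctr(1)[of z m] ctr_le[of m] in linarith)
      ultimately show ?thesis by (simp add: \<phi>_def)
    next
      case 2
      have "out z = 1" unfolding out_def by (rule rad_eq_1) (use 2 s0 ctr_le[of N] in auto)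
      moreover have "inn z = 1" unfolding inn_def by (rule rad_eq_1[OF s0]) (use 2 in simp)
      moreover have "hol m z = 0" if "m \<le> N" for m
        by (rule hol0) (use 2 s0 dist_ctr(2)[of m z] ctrN[OF that] in linarith)
      ultimately show ?thesis by (simp add: \<phi>_def)
    next
      case 3
      have z: "hdist z k < ctr k / 4" using 3 sm(2)[of k] by linarith
      have "out z = 1" unfolding out_def by (rule rad_eq_1) (use disc_ctr(1)[OF z] in auto)
      moreover have "inn z = 0" unfolding inn_def
        by (rule rad_eq_0[OF s0]) (use disc_ctr(2)[OF z] ctrN[OF 3(1)] less_imp_le[OF ctr_pos[of k]] in simp)
      moreover have "hol k z = 1" unfolding hol_def by (rule rad_eq_1[OF sm]) (use 3 in simp)
      moreover have "hol m z = 0" if "m \<noteq> k" for m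
        by (rule hol0) (use disc_ctr(3)[OF z that] in simp)
      then have "(\<Sum>m\<le>N. hol m z) = (\<Sum>m\<in>{k}. hol m z)" using 3(1) by (intro sum.mono_neutral_right) auto
      ultimately show ?thesis by (simp add: \<phi>_def)
    qed
  qed
  have one: "\<phi> z = 1" if "z \<in> ball w (ctr N / 4)" for z
  proof -
    have wz: "cmod (z - w) < ctr N / 4" using that by (simp add: dist_norm norm_minus_commute)
    have "cmod z \<le> cmod w + cmod (z - w)" "cmod w \<le> cmod z + cmod (z - w)"
      using norm_triangle_sub[of z w] norm_triangle_sub[of w z] by (auto simp: norm_minus_commute)
    then have z: "cmod z \<le> 5 / 8" "ctr N / 2 \<le> cmod z" using wz w(2) N ctr_le[of N] by linarith+
    have "out z = 1" unfolding out_def by (rule rad_eq_1) (use z in auto)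
    moreover have "inn z = 0" unfolding inn_def by (rule rad_eq_0[OF s0]) (use z in simp)
    moreover have "hol m z = 0" if "m \<le> N" for m
    proof (rule hol0)
      have "hdist w m \<le> cmod (w - z) + hdist z m"
        using norm_triangle_ineq[of "w - z" "z - of_real (ctr m)"] by simp
      then show "ctr m / 4 \<le> hdist z m"
        using far[of m] wz ctrN[OF that] by (simp add: norm_minus_commute)
    qed
    ultimately show ?thesis by (simp add: \<phi>_def)
  qed
  define Eo where "Eo z = (cmod (dout z / (z - w)))\<^sup>2" for z
  define Ei where "Ei z = (cmod (dinn z / (z - w)))\<^sup>2" for z
  define Eh where "Eh m z = (cmod (dhol m z / (z - w)))\<^sup>2" for m z
  \<comment> \<open>At each point at most one of the gradients is nonzero, so the energies add
    without a factor growing with N.\<close>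
  have pt: "(cmod (d\<phi> z / (z - w)))\<^sup>2 \<le> Eo z + Ei z + (\<Sum>m\<le>N. Eh m z)" for z
  proof (cases "\<exists>k\<le>N. hdist z k < ctr k / 4")
    case True
    then obtain k where k: "k \<le> N" "hdist z k < ctr k / 4" by blast
    have "dout z = 0" unfolding dout_def by (rule drad_eq_0) (use disc_ctr(1)[OF k(2)] in auto)
    moreover have "dinn z = 0" unfolding dinn_def
      by (rule drad_eq_0[OF s0]) (use disc_ctr(2)[OF k(2)] ctrN[OF k(1)] less_imp_le[OF ctr_pos[of k]] in auto)
    moreover have h0: "dhol m z = 0" if "m \<noteq> k" for m
      unfolding dhol_def by (rule drad_eq_0[OF sm]) (use disc_ctr(3)[OF k(2) that] in auto)
    have "(\<Sum>m\<le>N. dhol m z) = (\<Sum>m\<in>{k}. dhol m z)" using k(1) h0 by (intro sum.mono_neutral_right) auto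
    moreover have "(\<Sum>m\<le>N. Eh m z) = (\<Sum>m\<in>{k}. Eh m z)"
      using k(1) h0 by (intro sum.mono_neutral_right) (auto simp: Eh_def)
    ultimately show ?thesis by (simp add: d\<phi>_def Eo_def Ei_def Eh_def)
  next
    case False
    have "dhol m z = 0" if "m \<le> N" for m
      unfolding dhol_def by (rule drad_eq_0[OF sm]) (use False that in auto)
    then have "(\<Sum>m\<le>N. dhol m z) = 0" "(\<Sum>m\<le>N. Eh m z) = 0" by (auto simp: Eh_def)
    moreover have "dout z = 0 \<or> dinn z = 0"
    proof (cases "5 / 8 < cmod z")
      case True
      then have "dinn z = 0" unfolding dinn_def by (intro drad_eq_0[OF s0]) (use ctr_le[of N] in auto)
      then show ?thesis ..
    next
      case False
      then have "dout z = 0" unfolding dout_def by (intro drad_eq_0) auto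
      then show ?thesis ..
    qed
    ultimately show ?thesis by (auto simp: d\<phi>_def Eo_def Ei_def)
  qed
  have EoI: "(\<integral>z. Eo z \<partial>lborel) \<le> 64 * pi / ((1 / 8)\<^sup>2 * (ln (7 / 5))\<^sup>2) * (2 * ln (7 / 5) + 1)" "integrable lborel Eo"
  proof -
    have "1 / 8 \<le> cmod (z - w)" if "5 / 8 < cmod (z - 0)" for z
      using that w(2) norm_triangle_ineq2[of z w] by simp
    from drad_energy[where s = "5/8" and R = "7/8" and d = "1/8" and c = 0 and w = w, OF _ _ _ this]
    show "(\<integral>z. Eo z \<partial>lborel) \<le> 64 * pi / ((1 / 8)\<^sup>2 * (ln (7 / 5))\<^sup>2) * (2 * ln (7 / 5) + 1)" "integrable lborel Eo"
      unfolding Eo_def dout_def by simp_all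
  qed
  have EiI: "(\<integral>z. Ei z \<partial>lborel) \<le> 1" "integrable lborel Ei"
  proof -
    have d: "cmod w / 2 \<le> cmod (z - w)" if "?s0 < cmod (z - 0)" "cmod (z - 0) < ?R0" for z
      using that N norm_triangle_ineq2[of w z] by (simp add: norm_minus_commute)
    note E = drad_energy[OF s0 _ d]
    show "integrable lborel Ei" unfolding Ei_def dinn_def by (rule E) (use w0 in auto)
    have ratio: "?R0 / ?s0 = 16 ^ (2 * N + 3) / 4" using ctr_pos[of N] by (simp add: ctr_Suc del: ctr_pos)
    \<comment> \<open>Here the super-geometric decay of the centres is used: the ratio of radii
      exceeds exp (N + 1).\<close>
    have l0: "real (Suc N) \<le> ?l0"
    proof -
      have "exp (real (Suc N)) = exp 1 ^ Suc N" using exp_of_nat_mult[of "Suc N" "1::real"] by simp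
      also have "\<dots> \<le> 3 ^ Suc N" using exp_le by (intro power_mono) auto
      also have "\<dots> \<le> 16 ^ Suc N" by (intro power_mono) auto
      also have "(16::real) ^ Suc N \<le> 16 ^ (2 * N + 2)" by (intro power_increasing) auto
      also have "\<dots> \<le> 16 ^ (2 * N + 3) / 4" by (simp add: power_add)
      finally show ?thesis unfolding ratio by (subst ln_ge_iff) auto
    qed
    have "(\<integral>z. Ei z \<partial>lborel) \<le> 64 * pi / ((cmod w / 2)\<^sup>2 * ?l0\<^sup>2) * (2 * ?l0 + 1)"
      unfolding Ei_def dinn_def by (rule E) (use w0 in auto)
    also have "\<dots> \<le> 64 * pi / ((cmod w / 2)\<^sup>2 * ?l0\<^sup>2) * (3 * ?l0)"
      using l0 by (intro mult_left_mono) auto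
    also have "\<dots> = 768 * pi / (cmod w)\<^sup>2 / ?l0" using l0 by (simp add: power2_eq_square)
    also have "\<dots> \<le> real n0 / real (Suc N)" using n0 l0 w0 by (intro frac_le) auto
    also have "\<dots> \<le> 1" using N(2) by simp
    finally show "(\<integral>z. Ei z \<partial>lborel) \<le> 1" .
  qed
  have EhI: "(\<integral>z. Eh m z \<partial>lborel) \<le> 3072 * pi * (1 / (real (Suc m))\<^sup>2)" "integrable lborel (Eh m)" for m
  proof -
    have d: "ctr m / 4 \<le> cmod (z - w)" if "?sm m < hdist z m" "hdist z m < ?Rm m" for z
    proof -
      have "hdist w m \<le> cmod (w - z) + hdist z m"
        using norm_triangle_ineq[of "w - z" "z - of_real (ctr m)"] by simp
      then show ?thesis using far[of m] that by (simp add: norm_minus_commute)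
    qed
    note E = drad_energy[OF sm[of m] _ d, unfolded ln_hrad]
    show "integrable lborel (Eh m)" unfolding Eh_def dhol_def by (rule E) auto
    have "(\<integral>z. Eh m z \<partial>lborel) \<le> 64 * pi / ((ctr m / 4)\<^sup>2 * (hole_len m)\<^sup>2) * (2 * hole_len m + 1)"
      unfolding Eh_def dhol_def by (rule E) auto
    also have "\<dots> \<le> 64 * pi / ((ctr m / 4)\<^sup>2 * (hole_len m)\<^sup>2) * (3 * hole_len m)"
      using hole_len_ge[of m] by (intro mult_left_mono) auto
    also have "\<dots> = 3072 * pi * (1 / (hole_len m * (ctr m)\<^sup>2))"
      using hole_len_ge[of m] ctr_pos[of m] by (simp add: power2_eq_square del: ctr_pos)
    finally show "(\<integral>z. Eh m z \<partial>lborel) \<le> 3072 * pi * (1 / (real (Suc m))\<^sup>2)" unfolding hole_len_ctr .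
  qed
  have "(\<integral>z. (cmod (d\<phi> z / (z - w)))\<^sup>2 \<partial>lborel) \<le> (\<integral>z. Eo z + Ei z + (\<Sum>m\<le>N. Eh m z) \<partial>lborel)"
  proof (intro integral_mono' Bochner_Integration.integrable_add Bochner_Integration.integrable_sum EoI EiI EhI pt)
    fix z show "0 \<le> Eo z + Ei z + (\<Sum>m\<le>N. Eh m z)"
      by (intro add_nonneg_nonneg sum_nonneg) (auto simp: Eo_def Ei_def Eh_def)
  qed
  also have "\<dots> = (\<integral>z. Eo z \<partial>lborel) + (\<integral>z. Ei z \<partial>lborel) + (\<Sum>m\<le>N. \<integral>z. Eh m z \<partial>lborel)"
    using EoI(2) EiI(2) EhI(2) by (simp add: Bochner_Integration.integral_sum)
  also have "(\<Sum>m\<le>N. \<integral>z. Eh m z \<partial>lborel) \<le> (\<Sum>m\<le>N. 3072 * pi * (1 / (real (Suc m))\<^sup>2))"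
    by (intro sum_mono EhI)
  also have "\<dots> = 3072 * pi * (\<Sum>m<Suc N. 1 / (real (Suc m))\<^sup>2)"
    by (simp add: sum_distrib_left lessThan_Suc_atMost)
  also have "\<dots> \<le> 3072 * pi * 2" by (intro mult_left_mono sum_inverse_squares_le) auto
  finally have total: "(\<integral>z. (cmod (d\<phi> z / (z - w)))\<^sup>2 \<partial>lborel) \<le> kernel_bound * cut_const\<^sup>2"
    using EoI(1) EiI(1) cut_const_pos unfolding kernel_bound_def by simp
  show ?thesis
  proof (rule bergman_kernel_le[OF open_zalcman bounded_zalcman w(1)])
    fix f assume f: "f \<in> L2h zalcman"
    have "(cmod (f w) * cut_const)\<^sup>2 \<le> sqnorm zalcman f * (\<integral>z. (cmod (d\<phi> z / (z - w)))\<^sup>2 \<partial>lborel)"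
      by (rule evaluation_bound[where r = "ctr N / 4" and \<phi> = \<phi>, OF open_zalcman f w(1) S SD der cont]) (use supp one in auto)
    also have "\<dots> \<le> sqnorm zalcman f * (kernel_bound * cut_const\<^sup>2)"
      using total sqnorm_nonneg by (intro mult_left_mono)
    finally show "(cmod (f w))\<^sup>2 \<le> kernel_bound * sqnorm zalcman f"
      using cut_const_pos by (simp add: power_mult_distrib mult_ac)
  qed
qed

section \<open>Lower bounds for the metric\<close>

lemma ctr_neq_0 [simp]: "ctr n \<noteq> 0"
  using ctr_pos[of n] by linarith

lemma ctr_nonneg [simp]: "0 \<le> ctr n"
  using ctr_pos[of n] by linarith

lemma hrad_neq_0 [simp]: "hrad n \<noteq> 0"
  using hrad_pos[of n] by linarith

text \<open>The parallelogram law with the squared norm of f - c g dropped.\<close>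

lemma sqnorm_add_mult_le:
  assumes "open D" "f \<in> L2h D" "g \<in> L2h D"
  shows "sqnorm D (\<lambda>z. f z + c * g z) \<le> 2 * sqnorm D f + 2 * (cmod c)\<^sup>2 * sqnorm D g"
  using sqnorm_add_mult[OF assms, of c] sqnorm_add_mult[OF assms, of "- c"] sqnorm_nonneg[of D "\<lambda>z. f z + (- c) * g z"]
  by (simp add: algebra_simps)

text \<open>The earlier bound \<open>ctr n / 8\<close> would not place the radius
  \<open>5 / 2 * hrad n\<close>, which occurs near a hole, inside \<open>ctr n / 4\<close>.\<close>

lemma hrad_le': "hrad n \<le> ctr n / 16"
proof -
  have "2 \<le> exp (hole_len n)" using exp_ge_add_one_self[of "hole_len n"] hole_len_ge[of n] by linarith
  then have "exp (- hole_len n) \<le> 1 / 2" by (simp add: exp_minus inverse_eq_divide divide_le_eq)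
  then have "ctr n / 8 * exp (- hole_len n) \<le> ctr n / 8 * (1 / 2)"
    by (intro mult_left_mono) (auto simp: less_imp_le)
  then show ?thesis by (simp add: hrad_eq)
qed

lemma inverse_ctr_L2h:
  shows "(\<lambda>z. 1 / (z - of_real (ctr n))) \<in> L2h zalcman" "sqnorm zalcman (\<lambda>z. 1 / (z - of_real (ctr n))) \<le> 20 * pi * hole_len n"
proof -
  have far: "hrad n < hdist z n" if "z \<in> zalcman" for z using that by (simp add: zalcman_def)
  have ne: "z \<noteq> of_real (ctr n)" if "z \<in> zalcman" for z
    using less_trans[OF hrad_pos far[OF that]] by auto
  show "(\<lambda>z. 1 / (z - of_real (ctr n))) \<in> L2h zalcman"
  proof (rule L2h_bounded_holomorphic(1)[OF open_zalcman zalcman_subset])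
    show "(\<lambda>z. 1 / (z - of_real (ctr n))) holomorphic_on zalcman"
      using ne by (intro holomorphic_intros) auto
    show "cmod (1 / (z - of_real (ctr n))) \<le> 1 / hrad n" if "z \<in> zalcman" for z
      unfolding norm_divide using far[OF that] by (intro frac_le) auto
  qed (auto simp: less_imp_le)
  have R: "hrad n < 2" using hrad_le[of n] ctr_le[of n] by linarith
  have "sqnorm zalcman (\<lambda>z. 1 / (z - of_real (ctr n))) \<le> 4 * pi * 1 * (2 * ln (2 / hrad n) + 1)"
    unfolding sqnorm_def set_lebesgue_integral_def
  proof (rule integral_le_quadratic_annulus[where c = "of_real (ctr n)", OF hrad_pos R])
    fix z assume "\<not> (hrad n \<le> hdist z n \<and> hdist z n < 2)"
    moreover have "hrad n \<le> hdist z n \<and> hdist z n < 2" if "z \<in> zalcman"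
    proof
      have "cmod z \<le> 1" using that zalcman_subset by auto
      then show "hdist z n < 2" using dist_ctr(3)[of z n] ctr_le[of n] by linarith
      show "hrad n \<le> hdist z n" using far[OF that] by simp
    qed
    ultimately have "z \<notin> zalcman" by blast
    then show "indicat_real zalcman z *\<^sub>R (cmod (1 / (z - of_real (ctr n))))\<^sup>2 \<le> 0" by simp
  qed (auto simp: indicator_def norm_divide power_divide)
  \<comment> \<open>The logarithm splits into \<open>ln (16 / ctr n)\<close> and
    \<open>hole_len n\<close>. As \<open>ctr n\<close> is at most 1/16, the first is at most
    \<open>1 / (ctr n)\<^sup>2\<close> and hence at most \<open>hole_len n\<close>.\<close>
  also have "ln (2 / hrad n) \<le> 2 * hole_len n"
  proof -
    have "2 / hrad n = 16 / ctr n * exp (hole_len n)" by (simp add: hrad_eq exp_minus field_simps)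
    moreover have "ln (16 / ctr n * exp (hole_len n)) = ln (16 / ctr n) + hole_len n"
      by (subst ln_mult) auto
    moreover have "ln (16 / ctr n) \<le> 16 / ctr n" by (rule ln_bound) simp
    moreover have "16 / ctr n \<le> 1 / ctr n / ctr n"
      using ctr_le[of n] by (intro divide_right_mono) (auto simp: le_divide_eq)
    moreover have "1 / ctr n / ctr n \<le> hole_len n" using hole_len_ge_ctr[of n] by (simp add: power2_eq_square)
    ultimately show ?thesis by simp
  qed
  then have "4 * pi * 1 * (2 * ln (2 / hrad n) + 1) \<le> 4 * pi * 1 * (5 * hole_len n)"
    using hole_len_ge[of n] by (intro mult_left_mono) auto
  finally show "sqnorm zalcman (\<lambda>z. 1 / (z - of_real (ctr n))) \<le> 20 * pi * hole_len n" by simp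
qed

lemma crossing_annulus:
  assumes w: "ctr n / 8 \<le> cmod w" "cmod w \<le> ctr n / 4"
  shows "w \<in> zalcman" "cmod w \<le> 1 / 2" "ctr m / 2 \<le> hdist w m"
proof -
  have w0: "0 < cmod w" using w(1) ctr_pos[of n] by linarith
  show "cmod w \<le> 1 / 2" using w ctr_le[of n] by linarith
  show far: "ctr m / 2 \<le> hdist w m" for m
  proof -
    consider "m = n" | "m < n" | "n < m" by linarith
    then show ?thesis
    proof cases
      case 1
      show ?thesis unfolding 1 using w dist_ctr(2)[of n w] ctr_pos[of n] by linarith
    next
      case 2
      then show ?thesis using w dist_ctr(2)[of m w] ctr_less[OF 2] ctr_pos[of m] by linarith
    next
      case 3
      then show ?thesis using w dist_ctr(1)[of w m] ctr_less[OF 3] ctr_pos[of m] by linarith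
    qed
  qed
  have "hrad m < hdist w m" for m
    using far[of m] hrad_le[of m] ctr_pos[of m] by linarith
  then show "w \<in> zalcman" using w0 w ctr_le[of n] by (auto simp: zalcman_def)
qed

text \<open>Under the root stand the bounds for norm and kernel without the factor
  \<open>(real (Suc n))\<^sup>2\<close>; 4/5 comes from |w - a| \<le> 5/4 a for the centre
  a.\<close>

definition cross_const :: real where "cross_const = 4 / 5 / sqrt (65 * pi * kernel_bound)"

lemma cross_const_pos: "0 < cross_const"
  using kernel_bound_pos by (simp add: cross_const_def)

text \<open>With a the centre, the test function is (z - w) / (z - a), which vanishes at w and has
  derivative 1 / (w - a) of order 1 / a there. By the choice of \<open>hrad\<close> its squared norm
  is only of order \<open>(real (Suc n))\<^sup>2\<close>, and the kernel is bounded on this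
  annulus.\<close>

lemma bergman_metric_crossing:
  assumes w: "ctr n / 8 \<le> cmod w" "cmod w \<le> ctr n / 4"
  shows "cross_const / (ctr n * real (Suc n)) \<le> bergman_metric zalcman w 1"
proof -
  let ?a = "complex_of_real (ctr n)"
  let ?g = "\<lambda>z. 1 / (z - ?a)"
  define f where "f z = 1 + (?a - w) * ?g z" for z
  note W = crossing_annulus[OF w]
  note L1 = const_L2h[OF open_zalcman bounded_zalcman, of 1]
  have a0: "0 < cmod (w - ?a)" using W(3)[of n] ctr_pos[of n] by linarith
  have aw: "cmod (?a - w) \<le> 5 / 4 * ctr n" using dist_ctr(3)[of w n] w by (simp add: norm_minus_commute)
  have fL: "f \<in> L2h zalcman" unfolding f_def by (rule L2h_add_mult[OF open_zalcman L1 inverse_ctr_L2h(1)])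
  have "sqnorm zalcman f \<le> 2 * sqnorm zalcman (\<lambda>_. 1) + 2 * (cmod (?a - w))\<^sup>2 * sqnorm zalcman ?g"
    unfolding f_def by (rule sqnorm_add_mult_le[OF open_zalcman L1 inverse_ctr_L2h(1)])
  also have "sqnorm zalcman (\<lambda>_. 1) \<le> pi"
    using L2h_bounded_holomorphic(2)[OF open_zalcman zalcman_subset, of "\<lambda>_. 1" 1] by simp
  also have "2 * (cmod (?a - w))\<^sup>2 * sqnorm zalcman ?g \<le> 2 * (5 / 4 * ctr n)\<^sup>2 * (20 * pi * hole_len n)"
    using aw sqnorm_nonneg by (intro mult_mono inverse_ctr_L2h(2) power_mono mult_nonneg_nonneg) auto
  also have "\<dots> = 125 / 2 * pi * (hole_len n * (ctr n)\<^sup>2)" by (simp add: power2_eq_square)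
  also have "hole_len n * (ctr n)\<^sup>2 = (real (Suc n))\<^sup>2" by (rule hole_len_ctr)
  finally have "sqnorm zalcman f \<le> 2 * pi + 125 / 2 * pi * (real (Suc n))\<^sup>2" by simp
  also have "2 * pi \<le> 2 * pi * (real (Suc n))\<^sup>2"
  proof -
    have "1\<^sup>2 \<le> (real (Suc n))\<^sup>2" by (intro power_mono) auto
    then have "2 * pi * 1 \<le> 2 * pi * (real (Suc n))\<^sup>2" by (intro mult_left_mono) auto
    then show ?thesis by simp
  qed
  finally have nf: "sqnorm zalcman f \<le> 65 * pi * (real (Suc n))\<^sup>2"
    using mult_nonneg_nonneg[OF pi_ge_zero zero_le_power2[of "real (Suc n)"]] by linarith
  have fd: "(f has_field_derivative 1 / (w - ?a)) (at w)"
  proof -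
    define x where "x = w - ?a"
    have x: "x \<noteq> 0" "?a - w = - x" "w - ?a = x" using a0 by (auto simp: x_def)
    have "((\<lambda>z. inverse (z - ?a)) has_field_derivative - (1 * inverse ((w - ?a)\<^sup>2))) (at w)"
      by (rule DERIV_inverse_fun[unfolded numeral_2_eq_2[symmetric]]) (use a0 in \<open>auto intro!: derivative_eq_intros\<close>)
    then have "(f has_field_derivative 0 + (?a - w) * (- (1 * inverse ((w - ?a)\<^sup>2)))) (at w)"
      unfolding f_def by (intro DERIV_add DERIV_const DERIV_cmult) (simp add: inverse_eq_divide)
    also have "0 + (?a - w) * (- (1 * inverse ((w - ?a)\<^sup>2))) = 1 / (w - ?a)"
      unfolding x(2,3) using x(1) by (simp add: power2_eq_square divide_simps)
    finally show ?thesis .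
  qed
  have "cross_const / (ctr n * real (Suc n)) * cmod 1 \<le> bergman_metric zalcman w 1"
  proof (rule bergman_metric_ge[OF open_zalcman bounded_zalcman W(1) fL _ nf bergman_kernel_zalcman_le[OF W]])
    show "f w = 0" unfolding f_def using a0 by (simp add: divide_simps)
    have "(cross_const / (ctr n * real (Suc n)))\<^sup>2 * (65 * pi * (real (Suc n))\<^sup>2 * kernel_bound)
        = (4 / (5 * ctr n))\<^sup>2"
    proof -
      have "(4 / 5 / sqrt B / (a * m))\<^sup>2 * (B * m\<^sup>2) = (4 / (5 * a))\<^sup>2" if "0 < B" "0 < a" "0 < m" for B a m :: real
        using that by (simp add: power_divide power_mult_distrib)
      from this[of "65 * pi * kernel_bound" "ctr n" "real (Suc n)"] show ?thesis
        using kernel_bound_pos unfolding cross_const_def by (simp add: mult_ac)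
    qed
    also have "\<dots> \<le> (1 / cmod (w - ?a))\<^sup>2"
    proof (intro power_mono)
      have "1 / (5 / 4 * ctr n) \<le> 1 / cmod (w - ?a)" using aw a0 by (intro frac_le) (auto simp: norm_minus_commute)
      then show "4 / (5 * ctr n) \<le> 1 / cmod (w - ?a)" by simp
    qed simp
    finally show "(cross_const / (ctr n * real (Suc n)))\<^sup>2 * (65 * pi * (real (Suc n))\<^sup>2 * kernel_bound) \<le> (cmod (deriv f w))\<^sup>2"
      unfolding DERIV_imp_deriv[OF fd] by (simp add: norm_divide)
  qed (use cross_const_pos in \<open>auto simp: less_imp_le\<close>)
  then show ?thesis by simp
qed

section \<open>Metric near boundary circles and in the interior\<close>

definition exterior_const :: real where "exterior_const = 1 / (8 * sqrt (216 * pi * point_const))"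

lemma exterior_const_pos: "0 < exterior_const"
  using point_const_pos by (simp add: exterior_const_def)

text \<open>The test function (z - w) / (z - b)^3 has its pole at the centre of an exterior disc.
  Order 3 makes the squared modulus O(|z - b|^(-4)), so the squared norm is O(\<delta>^(-2)) without
  a logarithm. With kernel O(\<delta>^(-2)) and derivative 1/(8 \<delta>^3) in modulus, the quotient
  is of order 1 / \<delta>.\<close>

lemma bergman_metric_exterior_disc:
  assumes D: "open D" "D \<subseteq> cball 0 1" and w: "w \<in> D" and \<delta>: "0 < \<delta>"
    and b: "ball b \<delta> \<inter> D = {}" "cmod (w - b) = 2 * \<delta>" and r: "cball w (\<delta> / 2) \<subseteq> D"
  shows "exterior_const / \<delta> \<le> bergman_metric D w 1"
proof -
  have bD: "bounded D" using D(2) bounded_subset[OF bounded_cball] by blast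
  have far: "\<delta> \<le> cmod (z - b)" if "z \<in> D" for z
    using b(1) that by (auto simp: disjoint_iff dist_norm norm_minus_commute not_less)
  have ne: "z - b \<noteq> 0" if "z \<in> D" for z using far[OF that] \<delta> by auto
  define f where "f z = (z - w) / (z - b) ^ 3" for z
  have hol: "f holomorphic_on D" unfolding f_def using ne by (intro holomorphic_intros) auto
  have fb: "cmod (f z) \<le> 3 / (cmod (z - b))\<^sup>2" if z: "z \<in> D" for z
  proof -
    have "cmod (z - w) \<le> cmod (z - b) + cmod (w - b)"
      using norm_triangle_ineq4[of "z - b" "w - b"] by simp
    also have "\<dots> \<le> 3 * cmod (z - b)" using b(2) far[OF z] by simp
    finally have "cmod (z - w) / cmod (z - b) ^ 3 \<le> 3 * cmod (z - b) / cmod (z - b) ^ 3"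
      by (intro divide_right_mono) auto
    also have "3 * cmod (z - b) / cmod (z - b) ^ 3 = 3 / (cmod (z - b))\<^sup>2"
      using ne[OF z] by (simp add: power3_eq_cube power2_eq_square)
    finally show ?thesis by (simp add: f_def norm_divide norm_power)
  qed
  have fL: "f \<in> L2h D"
  proof (rule L2h_bounded_holomorphic(1)[OF D _ hol])
    show "cmod (f z) \<le> 3 / \<delta>\<^sup>2" if "z \<in> D" for z
      using fb[OF that] far[OF that] \<delta>
      by (intro order_trans[OF fb[OF that]] frac_le power_mono) auto
  qed auto
  have nf: "sqnorm D f \<le> 54 * pi / \<delta>\<^sup>2"
  proof -
    have "sqnorm D f \<le> 6 * pi * 9 / \<delta>\<^sup>2"
      unfolding sqnorm_def set_lebesgue_integral_def
    proof (rule integral_le_quartic_annulus[where c = b and R = "\<delta> + 2 + cmod b", OF \<delta>])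
      fix z assume "\<delta> \<le> cmod (z - b)"
      show "indicat_real D z *\<^sub>R (cmod (f z))\<^sup>2 \<le> 9 / cmod (z - b) ^ 4"
      proof (cases "z \<in> D")
        case True
        have "(cmod (f z))\<^sup>2 \<le> (3 / (cmod (z - b))\<^sup>2)\<^sup>2" using fb[OF True] by (intro power_mono) auto
        then show ?thesis using True by (simp add: power_divide)
      qed simp
    next
      fix z assume z: "\<not> (\<delta> \<le> cmod (z - b) \<and> cmod (z - b) < \<delta> + 2 + cmod b)"
      have "z \<notin> D"
      proof
        assume zD: "z \<in> D"
        then have "cmod z \<le> 1" using D by auto
        then have "cmod (z - b) < \<delta> + 2 + cmod b" using norm_triangle_ineq4[of z b] \<delta> by linarith
        then show False using z far[OF zD] by simp
      qed
      then show "indicat_real D z *\<^sub>R (cmod (f z))\<^sup>2 \<le> 0" by simp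
    qed (use norm_ge_zero[of b] in \<open>auto simp del: norm_ge_zero\<close>)
    then show ?thesis by simp
  qed
  have K: "bergman_kernel D w \<le> 4 * point_const / \<delta>\<^sup>2"
  proof (rule bergman_kernel_le[OF D(1) bD w])
    fix f assume "f \<in> L2h D"
    from L2h_point_bound[OF D(1) this _ r] show "(cmod (f w))\<^sup>2 \<le> 4 * point_const / \<delta>\<^sup>2 * sqnorm D f"
      using \<delta> by (simp add: power_divide mult.commute)
  qed
  have fd: "(f has_field_derivative 1 / (w - b) ^ 3) (at w)"
    unfolding f_def using ne[OF w] by (auto intro!: derivative_eq_intros simp: divide_simps)
  have "exterior_const / \<delta> * cmod 1 \<le> bergman_metric D w 1"
  proof (rule bergman_metric_ge[OF D(1) bD w fL _ nf K])
    \<comment> \<open>An equality that fixes \<open>exterior_const\<close>: 216 is 54 times 4, from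
      norm and kernel, and 8 is the cube of 2 in |w - b| = 2 \<delta>.\<close>
    have "(exterior_const / \<delta>)\<^sup>2 * (54 * pi / \<delta>\<^sup>2 * (4 * point_const / \<delta>\<^sup>2)) = (1 / (2 * \<delta>) ^ 3)\<^sup>2"
      using point_const_pos \<delta>
      by (simp add: exterior_const_def power_divide power_mult_distrib field_simps)
    also have "\<dots> = (cmod (deriv f w))\<^sup>2"
      unfolding DERIV_imp_deriv[OF fd] by (simp add: norm_divide norm_power b(2))
    finally show "(exterior_const / \<delta>)\<^sup>2 * (54 * pi / \<delta>\<^sup>2 * (4 * point_const / \<delta>\<^sup>2)) \<le> (cmod (deriv f w))\<^sup>2" by simp
  qed (use exterior_const_pos \<delta> in \<open>auto simp: f_def less_imp_le\<close>)
  then show ?thesis by simp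
qed

text \<open>The test function z - w gives a positive lower bound, uniform where r is; it serves to
  compare the Bergman and Euclidean topologies inside the domain.\<close>

lemma bergman_metric_interior:
  assumes D: "open D" "D \<subseteq> cball 0 1" and r: "0 < r" "cball w r \<subseteq> D"
  shows "r / sqrt (4 * pi * point_const) \<le> bergman_metric D w 1"
proof -
  have bD: "bounded D" using D(2) bounded_subset[OF bounded_cball] by blast
  have w: "w \<in> D" using r by auto
  have bd: "cmod (z - w) \<le> 2" if "z \<in> D" for z
  proof -
    have "cmod z \<le> 1" "cmod w \<le> 1" using D that w by auto
    then show ?thesis using norm_triangle_ineq4[of z w] by linarith
  qed
  have hol: "(\<lambda>z. z - w) holomorphic_on D" by (intro holomorphic_intros)
  have nf: "sqnorm D (\<lambda>z. z - w) \<le> 4 * pi"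
    using L2h_bounded_holomorphic(2)[OF D _ hol bd] by simp
  have K: "bergman_kernel D w \<le> point_const / r\<^sup>2"
    by (rule bergman_kernel_le[OF D(1) bD w]) (rule L2h_point_bound[OF D(1) _ r])
  have fd: "((\<lambda>z. z - w) has_field_derivative 1) (at w)" by (auto intro!: derivative_eq_intros)
  have "r / sqrt (4 * pi * point_const) * cmod 1 \<le> bergman_metric D w 1"
  proof (rule bergman_metric_ge[OF D(1) bD w affine_L2h[OF D(1) bD] _ nf K])
    show "(r / sqrt (4 * pi * point_const))\<^sup>2 * (4 * pi * (point_const / r\<^sup>2)) \<le> (cmod (deriv (\<lambda>z. z - w) w))\<^sup>2"
      unfolding DERIV_imp_deriv[OF fd] using point_const_pos r by (simp add: power_divide)
  qed (use point_const_pos r in auto)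
  then show ?thesis by simp
qed

lemma bergman_metric_nonneg:
  assumes D: "open D" "D \<subseteq> cball 0 1" and w: "w \<in> D"
  shows "0 \<le> bergman_metric D w 1"
proof -
  obtain r where r: "0 < r" "cball w r \<subseteq> D" using D(1) w open_contains_cball by blast
  have "0 \<le> r / sqrt (4 * pi * point_const)" using r point_const_pos by simp
  then show ?thesis using bergman_metric_interior[OF D r] by linarith
qed

section \<open>Completeness\<close>

lemma ennreal_less_1D: "ennreal a < 1 \<Longrightarrow> a < 1"
  by (metis ennreal_1 ennreal_leI linorder_not_le)

text \<open>A C^1 substitute for the positive part: it is 0 for v \<le> 0, has slope between 0 and
  1, and differs from v by at most 1 for v \<ge> 0.\<close>

definition root_ramp :: "real \<Rightarrow> real" where "root_ramp v = sqrt (1 + pos_sq v) - 1"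

definition root_ramp' :: "real \<Rightarrow> real" where "root_ramp' v = max 0 v / sqrt (1 + pos_sq v)"

lemma has_derivative_root_ramp: "(root_ramp has_real_derivative root_ramp' v) (at v)"
proof -
  have pos: "0 < 1 + pos_sq v" using pos_sq_nonneg[of v] by linarith
  have "((\<lambda>v. 1 + pos_sq v) has_real_derivative 0 + 2 * max 0 v) (at v)"
    by (intro DERIV_add DERIV_const has_derivative_pos_sq)
  from DERIV_diff[OF DERIV_chain2[OF DERIV_real_sqrt[OF pos] this] DERIV_const[of 1]]
  have "((\<lambda>v. sqrt (1 + pos_sq v) - 1) has_real_derivative inverse (sqrt (1 + pos_sq v)) / 2 * (0 + 2 * max 0 v) - 0) (at v)" .
  moreover have "inverse (sqrt (1 + pos_sq v)) / 2 * (0 + 2 * max 0 v) - 0 = root_ramp' v"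
  proof -
    have "inverse s / 2 * (0 + 2 * m) - 0 = m / s" for s m :: real by (cases "s = 0") (simp_all add: field_simps)
    then show ?thesis unfolding root_ramp'_def .
  qed
  ultimately show ?thesis unfolding root_ramp_def[abs_def] by (simp only:)
qed

lemma continuous_root_ramp': "continuous_on UNIV root_ramp'"
proof -
  have "1 + pos_sq v \<noteq> 0" for v using pos_sq_nonneg[of v] by linarith
  then show ?thesis unfolding root_ramp'_def[abs_def] pos_sq_def
    by (intro continuous_intros) (auto simp: pos_sq_def)
qed

lemma root_ramp'_bounds: "0 \<le> root_ramp' v" "root_ramp' v \<le> 1" "v \<le> 0 \<Longrightarrow> root_ramp' v = 0"
proof -
  have "max 0 v \<le> sqrt (1 + pos_sq v)" by (rule real_le_rsqrt) (simp add: pos_sq_def)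
  moreover have "0 < sqrt (1 + pos_sq v)" using pos_sq_nonneg[of v] by (simp add: add_pos_nonneg)
  ultimately show "root_ramp' v \<le> 1" by (simp add: root_ramp'_def divide_le_eq)
qed (auto simp: root_ramp'_def)

lemma root_ramp_ge: "v - 1 \<le> root_ramp v"
proof -
  have "v \<le> sqrt (1 + pos_sq v)"
    by (rule order_trans[of _ "max 0 v"], simp, rule real_le_rsqrt) (simp add: pos_sq_def)
  then show ?thesis by (simp add: root_ramp_def)
qed

text \<open>The metric is at least a constant over the distance near each boundary circle, so the logarithm
  of the distance to the circle, cut off smoothly, has bounded gradient in the Bergman metric.\<close>

lemma bergman_ball_avoids_circle:
  fixes c :: complex
  assumes D: "open D" "D \<subseteq> cball 0 1" and C: "0 < C"
    and y: "\<And>w. w \<in> D \<Longrightarrow> 0 < k * ((cmod (w - c))\<^sup>2 - s)"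
    and le: "\<And>w. w \<in> D \<Longrightarrow> k * ((cmod (w - c))\<^sup>2 - s) < 1 \<Longrightarrow>
        C * (2 * \<bar>k\<bar> * cmod (w - c) / (k * ((cmod (w - c))\<^sup>2 - s))) \<le> bergman_metric D w 1"
    and z0: "z0 \<in> D"
  shows "\<exists>\<eta>>0. \<forall>z\<in>D. bergman_dist D z0 z < 1 \<longrightarrow> \<eta> \<le> k * ((cmod (z - c))\<^sup>2 - s)"
proof -
  have bD: "bounded D" using D(2) bounded_subset[OF bounded_cball] by blast
  \<comment> \<open>A defining function of the circle, positive inside the domain: k < 0 for the
    outer circle, k > 0 for a hole. Its size is scaled so that Y < 1 is the collar where the metric
    estimate is available; outside it, u is constant.\<close>
  define Y where "Y t = k * (t - s)" for t
  define H where "H t = C * root_ramp (- ln (Y t))" for t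
  define H' where "H' t = C * (root_ramp' (- ln (Y t)) * (- (k / Y t)))" for t
  define u where "u z = H ((cmod (z - c))\<^sup>2)" for z
  define du where "du z = (2 * H' ((cmod (z - c))\<^sup>2)) *\<^sub>R (z - c)" for z
  have Y: "0 < Y ((cmod (w - c))\<^sup>2)" if "w \<in> D" for w using y[OF that] by (simp add: Y_def)
  have dH: "(H has_real_derivative H' t) (at t)" if "0 < Y t" for t
  proof -
    have "((\<lambda>t. - ln (Y t)) has_real_derivative - (k / Y t)) (at t)"
      using that unfolding Y_def by (auto intro!: derivative_eq_intros)
    from DERIV_cmult[OF DERIV_chain2[OF has_derivative_root_ramp this], of C]
    show ?thesis unfolding H_def[abs_def] H'_def by simp
  qed
  have der: "(u has_derivative (\<lambda>v. du w \<bullet> v)) (at w)" if "w \<in> D" for w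
    unfolding u_def du_def by (rule has_derivative_radial[OF dH[OF Y[OF that]]])
  have cont: "continuous_on D du"
  proof -
    have Yne: "k * ((cmod (w - c))\<^sup>2 - s) \<noteq> 0" "0 < k * ((cmod (w - c))\<^sup>2 - s)" if "w \<in> D" for w
      using y[OF that] by auto
    show ?thesis
      unfolding du_def H'_def Y_def
      by (intro continuous_intros continuous_on_compose2[OF continuous_root_ramp']) (use Yne in auto)
  qed
  have bound: "cmod (du w) \<le> bergman_metric D w 1" if w: "w \<in> D" for w
  proof -
    let ?Y = "Y ((cmod (w - c))\<^sup>2)"
    have eq: "cmod (du w) = root_ramp' (- ln ?Y) * (C * (2 * \<bar>k\<bar> * cmod (w - c) / ?Y))"
      using C Y[OF w] root_ramp'_bounds(1)[of "- ln ?Y"] by (simp add: du_def H'_def abs_mult)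
    show ?thesis
    proof (cases "?Y < 1")
      case True
      have "root_ramp' (- ln ?Y) * (C * (2 * \<bar>k\<bar> * cmod (w - c) / ?Y)) \<le> 1 * (C * (2 * \<bar>k\<bar> * cmod (w - c) / ?Y))"
        using C Y[OF w] root_ramp'_bounds by (intro mult_right_mono) auto
      also have "\<dots> \<le> bergman_metric D w 1" using le[OF w] True by (simp add: Y_def)
      finally show ?thesis unfolding eq .
    next
      case False
      then have "root_ramp' (- ln ?Y) = 0" by (intro root_ramp'_bounds) simp
      then show ?thesis unfolding eq using bergman_metric_nonneg[OF D w] by simp
    qed
  qed
  \<comment> \<open>The last summand is the loss in \<open>root_ramp_ge\<close>.\<close>
  define T where "T = (u z0 + 1) / C + 1"
  have "exp (- T) \<le> k * ((cmod (z - c))\<^sup>2 - s)" if z: "z \<in> D" "bergman_dist D z0 z < 1" for z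
  proof -
    have "ennreal \<bar>u z - u z0\<bar> < 1"
      using bergman_dist_ge[OF D(1) bD der cont bound, of z z0] z(2) by (rule le_less_trans)
    then have "\<bar>u z - u z0\<bar> < 1" by (rule ennreal_less_1D)
    then have "u z \<le> u z0 + 1" by linarith
    then have "root_ramp (- ln (Y ((cmod (z - c))\<^sup>2))) \<le> (u z0 + 1) / C"
      using C by (simp add: u_def H_def le_divide_eq mult.commute)
    then have "- T \<le> ln (Y ((cmod (z - c))\<^sup>2))"
      using root_ramp_ge[of "- ln (Y ((cmod (z - c))\<^sup>2))"] by (simp add: T_def)
    then show ?thesis using Y[OF z(1)] by (simp add: Y_def ln_ge_iff)
  qed
  then show ?thesis by (intro exI[of _ "exp (- T)"]) auto
qed

text \<open>The exterior disc of radius \<delta> touches the unit circle from outside on the ray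
  through w. Close to the circle there are no holes, so the disc of radius \<delta> / 2 about w lies
  in the domain.\<close>

lemma metric_near_outer_circle:
  assumes w: "w \<in> zalcman" "3 / 4 < (cmod w)\<^sup>2"
  shows "exterior_const / (1 - cmod w) \<le> bergman_metric zalcman w 1"
proof -
  define \<delta> where "\<delta> = 1 - cmod w"
  have w1: "cmod w < 1" using w by (simp add: zalcman_def)
  have w34: "3 / 4 < cmod w"
  proof (rule ccontr)
    assume "\<not> 3 / 4 < cmod w"
    then have "(cmod w)\<^sup>2 \<le> (3 / 4)\<^sup>2" by (intro power_mono) auto
    then show False using w(2) by (simp add: power2_eq_square)
  qed
  have \<delta>: "0 < \<delta>" "\<delta> < 1 / 4" using w1 w34 by (auto simp: \<delta>_def)
  define b where "b = ((1 + \<delta>) / cmod w) *\<^sub>R w"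
  have nb: "cmod b = 1 + \<delta>" using w34 \<delta> by (auto simp: b_def)
  have "w - b = (1 - (1 + \<delta>) / cmod w) *\<^sub>R w" by (simp add: b_def algebra_simps)
  then have "cmod (w - b) = \<bar>(1 - (1 + \<delta>) / cmod w) * cmod w\<bar>" by (simp add: abs_mult)
  also have "(1 - (1 + \<delta>) / cmod w) * cmod w = - (2 * \<delta>)"
  proof -
    have "(1 - (1 + \<delta>) / cmod w) * cmod w = cmod w - (1 + \<delta>)" using w34 by (auto simp: left_diff_distrib)
    then show ?thesis by (simp add: \<delta>_def)
  qed
  finally have wb: "cmod (w - b) = 2 * \<delta>" using \<delta> by simp
  have "exterior_const / \<delta> \<le> bergman_metric zalcman w 1"
  proof (rule bergman_metric_exterior_disc[OF open_zalcman zalcman_subset w(1) \<delta>(1) _ wb])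
    have "v \<notin> zalcman" if "v \<in> ball b \<delta>" for v
      using that nb norm_triangle_ineq2[of b v] by (auto simp: zalcman_def dist_norm)
    then show "ball b \<delta> \<inter> zalcman = {}" by blast
    show "cball w (\<delta> / 2) \<subseteq> zalcman"
    proof
      fix v assume "v \<in> cball w (\<delta> / 2)"
      then have "cmod (w - v) \<le> \<delta> / 2" by (simp add: dist_norm)
      then have v: "cmod v < 1" "1 / 2 < cmod v"
        using norm_triangle_ineq2[of w v] norm_triangle_ineq2[of v w] \<delta> w34
        by (auto simp: \<delta>_def norm_minus_commute)
      have "hrad n < hdist v n" for n
        using v(2) dist_ctr(1)[of v n] ctr_le[of n] hrad_le[of n] by linarith
      then show "v \<in> zalcman" using v by (auto simp: zalcman_def)
    qed
  qed
  then show ?thesis by (simp add: \<delta>_def)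
qed

text \<open>The exterior disc lies inside the hole and touches its boundary at the point nearest to
  w; it fits because \<delta> < \<open>hrad n\<close>, which is the assumption on w.\<close>

lemma metric_near_hole:
  assumes w: "w \<in> zalcman" "hdist w n < 2 * hrad n"
  shows "exterior_const / (hdist w n - hrad n) \<le> bergman_metric zalcman w 1"
proof -
  let ?a = "complex_of_real (ctr n)" and ?s = "hrad n"
  define \<delta> where "\<delta> = cmod (w - ?a) - ?s"
  have wa: "?s < cmod (w - ?a)" using w by (simp add: zalcman_def)
  have wa0: "cmod (w - ?a) \<noteq> 0" using wa hrad_pos[of n] by linarith
  have \<delta>: "0 < \<delta>" "\<delta> < ?s" using wa w(2) by (auto simp: \<delta>_def)
  define b where "b = ?a + ((?s - \<delta>) / cmod (w - ?a)) *\<^sub>R (w - ?a)"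
  have nb: "cmod (b - ?a) = ?s - \<delta>" using wa0 \<delta> by (simp add: b_def)
  have "w - b = (1 - (?s - \<delta>) / cmod (w - ?a)) *\<^sub>R (w - ?a)" by (simp add: b_def algebra_simps)
  then have "cmod (w - b) = \<bar>(1 - (?s - \<delta>) / cmod (w - ?a)) * cmod (w - ?a)\<bar>" by (simp add: abs_mult)
  also have "(1 - (?s - \<delta>) / cmod (w - ?a)) * cmod (w - ?a) = 2 * \<delta>"
  proof -
    have "(1 - c / x) * x = x - c" if "x \<noteq> 0" for c x :: real using that by (simp add: left_diff_distrib)
    from this[OF wa0] have "(1 - (?s - \<delta>) / cmod (w - ?a)) * cmod (w - ?a) = cmod (w - ?a) - (?s - \<delta>)" .
    then show ?thesis by (simp add: \<delta>_def)
  qed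
  finally have wb: "cmod (w - b) = 2 * \<delta>" using \<delta> by simp
  have "exterior_const / \<delta> \<le> bergman_metric zalcman w 1"
  proof (rule bergman_metric_exterior_disc[OF open_zalcman zalcman_subset w(1) \<delta>(1) _ wb])
    have "v \<notin> zalcman" if v: "v \<in> ball b \<delta>" for v
    proof -
      have "cmod (v - b) < \<delta>" using v by (simp add: dist_norm norm_minus_commute)
      then have "cmod (v - ?a) < ?s"
        using norm_triangle_ineq[of "v - b" "b - ?a"] nb by simp
      moreover have "?s < cmod (v - ?a)" if "v \<in> zalcman" using that by (simp add: zalcman_def)
      ultimately show ?thesis using order_less_asym by blast
    qed
    then show "ball b \<delta> \<inter> zalcman = {}" by blast
    show "cball w (\<delta> / 2) \<subseteq> zalcman"
    proof
      fix v assume "v \<in> cball w (\<delta> / 2)"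
      then have vw: "cmod (w - v) \<le> \<delta> / 2" by (simp add: dist_norm)
      have "cmod (w - ?a) \<le> cmod (w - v) + cmod (v - ?a)" "cmod (v - ?a) \<le> cmod (w - v) + cmod (w - ?a)"
        using norm_triangle_ineq[of "w - v" "v - ?a"] norm_triangle_ineq[of "v - w" "w - ?a"]
        by (auto simp: norm_minus_commute)
      then have v: "?s < cmod (v - ?a)" "cmod (v - ?a) < 5 / 2 * ?s"
        using vw \<delta> w(2) by (auto simp: \<delta>_def)
      then have v': "cmod (v - ?a) < ctr n / 4" using hrad_le'[of n] ctr_pos[of n] by linarith
      have "hrad m < hdist v m" for m
      proof (cases "m = n")
        case False
        show ?thesis using disc_ctr(3)[OF v' False] hrad_le[of m] ctr_pos[of m] by linarith
      qed (use v in simp)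
      moreover have "0 < cmod v" using disc_ctr(2)[OF v'] ctr_pos[of n] by linarith
      ultimately show "v \<in> zalcman" using disc_ctr(1)[OF v'] by (auto simp: zalcman_def)
    qed
  qed
  then show ?thesis by (simp add: \<delta>_def)
qed

text \<open>The factor -4 makes Y < 1 equivalent to |w|^2 > 3/4, the range of
  \<open>metric_near_outer_circle\<close>. Factoring 1 - |w|^2 leaves |w| / (1 + |w|) \<le> 1, and
  halving \<open>exterior_const\<close> absorbs the 2 from differentiating the square.\<close>

lemma bergman_ball_avoids_outer_circle:
  assumes "z0 \<in> zalcman"
  shows "\<exists>\<eta>>0. \<forall>z\<in>zalcman. bergman_dist zalcman z0 z < 1 \<longrightarrow> \<eta> \<le> - 4 * ((cmod (z - 0))\<^sup>2 - 1)"
proof (rule bergman_ball_avoids_circle[OF open_zalcman zalcman_subset _ _ _ assms, where C = "exterior_const / 2"])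
  fix w assume w: "w \<in> zalcman"
  then have w1: "cmod w < 1" by (simp add: zalcman_def)
  then have "(cmod w)\<^sup>2 < 1" by (simp add: abs_square_less_1)
  then show "0 < - 4 * ((cmod (w - 0))\<^sup>2 - 1)" by simp
  assume "- 4 * ((cmod (w - 0))\<^sup>2 - 1) < 1"
  then have "3 / 4 < (cmod w)\<^sup>2" by simp
  from metric_near_outer_circle[OF w this]
  have le: "exterior_const / (1 - cmod w) \<le> bergman_metric zalcman w 1" .
  have "exterior_const / 2 * (2 * \<bar>- 4\<bar> * cmod (w - 0) / (- 4 * ((cmod (w - 0))\<^sup>2 - 1)))
      = exterior_const / (1 - cmod w) * (cmod w / (1 + cmod w))"
  proof -
    have eq: "- 4 * ((cmod w)\<^sup>2 - 1) = 4 * ((1 - cmod w) * (1 + cmod w))"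
      by (simp add: power2_eq_square algebra_simps)
    show ?thesis unfolding diff_zero eq by simp
  qed
  also have "\<dots> \<le> exterior_const / (1 - cmod w) * 1"
  proof (rule mult_left_mono)
    have "0 < 1 + cmod w" by (intro add_pos_nonneg) auto
    then show "cmod w / (1 + cmod w) \<le> 1" by simp
  qed (use exterior_const_pos w1 in simp)
  finally show "exterior_const / 2 * (2 * \<bar>- 4\<bar> * cmod (w - 0) / (- 4 * ((cmod (w - 0))\<^sup>2 - 1))) \<le> bergman_metric zalcman w 1"
    using le by simp
qed (use exterior_const_pos in simp)

text \<open>Scaling by the inverse squared radius makes Y < 1 say that the squared distance to the
  centre is below twice the squared radius, which is inside the range of
  \<open>metric_near_hole\<close>.\<close>

lemma bergman_ball_avoids_hole:
  assumes "z0 \<in> zalcman"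
  shows "\<exists>\<eta>>0. \<forall>z\<in>zalcman. bergman_dist zalcman z0 z < 1 \<longrightarrow>
    \<eta> \<le> 1 / (hrad n)\<^sup>2 * ((hdist z n)\<^sup>2 - (hrad n)\<^sup>2)"
proof (rule bergman_ball_avoids_circle[OF open_zalcman zalcman_subset _ _ _ assms, where C = "exterior_const / 2"])
  let ?a = "complex_of_real (ctr n)" and ?s = "hrad n"
  fix w assume w: "w \<in> zalcman"
  then have wa: "?s < cmod (w - ?a)" by (simp add: zalcman_def)
  have "?s\<^sup>2 < (cmod (w - ?a))\<^sup>2" using wa by (intro power_strict_mono) (auto simp: less_imp_le)
  then show "0 < 1 / ?s\<^sup>2 * ((cmod (w - ?a))\<^sup>2 - ?s\<^sup>2)"
    by (intro mult_pos_pos divide_pos_pos zero_less_power hrad_pos) auto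
  assume "1 / ?s\<^sup>2 * ((cmod (w - ?a))\<^sup>2 - ?s\<^sup>2) < 1"
  then have lt: "(cmod (w - ?a))\<^sup>2 < 2 * ?s\<^sup>2" by (simp add: divide_less_eq)
  have "cmod (w - ?a) < 2 * ?s"
  proof (rule power_less_imp_less_base[of _ 2])
    have "2 * ?s\<^sup>2 \<le> (2 * ?s)\<^sup>2" by (simp add: power_mult_distrib)
    then show "(cmod (w - ?a))\<^sup>2 < (2 * ?s)\<^sup>2" using lt by linarith
  qed (simp add: less_imp_le)
  from metric_near_hole[OF w this]
  have le: "exterior_const / (cmod (w - ?a) - ?s) \<le> bergman_metric zalcman w 1" .
  have "exterior_const / 2 * (2 * \<bar>1 / ?s\<^sup>2\<bar> * cmod (w - ?a) / (1 / ?s\<^sup>2 * ((cmod (w - ?a))\<^sup>2 - ?s\<^sup>2)))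
      = exterior_const / (cmod (w - ?a) - ?s) * (cmod (w - ?a) / (cmod (w - ?a) + ?s))"
  proof -
    have eq: "(cmod (w - ?a))\<^sup>2 - ?s\<^sup>2 = (cmod (w - ?a) - ?s) * (cmod (w - ?a) + ?s)"
      by (simp add: power2_eq_square algebra_simps)
    have "?s \<noteq> 0" using hrad_pos[of n] by linarith
    then show ?thesis unfolding eq by simp
  qed
  also have "\<dots> \<le> exterior_const / (cmod (w - ?a) - ?s) * 1"
  proof (rule mult_left_mono)
    have "0 < cmod (w - ?a) + ?s" by (intro add_nonneg_pos) auto
    then show "cmod (w - ?a) / (cmod (w - ?a) + ?s) \<le> 1"
      using less_imp_le[OF hrad_pos[of n]] by simp
  qed (use exterior_const_pos wa in simp)
  finally show "exterior_const / 2 * (2 * \<bar>1 / ?s\<^sup>2\<bar> * cmod (w - ?a) / (1 / ?s\<^sup>2 * ((cmod (w - ?a))\<^sup>2 - ?s\<^sup>2))) \<le> bergman_metric zalcman w 1"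
    using le by simp
qed (use exterior_const_pos in simp)

text \<open>The function u is a sum of logarithmic cutoffs over disjoint annuli shrinking to 0, with
  weights C / (n + n0 + 1). It is 0 at z0 and exceeds 1 inside the innermost annulus, since partial
  sums of the harmonic series exceed 1 / C.\<close>

lemma bergman_ball_avoids_origin:
  assumes z0: "z0 \<in> zalcman"
  shows "\<exists>\<eta>>0. \<forall>z\<in>zalcman. bergman_dist zalcman z0 z < 1 \<longrightarrow> \<eta> \<le> cmod z"
proof -
  have "0 < cmod z0" using z0 by (auto simp: zalcman_def)
  \<comment> \<open>Starting at this index puts z0 outside all annuli used, so u vanishes
    there.\<close>
  then obtain n0 where n0: "ctr n0 < cmod z0" using ctr_lt by blast
  \<comment> \<open>A cutoff across the k-th annulus has gradient at most \<open>64 / ctr k\<close>: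
    the modulus is at least \<open>ctr k / 8\<close> and ln 2 at least 1/2.\<close>
  define C where "C = cross_const / 64"
  have C: "0 < C" using cross_const_pos by (simp add: C_def)
  have AB: "0 < (ctr n / 8)\<^sup>2" "(ctr n / 8)\<^sup>2 < (ctr n / 4)\<^sup>2" "0 < ctr n / 8" "ctr n / 8 < ctr n / 4" for n
    by (auto intro!: power_strict_mono simp: power_divide)
  have "\<not> summable (\<lambda>n. 1 / real (Suc n))"
    using not_summable_harmonic[where 'a = real] summable_Suc_iff[of "\<lambda>n. 1 / real n"]
    by (simp add: inverse_eq_divide)
  then have nb: "\<not> summable (\<lambda>n. 1 / real (Suc (n + n0)))"
    using summable_iff_shift[of "\<lambda>n. 1 / real (Suc n)" n0] by simp
  have "\<exists>M. 1 / C < (\<Sum>n<M. 1 / real (Suc (n + n0)))"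
  proof (rule ccontr)
    assume "\<nexists>M. 1 / C < (\<Sum>n<M. 1 / real (Suc (n + n0)))"
    then have "(\<Sum>k\<le>n. 1 / real (Suc (k + n0))) \<le> 1 / C" for n
      unfolding lessThan_Suc_atMost[symmetric] not_ex not_less by blast
    then have "summable (\<lambda>n. 1 / real (Suc (n + n0)))"
      by (intro bounded_imp_summable[where B = "1 / C"]) auto
    then show False using nb by blast
  qed
  then obtain M where M: "1 / C < (\<Sum>n<M. 1 / real (Suc (n + n0)))" by blast
  define R where "R n = rad 0 ((ctr (n + n0) / 8)\<^sup>2) ((ctr (n + n0) / 4)\<^sup>2)" for n
  define dR where "dR n = drad 0 ((ctr (n + n0) / 8)\<^sup>2) ((ctr (n + n0) / 4)\<^sup>2)" for n
  define u where "u z = (\<Sum>n<M. C / real (Suc (n + n0)) * R n z)" for z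
  define du where "du z = (\<Sum>n<M. (C / real (Suc (n + n0))) *\<^sub>R dR n z)" for z
  have der: "(u has_derivative (\<lambda>v. du w \<bullet> v)) (at w)" for w
    unfolding u_def du_def R_def dR_def inner_sum_left inner_scaleR_left
    by (intro has_derivative_sum has_derivative_mult_right has_derivative_rad AB)
  have cont: "continuous_on zalcman du"
    unfolding du_def dR_def by (intro continuous_intros continuous_drad AB)
  have dR0: "dR n z = 0" if "\<not> (ctr (n + n0) / 8 < cmod z \<and> cmod z < ctr (n + n0) / 4)" for n z
    unfolding dR_def using that by (intro drad_eq_0 AB) simp
  have bound: "cmod (du w) \<le> bergman_metric zalcman w 1" if w: "w \<in> zalcman" for w
  proof (cases "\<exists>k<M. ctr (k + n0) / 8 < cmod w \<and> cmod w < ctr (k + n0) / 4")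
    case True
    then obtain k where k: "k < M" "ctr (k + n0) / 8 < cmod w" "cmod w < ctr (k + n0) / 4" by blast
    have other: "dR n w = 0" if nk: "n \<noteq> k" for n
    proof (rule dR0)
      consider "n < k" | "k < n" using nk by linarith
      then show "\<not> (ctr (n + n0) / 8 < cmod w \<and> cmod w < ctr (n + n0) / 4)"
      proof cases
        case 1
        then have "ctr (k + n0) \<le> ctr (n + n0) / 16" by (intro ctr_less) simp
        then show ?thesis using k ctr_pos[of "k + n0"] ctr_pos[of "n + n0"] by linarith
      next
        case 2
        then have "ctr (n + n0) \<le> ctr (k + n0) / 16" by (intro ctr_less) simp
        then show ?thesis using k ctr_pos[of "k + n0"] ctr_pos[of "n + n0"] by linarith
      qed
    qed
    have "du w = (\<Sum>n\<in>{k}. (C / real (Suc (n + n0))) *\<^sub>R dR n w)"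
      unfolding du_def using k(1) other by (intro sum.mono_neutral_right) auto
    then have "cmod (du w) = C / real (Suc (k + n0)) * cmod (dR k w)" using C by simp
    also have "cmod (dR k w) \<le> 64 / ctr (k + n0)"
    proof -
      have "cmod (dR k w) \<le> 4 / (cmod w * ln 2)"
        using cmod_drad_annulus[OF AB(3,4)[of "k + n0"], of 0 w] k by (simp add: dR_def)
      also have "\<dots> \<le> 4 / (ctr (k + n0) / 8 * (1 / 2))"
      proof (rule divide_left_mono)
        have "0 < cmod w" using k(2) ctr_pos[of "k + n0"] by linarith
        then show "0 < cmod w * ln 2 * (ctr (k + n0) / 8 * (1 / 2))" by simp
        show "ctr (k + n0) / 8 * (1 / 2) \<le> cmod w * ln 2"
          using k(2) ln2_ge_two_thirds by (intro mult_mono) auto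
      qed simp
      finally show ?thesis by simp
    qed
    then have "C / real (Suc (k + n0)) * cmod (dR k w) \<le> C / real (Suc (k + n0)) * (64 / ctr (k + n0))"
      using C by (intro mult_left_mono) auto
    also have "\<dots> = cross_const / (ctr (k + n0) * real (Suc (k + n0)))"
    proof -
      have "a / 64 / x * (64 / y) = a / (y * x)" for a x y :: real by (simp add: mult.commute)
      then show ?thesis unfolding C_def .
    qed
    also have "\<dots> \<le> bergman_metric zalcman w 1" using k by (intro bergman_metric_crossing) auto
    finally show ?thesis .
  next
    case False
    then have "du w = 0" unfolding du_def using dR0 by (intro sum.neutral) auto
    then show ?thesis using bergman_metric_nonneg[OF open_zalcman zalcman_subset w] by simp
  qed
  have "u z0 = 0"
  proof -
    have "R n z0 = 0" for n
    proof -
      have "ctr (n + n0) \<le> ctr n0" by (rule ctr_mono) simp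
      then have "ctr (n + n0) / 4 \<le> cmod (z0 - 0)" using n0 ctr_pos[of "n + n0"] unfolding diff_zero by linarith
      then show ?thesis unfolding R_def by (intro rad_eq_0 AB)
    qed
    then show ?thesis by (simp add: u_def)
  qed
  have "ctr (M + n0) / 8 \<le> cmod z" if z: "z \<in> zalcman" "bergman_dist zalcman z0 z < 1" for z
  proof (rule ccontr)
    assume small: "\<not> ctr (M + n0) / 8 \<le> cmod z"
    have "R n z = 1" if "n < M" for n
    proof -
      have "ctr (M + n0) \<le> ctr (n + n0)" using that by (intro ctr_mono) simp
      then have "cmod (z - 0) \<le> ctr (n + n0) / 8" using small unfolding diff_zero by linarith
      then show ?thesis unfolding R_def by (intro rad_eq_1 AB)
    qed
    then have "u z = C * (\<Sum>n<M. 1 / real (Suc (n + n0)))" by (simp add: u_def sum_distrib_left)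
    then have "1 < u z" using M C by (simp add: divide_less_eq mult.commute)
    moreover have "ennreal \<bar>u z - u z0\<bar> < 1"
      using bergman_dist_ge[OF open_zalcman bounded_zalcman der cont bound, of z z0] z(2) by (rule le_less_trans)
    then have "\<bar>u z - u z0\<bar> < 1" by (rule ennreal_less_1D)
    ultimately show False using \<open>u z0 = 0\<close> by simp
  qed
  then show ?thesis by (intro exI[of _ "ctr (M + n0) / 8"]) auto
qed

text \<open>Crossing the annulus between radii r and 2 r has Bergman length at least \<kappa>: the
  metric there is at least m, because radius 3 r leaves a disc of radius r about each of its points,
  and the unit cutoff has gradient at most 4 / (r ln 2).\<close>

lemma bergman_dist_close:
  assumes D: "open D" "D \<subseteq> cball 0 1" and r: "0 < r" "cball l (3 * r) \<subseteq> D"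
  shows "\<exists>\<kappa>>0. \<forall>w z. cmod (w - l) \<le> r \<longrightarrow> bergman_dist D w z < ennreal \<kappa> \<longrightarrow> cmod (z - l) < 2 * r"
proof -
  have bD: "bounded D" using D(2) bounded_subset[OF bounded_cball] by blast
  define m where "m = r / sqrt (4 * pi * point_const)"
  have m: "0 < m" using r point_const_pos by (simp add: m_def)
  have AB: "0 < r\<^sup>2" "r\<^sup>2 < (2 * r)\<^sup>2" "r < 2 * r" using r by (auto intro!: power_strict_mono)
  define \<kappa> where "\<kappa> = m * r * ln 2 / 4"
  have \<kappa>: "0 < \<kappa>" using m r by (simp add: \<kappa>_def)
  define u where "u z = \<kappa> * rad l (r\<^sup>2) ((2 * r)\<^sup>2) z" for z
  define du where "du z = \<kappa> *\<^sub>R drad l (r\<^sup>2) ((2 * r)\<^sup>2) z" for z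
  have der: "(u has_derivative (\<lambda>v. du w \<bullet> v)) (at w)" for w
    unfolding u_def du_def inner_scaleR_left by (intro has_derivative_mult_right has_derivative_rad AB)
  have cont: "continuous_on D du" unfolding du_def by (intro continuous_intros continuous_drad AB)
  have bound: "cmod (du w) \<le> bergman_metric D w 1" if w: "w \<in> D" for w
  proof (cases "r < cmod (w - l) \<and> cmod (w - l) < 2 * r")
    case True
    have "cmod (drad l (r\<^sup>2) ((2 * r)\<^sup>2) w) \<le> 4 / (cmod (w - l) * ln 2)"
      using cmod_drad_annulus[OF r(1) AB(3), of l w] True r by simp
    also have "\<dots> \<le> 4 / (r * ln 2)" using True r by (intro divide_left_mono mult_right_mono mult_pos_pos) auto
    finally have "\<kappa> * cmod (drad l (r\<^sup>2) ((2 * r)\<^sup>2) w) \<le> \<kappa> * (4 / (r * ln 2))"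
      using \<kappa> by (intro mult_left_mono) auto
    then have "cmod (du w) \<le> \<kappa> * (4 / (r * ln 2))" unfolding du_def norm_scaleR using \<kappa> by simp
    also have "\<dots> = m" using r by (simp add: \<kappa>_def)
    also have "m \<le> bergman_metric D w 1"
    proof -
      have "cball w r \<subseteq> D"
      proof
        fix v assume "v \<in> cball w r"
        then have "v \<in> cball l (3 * r)"
          using True dist_triangle[of l v w] by (auto simp: dist_norm norm_minus_commute)
        then show "v \<in> D" using r by blast
      qed
      then show ?thesis unfolding m_def by (rule bergman_metric_interior[OF D r(1)])
    qed
    finally show ?thesis .
  next
    case False
    then have "du w = 0" unfolding du_def using drad_eq_0[OF r(1) AB(3) False] by simp
    then show ?thesis using bergman_metric_nonneg[OF D w] by simp
  qed
  have "cmod (z - l) < 2 * r" if wz: "cmod (w - l) \<le> r" "bergman_dist D w z < ennreal \<kappa>" for w z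
  proof (rule ccontr)
    assume "\<not> cmod (z - l) < 2 * r"
    then have "u z = 0" unfolding u_def using rad_eq_0[OF r(1) AB(3), of z l] by simp
    moreover have "u w = \<kappa>" unfolding u_def using rad_eq_1[OF r(1) AB(3) wz(1)] by simp
    moreover have "ennreal \<bar>u z - u w\<bar> < ennreal \<kappa>"
      using bergman_dist_ge[OF D(1) bD der cont bound, of z w] wz(2) by (rule le_less_trans)
    ultimately show False using \<kappa> by simp
  qed
  then show ?thesis using \<kappa> by blast
qed

text \<open>A subsequence converges in the closed unit disc. A tail of the sequence stays in a
  Bergman ball of radius 1, so the bounds away from each boundary component pass to the limit and
  place it in the domain; \<open>bergman_dist_close\<close> then carries convergence from the
  subsequence to the whole sequence.\<close>

lemma bergman_complete_zalcman: "bergman_complete zalcman"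
  unfolding bergman_complete_def
proof (intro allI impI)
  fix x assume x: "bergman_Cauchy zalcman x"
  then have xD: "x k \<in> zalcman" for k by (simp add: bergman_Cauchy_def)
  have Cauchy: "\<exists>N. \<forall>m\<ge>N. \<forall>n\<ge>N. bergman_dist zalcman (x m) (x n) < ennreal e" if "0 < e" for e
    using x that by (simp add: bergman_Cauchy_def)
  obtain N where N: "\<And>n. N \<le> n \<Longrightarrow> bergman_dist zalcman (x N) (x n) < 1"
    using Cauchy[of 1] by auto
  have "compact (cball (0::complex) 1)" by simp
  moreover have "\<forall>n. x n \<in> cball 0 1" using xD zalcman_subset by blast
  ultimately obtain l r where r: "strict_mono (r :: nat \<Rightarrow> nat)" and lim: "(x \<circ> r) \<longlonglongrightarrow> l"
    unfolding compact_def by blast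
  have ev: "\<forall>\<^sub>F k in sequentially. N \<le> r k"
    using filterlim_subseq[OF r] by (simp add: filterlim_at_top)
  have nlim: "(\<lambda>k. cmod ((x \<circ> r) k - c)) \<longlonglongrightarrow> cmod (l - c)" for c
    by (intro tendsto_intros lim)
  have "cmod l < 1"
  proof -
    obtain \<eta> where \<eta>: "0 < \<eta>" "\<And>z. z \<in> zalcman \<Longrightarrow> bergman_dist zalcman (x N) z < 1 \<Longrightarrow> \<eta> \<le> - 4 * ((cmod (z - 0))\<^sup>2 - 1)"
      using bergman_ball_avoids_outer_circle[OF xD[of N]] by blast
    have "\<eta> \<le> - 4 * ((cmod (l - 0))\<^sup>2 - 1)"
      by (rule tendsto_lowerbound[OF tendsto_mult[OF tendsto_const tendsto_diff[OF tendsto_power[OF nlim] tendsto_const]] eventually_mono[OF ev]])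
        (use \<eta>(2)[OF xD N] in auto)
    then have "(cmod l)\<^sup>2 < 1" using \<eta>(1) by simp
    then show ?thesis by (simp add: abs_square_less_1)
  qed
  moreover have "l \<noteq> 0"
  proof -
    obtain \<eta> where \<eta>: "0 < \<eta>" "\<And>z. z \<in> zalcman \<Longrightarrow> bergman_dist zalcman (x N) z < 1 \<Longrightarrow> \<eta> \<le> cmod z"
      using bergman_ball_avoids_origin[OF xD[of N]] by blast
    have "\<eta> \<le> cmod l"
      by (rule tendsto_lowerbound[OF tendsto_norm[OF lim] eventually_mono[OF ev]])
        (auto intro!: \<eta> xD N)
    then show ?thesis using \<eta>(1) by auto
  qed
  moreover have "hrad n < hdist l n" for n
  proof -
    obtain \<eta> where \<eta>: "0 < \<eta>" "\<And>z. z \<in> zalcman \<Longrightarrow> bergman_dist zalcman (x N) z < 1 \<Longrightarrow>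
        \<eta> \<le> 1 / (hrad n)\<^sup>2 * ((hdist z n)\<^sup>2 - (hrad n)\<^sup>2)"
      using bergman_ball_avoids_hole[OF xD[of N], of n] by blast
    have "\<eta> \<le> 1 / (hrad n)\<^sup>2 * ((hdist l n)\<^sup>2 - (hrad n)\<^sup>2)"
      by (rule tendsto_lowerbound[OF tendsto_mult[OF tendsto_const tendsto_diff[OF tendsto_power[OF nlim] tendsto_const]] eventually_mono[OF ev]])
        (use \<eta>(2)[OF xD N] in auto)
    then have "0 < 1 / (hrad n)\<^sup>2 * ((hdist l n)\<^sup>2 - (hrad n)\<^sup>2)" using \<eta>(1) by linarith
    then have "(hrad n)\<^sup>2 < (hdist l n)\<^sup>2" by (simp add: zero_less_divide_iff)
    then show ?thesis by (rule power_less_imp_less_base) simp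
  qed
  ultimately have l: "l \<in> zalcman" by (simp add: zalcman_def)
  have "x \<longlonglongrightarrow> l"
  proof (rule metric_LIMSEQ_I)
    fix e :: real assume e: "0 < e"
    obtain R where R: "0 < R" "cball l R \<subseteq> zalcman" using open_zalcman l open_contains_cball by blast
    \<comment> \<open>The disc of radius 3 d must lie in the domain, and the resulting closeness 2 d
      must not exceed e.\<close>
    define d where "d = min (R / 3) (e / 2)"
    have d: "0 < d" "3 * d \<le> R" "2 * d \<le> e" using R e by (auto simp: d_def)
    have "cball l (3 * d) \<subseteq> zalcman" using R subset_cball[OF d(2)] by blast
    then obtain \<kappa> where \<kappa>: "0 < \<kappa>" "\<And>w z. cmod (w - l) \<le> d \<Longrightarrow> bergman_dist zalcman w z < ennreal \<kappa> \<Longrightarrow> cmod (z - l) < 2 * d"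
      using bergman_dist_close[OF open_zalcman zalcman_subset d(1)] by blast
    obtain N' where N': "\<And>m n. N' \<le> m \<Longrightarrow> N' \<le> n \<Longrightarrow> bergman_dist zalcman (x m) (x n) < ennreal \<kappa>"
      using Cauchy[OF \<kappa>(1)] by blast
    have "\<forall>\<^sub>F k in sequentially. N' \<le> r k \<and> dist ((x \<circ> r) k) l < d"
      using filterlim_subseq[OF r] tendstoD[OF lim d(1)] by (simp add: filterlim_at_top eventually_conj_iff)
    from eventually_happens'[OF sequentially_bot this]
    obtain k where k: "N' \<le> r k" "dist (x (r k)) l < d" unfolding o_def by blast
    have "dist (x n) l < e" if "N' \<le> n" for n
    proof -
      have "cmod (x n - l) < 2 * d"
        by (rule \<kappa>(2)[of "x (r k)"]) (use k N' that in \<open>auto simp: dist_norm\<close>)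
      then show ?thesis using d by (simp add: dist_norm)
    qed
    then show "\<exists>no. \<forall>n\<ge>no. dist (x n) l < e" by blast
  qed
  then show "\<exists>l\<in>zalcman. x \<longlonglongrightarrow> l" using l by blast
qed

text \<open>The points \<open>ctr k / 4\<close> lie on the outer edges of the crossing annuli, where
  the kernel bound holds, and tend to the frontier point 0.\<close>

lemma finite_boundary_liminf_zalcman: "finite_boundary_liminf zalcman"
proof -
  define z where "z k = complex_of_real (ctr k / 4)" for k
  have nz: "cmod (z k) = ctr k / 4" for k by (simp add: z_def)
  have zk: "ctr k / 8 \<le> cmod (z k)" "cmod (z k) \<le> ctr k / 4" for k by (simp_all add: nz)
  have zD: "z k \<in> zalcman" for k by (rule crossing_annulus(1)[OF zk])
  have "(\<lambda>k. (1 / 16 :: real) ^ k) \<longlonglongrightarrow> 0" by (rule LIMSEQ_realpow_zero) auto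
  then have lim: "(\<lambda>k. cmod (z k)) \<longlonglongrightarrow> 0"
  proof (rule tendsto_sandwich[OF _ _ tendsto_const, rotated 2])
    show "\<forall>\<^sub>F k in sequentially. cmod (z k) \<le> (1 / 16) ^ k"
    proof (intro always_eventually allI)
      fix k
      show "cmod (z k) \<le> (1 / 16) ^ k" using ctr_le_power[of k] ctr_pos[of k] unfolding nz by linarith
    qed
  qed simp
  have "0 \<notin> zalcman" by (simp add: zalcman_def)
  moreover have "0 \<in> closure zalcman"
  proof -
    have "z \<longlonglongrightarrow> 0" using lim by (rule tendsto_norm_zero_cancel)
    then show ?thesis using zD closure_sequential by blast
  qed
  ultimately have fr: "0 \<in> frontier zalcman" using open_zalcman by (simp add: frontier_def interior_open)
  have "(\<lambda>k. infdist (z k) (frontier zalcman)) \<longlonglongrightarrow> 0"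
  proof (rule tendsto_sandwich[OF _ _ tendsto_const lim])
    show "\<forall>\<^sub>F k in sequentially. infdist (z k) (frontier zalcman) \<le> cmod (z k)"
      using infdist_le[OF fr] by (simp add: always_eventually)
  qed (simp add: infdist_nonneg)
  moreover have "bergman_kernel zalcman (z k) \<le> kernel_bound" for k
    using crossing_annulus[OF zk] by (intro bergman_kernel_zalcman_le) auto
  ultimately show ?thesis unfolding finite_boundary_liminf_def using zD by blast
qed

theorem theorem5:
  shows "\<exists>D. bounded_domain D \<and> finite_boundary_liminf D \<and> bergman_complete D"
  using bounded_domain_zalcman finite_boundary_liminf_zalcman bergman_complete_zalcman by blast

end
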